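(* Let $P_1$ and $P_2$ be two probability measures on the positive integers such that $P_1$ stochastically dominates $P_2$ and $P_1\ne P_2$. For $i=1,2$ let $m_i:=E_{P_i}[Z]$ be the mean of $P_i$, let $Z_i^{(n)}$ be the number of individuals in the $n$th generation of $GW(P_i)$, and let $P_i^{(n)}$ be the law of $Z_i^{(n)}$. Assume that there exists $\theta>0$ such that $E[e^{\theta Z_1^{(1)}}]<\infty$. Let $f$ be the generating function of $P_1$ and let $\alpha:=-\log f'(0)/\log f'(1)$ (with $\alpha=\infty$ if $P_1\{1\}=0$). Assume further that $$m_1>m_2^{\max\{\frac{2}{\alpha},\,\frac1\alpha+1\}}$$ (if $P_1\{1\}=0$, then $\alpha=\infty$ and this condition is automatically satisfied). Then for every $\beta>\frac{23}{4}$ there exists some $k=k(P_1,P_2,\beta)$ such that $$v(\beta,P_1^{(k)})>v(\beta,P_2^{(k)}).$$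
   Context: For a probability measure $P$ on the positive integers, $GW(P)$ denotes the Galton-Watson tree (random rooted tree, root in generation $0$) in which the numbers of children of all individuals are i.i.d. with law $P$; it has no leaves. For $\beta>0$ and a rooted tree, the $\beta$-biased random walk $(X_n)_{n\ge0}$ starts at the root; from the root it moves to each child of the root with equal probability; from a non-root vertex $x$ with $k$ children it moves to the parent of $x$ with probability $\frac{1}{1+\beta k}$ and to each given child of $x$ with probability $\frac{\beta}{1+\beta k}$. Write $|x|$ for the distance of $x$ from the root. The speed $v(\beta,P):=\lim_{n\to\infty}|X_n|/n$ of the $\beta$-biased walk on $GW(P)$ is the almost sure limit under the averaged law (choose the tree according to $GW(P)$, then run the walk on it); for $\beta>1/E_P[Z]$, with $Z$ having law $P$, this limit is known to exist almost surely and to be a non-random constant. In particular $v(\beta,P_i^{(k)})$ is the speed of the $\beta$-biased walk on a Galton-Watson tree having $P_i^{(k)}$ as its offspring distribution; here $k\geq 1$ is an integer. The generating function is $f(s)=\sum_{j\ge1}P_1\{j\}s^j$, so $f'(0)=P_1\{1\}$ and $f'(1)=m_1$. $P_1$ stochastically dominates $P_2$ if $P_1([k,\infty))\ge P_2([k,\infty))$ for all $k$; the convention is that stochastic domination also includes $P_1\ne P_2$. When $\alpha=\infty$, $1/\alpha$ and $2/\alpha$ are read as $0$. *)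

theory Defs
  imports "HOL-Probability.Probability"
begin

text \<open>Rooted trees are encoded by their offspring numbers in Ulam-Harris notation: vertices are
  finite words over the naturals, the root is the empty word, and \<open>t u\<close> is the number of children
  \<open>u @ [0], \<dots>, u @ [t u - 1]\<close> of \<open>u\<close>. The values \<open>t u\<close> at words \<open>u\<close> that are not vertices
  of the tree are irrelevant.\<close>

type_synonym vertex = "nat list"
type_synonym tree = "vertex \<Rightarrow> nat"

definition children :: "tree \<Rightarrow> vertex \<Rightarrow> vertex set" where
  "children t u = {u @ [i] | i. i < t u}"

primrec generation :: "tree \<Rightarrow> nat \<Rightarrow> vertex set" where
  "generation t 0 = {[]}"
| "generation t (Suc n) = (\<Union>u\<in>generation t n. children t u)"

definition generation_size :: "nat \<Rightarrow> tree \<Rightarrow> nat" where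
  "generation_size n t = card (generation t n)"

definition GW :: "nat pmf \<Rightarrow> tree measure" where
  "GW P = (\<Pi>\<^sub>M u\<in>UNIV. measure_pmf P)"

definition generation_law :: "nat pmf \<Rightarrow> nat \<Rightarrow> nat pmf" where
  "generation_law P n = Abs_pmf (distr (GW P) (count_space UNIV) (generation_size n))"

text \<open>For \<open>x \<noteq> []\<close> the parent of \<open>x\<close> is \<open>butlast x\<close>.\<close>

definition step_prob :: "real \<Rightarrow> tree \<Rightarrow> vertex \<Rightarrow> vertex \<Rightarrow> real" where
  "step_prob \<beta> t x y =
     (if x = [] then (if y \<in> children t x then 1 / real (t x) else 0)
      else if y = butlast x then 1 / (1 + \<beta> * real (t x))
      else if y \<in> children t x then \<beta> / (1 + \<beta> * real (t x))
      else 0)"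

definition step :: "real \<Rightarrow> tree \<Rightarrow> vertex \<Rightarrow> vertex pmf" where
  "step \<beta> t x = embed_pmf (step_prob \<beta> t x)"

text \<open>The law of the walk started at the root, on a fixed tree. It is realised by means of
  independent moves \<open>\<xi> (n, x)\<close>, one for each time \<open>n\<close> and vertex \<open>x\<close>, with \<open>\<xi> (n, x)\<close> distributed
  as a step from \<open>x\<close>: at time \<open>n\<close> the walk uses the move attached to \<open>n\<close> and to its current position.
  Lemma \<open>emeasure_walk_cylinder\<close> below shows that this is the Markov chain with transition
  probabilities \<open>step \<beta> t\<close>.\<close>

abbreviation paths :: "(nat \<Rightarrow> vertex) measure" where
  "paths \<equiv> (\<Pi>\<^sub>M n\<in>UNIV. count_space UNIV)"

primrec follow :: "(nat \<times> vertex \<Rightarrow> vertex) \<Rightarrow> nat \<Rightarrow> vertex" where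
  "follow \<xi> 0 = []"
| "follow \<xi> (Suc n) = \<xi> (n, follow \<xi> n)"

definition walk :: "real \<Rightarrow> tree \<Rightarrow> (nat \<Rightarrow> vertex) measure" where
  "walk \<beta> t = distr (\<Pi>\<^sub>M p\<in>UNIV. measure_pmf (step \<beta> t (snd p))) paths follow"

text \<open>The joint law of the Galton-Watson tree and of the walk on it.\<close>

definition averaged :: "real \<Rightarrow> nat pmf \<Rightarrow> (tree \<times> (nat \<Rightarrow> vertex)) measure" where
  "averaged \<beta> P =
     GW P \<bind> (\<lambda>t. distr (walk \<beta> t) (GW P \<Otimes>\<^sub>M paths) (\<lambda>X. (t, X)))"

definition speed :: "real \<Rightarrow> nat pmf \<Rightarrow> real" where
  "speed \<beta> P =
     (THE v. AE (t, X) in averaged \<beta> P. (\<lambda>n. real (length (X n)) / real n) \<longlonglongrightarrow> v)"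

definition stochastically_dominates :: "nat pmf \<Rightarrow> nat pmf \<Rightarrow> bool" where
  "stochastically_dominates P Q \<longleftrightarrow>
     (\<forall>k. measure_pmf.prob P {k..} \<ge> measure_pmf.prob Q {k..}) \<and> P \<noteq> Q"

definition mean :: "nat pmf \<Rightarrow> real" where
  "mean P = measure_pmf.expectation P real"

definition gen_fun :: "nat pmf \<Rightarrow> real \<Rightarrow> real" where
  "gen_fun P s = (\<Sum>j. pmf P j * s ^ j)"

text \<open>The two-sided derivative at \<open>1\<close> is meaningful when \<open>P\<close> has an exponential moment, since then the
  radius of convergence exceeds \<open>1\<close>. Extended real arithmetic provides \<open>1 / \<infinity> = 2 / \<infinity> = 0\<close>.\<close>

definition alpha :: "nat pmf \<Rightarrow> ereal" where
  "alpha P = (if pmf P 1 = 0 then \<infinity>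
     else ereal (- ln (deriv (gen_fun P) 0) / ln (deriv (gen_fun P) 1)))"


subsection \<open>Well-definedness\<close>

lemma space_GW [simp]: "space (GW P) = UNIV"
  by (auto simp: GW_def space_PiM)

lemma prob_space_GW: "prob_space (GW P)"
  unfolding GW_def by (intro prob_space_PiM measure_pmf.prob_space_axioms)

lemma measurable_GW_component [measurable]: "(\<lambda>t. t u) \<in> GW P \<rightarrow>\<^sub>M count_space UNIV"
proof -
  have "(\<lambda>t. t u) \<in> (\<Pi>\<^sub>M u\<in>UNIV. measure_pmf P) \<rightarrow>\<^sub>M measure_pmf P"
    by (rule measurable_component_singleton) simp
  then show ?thesis
    using measurable_cong_sets[OF refl, of "measure_pmf P" "count_space UNIV"] by (simp add: GW_def)
qed

lemma finite_children [simp]: "finite (children t u)"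
  by (simp add: children_def)

lemma finite_generation [simp]: "finite (generation t n)"
  by (induction n) auto

lemma card_children [simp]: "card (children t u) = t u"
proof -
  have "children t u = (\<lambda>i. u @ [i]) ` {..<t u}" by (auto simp: children_def)
  then show ?thesis by (simp add: card_image inj_on_def)
qed

lemma mem_generation_measurable [measurable]:
  "Measurable.pred (GW P) (\<lambda>t. u \<in> generation t n)"
proof (induction n arbitrary: u)
  case (Suc n)
  note Suc[measurable]
  have "(\<lambda>t. u \<in> generation t (Suc n)) =
      (\<lambda>t. u \<noteq> [] \<and> butlast u \<in> generation t n \<and> last u < t (butlast u))"
  proof (rule ext)
    fix t
    show "(u \<in> generation t (Suc n)) =
        (u \<noteq> [] \<and> butlast u \<in> generation t n \<and> last u < t (butlast u))"
      by (cases u rule: rev_cases) (auto simp: children_def)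
  qed
  then show ?case by simp
qed simp

lemma measurable_generation_size [measurable]:
  "generation_size n \<in> GW P \<rightarrow>\<^sub>M count_space UNIV"
proof -
  have "Measurable.pred (GW P) (\<lambda>t. generation_size n t = j)" for j
  proof -
    have "(generation_size n t = j) \<longleftrightarrow>
        (\<exists>us. distinct us \<and> length us = j \<and> (\<forall>u. u \<in> generation t n \<longleftrightarrow> u \<in> set us))" for t
    proof
      assume j: "generation_size n t = j"
      obtain us where "set us = generation t n" "distinct us"
        using finite_distinct_list[OF finite_generation] by blast
      then show "\<exists>us. distinct us \<and> length us = j \<and> (\<forall>u. u \<in> generation t n \<longleftrightarrow> u \<in> set us)"
        using j by (intro exI[of _ us]) (auto simp: generation_size_def distinct_card[symmetric])
    next
      assume "\<exists>us. distinct us \<and> length us = j \<and> (\<forall>u. u \<in> generation t n \<longleftrightarrow> u \<in> set us)"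
      then obtain us where "distinct us" "length us = j" "generation t n = set us" by blast
      then show "generation_size n t = j" by (simp add: generation_size_def distinct_card)
    qed
    then show ?thesis by simp
  qed
  then have "{t. generation_size n t = j} \<in> sets (GW P)" for j
    by (simp add: pred_def)
  then show ?thesis
    by (simp add: measurable_count_space_eq2_countable vimage_def)
qed

lemma measure_pmf_generation_law:
  "measure_pmf (generation_law P n) = distr (GW P) (count_space UNIV) (generation_size n)"
    (is "_ = ?D")
proof -
  interpret D: prob_space ?D
    by (rule prob_space.prob_space_distr[OF prob_space_GW]) measurable
  have "AE x in ?D. measure ?D {x} \<noteq> 0"
    by (subst D.AE_support_countable) (auto intro!: exI[of _ UNIV] simp: AE_count_space)
  then show ?thesis
    unfolding generation_law_def by (intro Abs_pmf_inverse) (simp add: D.prob_space_axioms)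
qed

lemma pmf_step:
  assumes "\<beta> > 0" "t x > 0"
  shows "pmf (step \<beta> t x) y = step_prob \<beta> t x y"
proof -
  have nn: "step_prob \<beta> t x y \<ge> 0" for y
    using assms by (auto simp: step_prob_def)
  have disj: "butlast x \<notin> children t x" if "x \<noteq> []"
    by (auto simp: children_def dest: arg_cong[where f = length])
  have pos: "1 + \<beta> * real (t x) > 0" using assms by (simp add: add_pos_pos)
  let ?S = "insert (butlast x) (children t x)"
  have "(\<integral>\<^sup>+y. ennreal (step_prob \<beta> t x y) \<partial>count_space UNIV) =
      (\<integral>\<^sup>+y. ennreal (step_prob \<beta> t x y) \<partial>count_space ?S)"
    by (rule nn_integral_count_space_eq) (auto simp: step_prob_def)
  also have "\<dots> = (\<Sum>y\<in>?S. ennreal (step_prob \<beta> t x y))"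
    by (rule nn_integral_count_space_finite) simp
  also have "\<dots> = ennreal (\<Sum>y\<in>?S. step_prob \<beta> t x y)"
    using nn by (rule sum_ennreal)
  also have "(\<Sum>y\<in>?S. step_prob \<beta> t x y) = 1"
  proof (cases "x = []")
    case True
    have "(\<Sum>y\<in>?S. step_prob \<beta> t x y) = (\<Sum>y\<in>children t x. step_prob \<beta> t x y)"
      by (rule sum.mono_neutral_right) (auto simp: step_prob_def True)
    also have "\<dots> = (\<Sum>y\<in>children t x. 1 / real (t x))"
      by (rule sum.cong) (auto simp: step_prob_def True)
    finally show ?thesis using assms by simp
  next
    case False
    have "(\<Sum>y\<in>?S. step_prob \<beta> t x y) =
        step_prob \<beta> t x (butlast x) + (\<Sum>y\<in>children t x. step_prob \<beta> t x y)"
      using disj[OF False] by simp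
    also have "(\<Sum>y\<in>children t x. step_prob \<beta> t x y) =
        (\<Sum>y\<in>children t x. \<beta> / (1 + \<beta> * real (t x)))"
      using disj[OF False] False by (intro sum.cong) (auto simp: step_prob_def)
    finally show ?thesis
      using pos False by (simp add: step_prob_def field_simps)
  qed
  finally show ?thesis
    unfolding step_def using nn by (intro pmf_embed_pmf) auto
qed

lemma follow_measurable [measurable]:
  assumes "\<And>p. sets (M p) = UNIV"
  shows "follow \<in> (\<Pi>\<^sub>M p\<in>UNIV. M p) \<rightarrow>\<^sub>M paths"
proof -
  have comp: "(\<lambda>\<xi>. \<xi> p) \<in> (\<Pi>\<^sub>M p\<in>UNIV. M p) \<rightarrow>\<^sub>M count_space UNIV" for p
  proof -
    have "(\<lambda>\<xi>. \<xi> p) \<in> (\<Pi>\<^sub>M p\<in>UNIV. M p) \<rightarrow>\<^sub>M M p"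
      by (rule measurable_component_singleton) simp
    then show ?thesis
      using measurable_cong_sets[OF refl, of "M p" "count_space UNIV" "Pi\<^sub>M UNIV M"] assms by simp
  qed
  have "(\<lambda>\<xi>. follow \<xi> n) \<in> (\<Pi>\<^sub>M p\<in>UNIV. M p) \<rightarrow>\<^sub>M count_space UNIV" for n
  proof (induction n)
    case (Suc n)
    show ?case
      unfolding follow.simps
      by (rule measurable_compose_countable[OF comp Suc])
  qed simp
  then show ?thesis
    by (intro measurable_PiM_single') (auto simp: space_PiM)
qed

lemma prob_space_walk: "prob_space (walk \<beta> t)"
  unfolding walk_def
  by (intro prob_space.prob_space_distr prob_space_PiM measure_pmf.prob_space_axioms follow_measurable)
    simp

lemma sets_walk [simp, measurable_cong]: "sets (walk \<beta> t) = sets paths"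
  by (simp add: walk_def)

lemma cylinder_sets: "{X. \<forall>i\<le>n. X i = xs i} \<in> sets paths"
proof -
  have "{X \<in> space paths. \<forall>i\<in>{..n}. X i = xs i} \<in> sets paths"
    by measurable
  then show ?thesis by (simp add: space_PiM Ball_def)
qed

lemma emeasure_walk_cylinder:
  "emeasure (walk \<beta> t) {X. \<forall>i\<le>n. X i = xs i} =
     (if xs 0 = [] then \<Prod>i<n. ennreal (pmf (step \<beta> t (xs i)) (xs (Suc i))) else 0)"
proof -
  let ?M = "\<lambda>p :: nat \<times> vertex. measure_pmf (step \<beta> t (snd p))"
  interpret product_prob_space ?M UNIV
    by unfold_locales
  have fol: "(\<forall>i\<le>n. follow \<xi> i = xs i) \<longleftrightarrow> xs 0 = [] \<and> (\<forall>i<n. \<xi> (i, xs i) = xs (Suc i))" for \<xi>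
  proof (induction n)
    case (Suc n)
    then show ?case by (auto simp: le_Suc_eq less_Suc_eq)
  qed auto
  have "emeasure (walk \<beta> t) {X. \<forall>i\<le>n. X i = xs i} =
      emeasure (PiM UNIV ?M) {\<xi>. xs 0 = [] \<and> (\<forall>i<n. \<xi> (i, xs i) = xs (Suc i))}"
    unfolding walk_def using cylinder_sets[of n xs]
    by (subst emeasure_distr) (auto simp: space_PiM fol vimage_def intro!: follow_measurable)
  also have "\<dots> = (if xs 0 = [] then \<Prod>i<n. ennreal (pmf (step \<beta> t (xs i)) (xs (Suc i))) else 0)"
  proof (cases "xs 0 = []")
    case True
    let ?J = "(\<lambda>i. (i, xs i)) ` {..<n}"
    have "{\<xi>. xs 0 = [] \<and> (\<forall>i<n. \<xi> (i, xs i) = xs (Suc i))} =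
        {\<xi>\<in>space (PiM UNIV ?M). \<forall>p\<in>?J. \<xi> p \<in> {xs (Suc (fst p))}}"
      using True by (auto simp: space_PiM)
    also have "emeasure (PiM UNIV ?M) \<dots> = (\<Prod>p\<in>?J. emeasure (?M p) {xs (Suc (fst p))})"
      by (rule emeasure_PiM_Collect) auto
    also have "\<dots> = (\<Prod>i<n. ennreal (pmf (step \<beta> t (xs i)) (xs (Suc i))))"
      by (subst prod.reindex) (auto simp: inj_on_def emeasure_pmf_single)
    finally show ?thesis using True by simp
  qed simp
  finally show ?thesis .
qed

lemma sets_paths_eq:
  "sets paths = sigma_sets UNIV (insert {} (range (\<lambda>(n, xs). {X. \<forall>i\<le>n. X i = xs i})))"
    (is "_ = sigma_sets UNIV ?G")
proof (rule antisym)
  show "sigma_sets UNIV ?G \<subseteq> sets paths"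
  proof (rule sigma_algebra.sigma_sets_subset)
    show "sigma_algebra UNIV (sets paths)"
      using sets.sigma_algebra_axioms[of paths] by (simp add: space_PiM)
    show "?G \<subseteq> sets paths" using cylinder_sets by auto
  qed
  interpret G: sigma_algebra UNIV "sigma_sets UNIV ?G"
    by (rule sigma_algebra_sigma_sets) auto
  have "{X. X i \<in> A} \<in> sigma_sets UNIV ?G" for i :: nat and A :: "vertex set"
  proof -
    let ?L = "{ys :: vertex list. length ys = Suc i \<and> ys ! i \<in> A}"
    have "{X. X i \<in> A} = (\<Union>ys\<in>?L. {X. \<forall>j\<le>i. X j = ys ! j})"
    proof (intro equalityI subsetI)
      fix X :: "nat \<Rightarrow> vertex" assume "X \<in> {X. X i \<in> A}"
      then have "map X [0..<Suc i] \<in> ?L" "\<forall>j\<le>i. X j = map X [0..<Suc i] ! j"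
        by (auto simp del: upt_Suc)
      then show "X \<in> (\<Union>ys\<in>?L. {X. \<forall>j\<le>i. X j = ys ! j})" by blast
    qed auto
    moreover have "{X :: nat \<Rightarrow> vertex. \<forall>j\<le>i. X j = ys ! j} \<in> sigma_sets UNIV ?G" for ys
      by (rule sigma_sets.Basic, rule insertI2, rule range_eqI[of _ _ "(i, (!) ys)"]) simp
    ultimately show ?thesis by (auto intro!: G.countable_UN')
  qed
  then show "sets paths \<subseteq> sigma_sets UNIV ?G"
    by (subst sets_PiM_single) (auto intro!: G.sigma_sets_subset)
qed

lemma Int_stable_cylinders:
  "Int_stable (insert {} (range (\<lambda>(n, xs). {X :: nat \<Rightarrow> vertex. \<forall>i\<le>n. X i = xs i})))"
    (is "Int_stable ?G")
proof (rule Int_stableI)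
  fix A B assume A: "A \<in> ?G" and B: "B \<in> ?G"
  show "A \<inter> B \<in> ?G"
  proof (cases "A \<inter> B = {}")
    case False
    then obtain Y where Y: "Y \<in> A" "Y \<in> B" by blast
    have *: "\<exists>n. C = {X. \<forall>i\<le>n. X i = Y i}" if "C \<in> ?G" "Y \<in> C" for C
    proof -
      from that obtain n xs where "C = {X. \<forall>i\<le>n. X i = xs i}" by auto
      with that(2) show ?thesis by (intro exI[of _ n]) auto
    qed
    obtain m where m: "A = {X. \<forall>i\<le>m. X i = Y i}" using *[OF A Y(1)] by blast
    obtain n where n: "B = {X. \<forall>i\<le>n. X i = Y i}" using *[OF B Y(2)] by blast
    have "A \<inter> B = {X. \<forall>i\<le>max m n. X i = Y i}" unfolding m n by (auto simp: le_max_iff_disj)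
    then show ?thesis by auto
  qed simp
qed

lemma measurable_walk [measurable]: "walk \<beta> \<in> GW P \<rightarrow>\<^sub>M prob_algebra paths"
proof (rule measurable_prob_algebra_generated[OF sets_paths_eq Int_stable_cylinders])
  fix A assume "A \<in> insert {} (range (\<lambda>(n, xs). {X :: nat \<Rightarrow> vertex. \<forall>i\<le>n. X i = xs i}))"
  then consider "A = {}" | n xs where "A = {X. \<forall>i\<le>n. X i = xs i}" by auto
  then show "(\<lambda>t. emeasure (walk \<beta> t) A) \<in> borel_measurable (GW P)"
  proof cases
    case (2 n xs)
    have local_step: "step \<beta> t x = step \<beta> (\<lambda>_. t x) x" for t x
    proof -
      have "step_prob \<beta> t x = step_prob \<beta> (\<lambda>_. t x) x"
        by (simp add: step_prob_def children_def fun_eq_iff)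
      then show ?thesis by (simp add: step_def)
    qed
    have [measurable]: "(\<lambda>t. ennreal (pmf (step \<beta> t x) y)) \<in> borel_measurable (GW P)" for x y
      by (subst local_step, rule measurable_compose[OF measurable_GW_component[of x]]) simp
    show ?thesis unfolding 2 emeasure_walk_cylinder by measurable
  qed simp
qed (auto simp: prob_space_walk)

lemma measurable_averaged_kernel [measurable]:
  "(\<lambda>t. distr (walk \<beta> t) (GW P \<Otimes>\<^sub>M paths) (\<lambda>X. (t, X))) \<in> GW P \<rightarrow>\<^sub>M subprob_algebra (GW P \<Otimes>\<^sub>M paths)"
proof (rule measurable_distr2)
  show "walk \<beta> \<in> GW P \<rightarrow>\<^sub>M subprob_algebra paths"
    by (rule measurable_prob_algebraD[OF measurable_walk])
qed measurable

lemma AE_averaged_iff: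
  assumes [measurable]: "Measurable.pred (GW P \<Otimes>\<^sub>M paths) Q"
  shows "(AE p in averaged \<beta> P. Q p) \<longleftrightarrow> (AE t in GW P. AE X in walk \<beta> t. Q (t, X))"
proof -
  have "(AE p in averaged \<beta> P. Q p) \<longleftrightarrow>
      (AE t in GW P. AE p in distr (walk \<beta> t) (GW P \<Otimes>\<^sub>M paths) (\<lambda>X. (t, X)). Q p)"
    unfolding averaged_def by (rule AE_bind[OF measurable_averaged_kernel]) measurable
  also have "\<dots> \<longleftrightarrow> (AE t in GW P. AE X in walk \<beta> t. Q (t, X))"
  proof (rule AE_cong)
    fix t
    have "{p \<in> space (GW P \<Otimes>\<^sub>M paths). Q p} \<in> sets (GW P \<Otimes>\<^sub>M paths)" by measurable
    moreover have "(\<lambda>X. (t, X)) \<in> walk \<beta> t \<rightarrow>\<^sub>M GW P \<Otimes>\<^sub>M paths" by simp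
    ultimately show "(AE p in distr (walk \<beta> t) (GW P \<Otimes>\<^sub>M paths) (\<lambda>X. (t, X)). Q p) \<longleftrightarrow>
        (AE X in walk \<beta> t. Q (t, X))"
      by (intro AE_distr_iff)
  qed
  finally show ?thesis .
qed

end

theory Submission
  imports Defs
begin

text \<open>
  The level of the walk changes by one in each step, so its speed is \<open>1 - 2 b\<close>, where \<open>b\<close> is the
  asymptotic frequency of backward steps, that is, steps to the parent. From a vertex with \<open>j\<close> children
  such a step has probability \<open>1 / (1 + \<beta> j)\<close>. If the bias is not too small, this makes \<open>b\<close> comparable to
  the harmonic moment \<open>E[1 / Z]\<close> of the offspring law, with constants that do not depend on that law. The
  theorem therefore reduces to showing that \<open>E[1 / Z\<^sub>1\<^sup>(\<^sup>k\<^sup>)]\<close> becomes much smaller than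
  \<open>E[1 / Z\<^sub>2\<^sup>(\<^sup>k\<^sup>)]\<close> for large \<open>k\<close>; \<open>speed_less_if_harmonic_moments\<close> makes this precise.

  To control the walk, each step is coupled with a coin that shows heads with probability
  \<open>\<beta> / (1 + \<beta>)\<close>. Heads force the walk away from the root, so the level of the walk increases at least as
  much as the simple walk formed by the coins, on every tree. If the coin walk reaches a strict record and
  never falls below it afterwards, then the biased walk is at a vertex with an unexplored subtree and
  stays in this subtree. At such a renewal the past and the future decouple, and the future is that of a
  walk started at the root of a new Galton-Watson tree (\<open>annealed_renewal\<close>). Renewals are determined by
  the coins alone, and they are so frequent that a stretch of \<open>n\<close> coins lacks one with exponentially small
  probability (\<open>coin_mean_not_renewing\<close>).

  Consequently, the probability of a backward step at time \<open>j\<close> converges, and backward steps at different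
  times have exponentially decaying correlations (\<open>backstep_rate_convergent\<close>,
  \<open>backstep_rate_covariance\<close>). A second moment argument along the squares, \<open>events_strong_law\<close>, then shows
  that the speed exists and identifies it (\<open>speed_eq\<close>). For the lower bound on \<open>b\<close> the walk is inspected
  at records of the coin walk, where the offspring number is fresh. For the upper bound, a backward step is
  charged to the first visit to the vertex that is left, at which time its offspring number was fresh; the
  walk returns to this vertex after \<open>r\<close> steps only if the coin walk does not rise during these steps,
  which has exponentially small probability in \<open>r\<close>.

  The harmonic moments are governed by \<open>max {P\<^sub>1{1}, 1 / m\<^sub>1}\<close>: the population of \<open>GW(P\<^sub>1)\<close> either grows at
  its mean rate or stagnates, and \<open>harmonic_moment_decay\<close> combines both possibilities in one contracting
  function of the population size. Jensen's inequality gives \<open>E[1 / Z\<^sub>2\<^sup>(\<^sup>k\<^sup>)] \<ge> m\<^sub>2\<^sup>-\<^sup>k\<close>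
  (\<open>harmonic_moment_ge\<close>). Since \<open>P\<^sub>1{1} = m\<^sub>1\<^sup>-\<^sup>\<alpha>\<close>, the assumption on the means yields \<open>m\<^sub>2 < m\<^sub>1\<close> and
  \<open>P\<^sub>1{1} < 1 / m\<^sub>2\<close>, so the ratio of the two harmonic moments tends to \<open>0\<close> geometrically.
\<close>

section \<open>Independence and stationarity of the Galton-Watson tree\<close>

lemma indep_vars_GW: "prob_space.indep_vars (GW P) (\<lambda>_. measure_pmf P) (\<lambda>u t. t u) UNIV"
proof -
  interpret prob_space "GW P" by (rule prob_space_GW)
  have rv: "(\<lambda>t. t u) \<in> GW P \<rightarrow>\<^sub>M measure_pmf P" for u
    unfolding GW_def by (rule measurable_component_singleton) simp
  have comp: "distr (GW P) (measure_pmf P) (\<lambda>t. t u) = measure_pmf P" for u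
    unfolding GW_def by (rule distr_PiM_component) (auto intro: measure_pmf.prob_space_axioms)
  have "distr (GW P) (\<Pi>\<^sub>M u\<in>UNIV. measure_pmf P) (\<lambda>t. \<lambda>u\<in>UNIV. t u) = GW P"
    by (simp add: GW_def restrict_UNIV)
  then show ?thesis
    by (subst indep_vars_iff_distr_eq_PiM') (simp_all add: rv comp, simp add: GW_def)
qed

text \<open>Every later independence argument has this form: one factor only reads the offspring numbers that
  the walk has used so far, the other one only reads offspring numbers that it has not seen yet.\<close>

lemma GW_split:
  fixes F H :: "tree \<Rightarrow> ennreal"
  assumes F[measurable]: "F \<in> borel_measurable (GW P)"
      and H[measurable]: "H \<in> borel_measurable (GW P)"
    and AB: "A \<inter> B = {}"
    and FA: "\<And>t t'. (\<And>u. u \<in> A \<Longrightarrow> t u = t' u) \<Longrightarrow> F t = F t'"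
    and HB: "\<And>t t'. (\<And>u. u \<in> B \<Longrightarrow> t u = t' u) \<Longrightarrow> H t = H t'"
  shows "(\<integral>\<^sup>+t. F t * H t \<partial>GW P) = (\<integral>\<^sup>+t. F t \<partial>GW P) * (\<integral>\<^sup>+t. H t \<partial>GW P)"
proof -
  interpret prob_space "GW P" by (rule prob_space_GW)
  have incl: "(\<lambda>f. f) \<in> (\<Pi>\<^sub>M u\<in>C. measure_pmf P) \<rightarrow>\<^sub>M GW P" for C
    unfolding GW_def
  proof (rule measurable_PiM_single')
    fix u :: vertex
    show "(\<lambda>f. f u) \<in> (\<Pi>\<^sub>M u\<in>C. measure_pmf P) \<rightarrow>\<^sub>M measure_pmf P"
    proof (cases "u \<in> C")
      case False
      have "(\<lambda>f. f u) \<in> (\<Pi>\<^sub>M u\<in>C. measure_pmf P) \<rightarrow>\<^sub>M measure_pmf P \<longleftrightarrow>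
          (\<lambda>f. undefined) \<in> (\<Pi>\<^sub>M u\<in>C. measure_pmf P) \<rightarrow>\<^sub>M measure_pmf P"
        using False by (intro measurable_cong) (auto simp: space_PiM PiE_def extensional_def)
      then show ?thesis by simp
    qed (rule measurable_component_singleton)
  qed (auto simp: space_PiM)
  have "indep_var (PiM A (\<lambda>_. measure_pmf P)) (\<lambda>t. restrict t A) (PiM B (\<lambda>_. measure_pmf P))
      (\<lambda>t. restrict t B)"
    using indep_var_restrict[OF indep_vars_GW AB] by simp
  then have "indep_var borel (F \<circ> (\<lambda>t. restrict t A)) borel (H \<circ> (\<lambda>t. restrict t B))"
    by (rule indep_var_compose)
      (auto intro: measurable_compose[OF incl F] measurable_compose[OF incl H])
  moreover have "F \<circ> (\<lambda>t. restrict t A) = F" "H \<circ> (\<lambda>t. restrict t B) = H"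
    by (auto simp: fun_eq_iff intro: FA HB)
  ultimately have "indep_var borel F borel H" by simp
  then have "indep_vars (\<lambda>_. borel) (case_bool F H) UNIV"
    unfolding indep_var_def
    by (rule back_subst[of "\<lambda>M. indep_vars M (case_bool F H) UNIV"])
      (simp add: fun_eq_iff split: bool.split)
  from indep_vars_nn_integral[OF _ this] show ?thesis
    by (simp add: UNIV_bool mult.commute)
qed

text \<open>The subtree hanging off a vertex \<open>x\<close> is again a Galton-Watson tree, because \<open>u \<mapsto> x @ u\<close> is
  injective and the offspring numbers are identically distributed.\<close>

lemma GW_shift: "distr (GW P) (GW P) (\<lambda>t u. t (x @ u)) = GW P"
  using distr_PiM_reindex[of UNIV "\<lambda>_. measure_pmf P" "\<lambda>u. x @ u" UNIV]
  by (simp add: GW_def inj_on_def restrict_UNIV measure_pmf.prob_space_axioms)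

lemma measurable_shift [measurable]: "(\<lambda>t u. t (x @ u)) \<in> GW P \<rightarrow>\<^sub>M GW P"
  unfolding GW_def
  by (intro measurable_PiM_single' measurable_component_singleton) (auto simp: space_PiM)

lemma nn_integral_GW_shift:
  assumes [measurable]: "F \<in> borel_measurable (GW P)"
  shows "(\<integral>\<^sup>+t. F (\<lambda>u. t (x @ u)) \<partial>GW P) = (\<integral>\<^sup>+t. F t \<partial>GW P)"
proof -
  have "(\<integral>\<^sup>+t. F t \<partial>distr (GW P) (GW P) (\<lambda>t u. t (x @ u))) = (\<integral>\<^sup>+t. F (\<lambda>u. t (x @ u)) \<partial>GW P)"
    by (rule nn_integral_distr) measurable
  then show ?thesis by (simp only: GW_shift)
qed

lemma nn_integral_GW_component: "(\<integral>\<^sup>+t. f (t u) \<partial>GW P) = (\<integral>\<^sup>+k. f k \<partial>measure_pmf P)"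
proof -
  have comp: "distr (GW P) (measure_pmf P) (\<lambda>t. t u) = measure_pmf P"
    unfolding GW_def by (rule distr_PiM_component) (auto intro: measure_pmf.prob_space_axioms)
  have "(\<integral>\<^sup>+k. f k \<partial>distr (GW P) (measure_pmf P) (\<lambda>t. t u)) = (\<integral>\<^sup>+t. f (t u) \<partial>GW P)"
    unfolding GW_def by (rule nn_integral_distr[OF measurable_component_singleton]) simp_all
  then show ?thesis by (simp only: comp)
qed

lemma AE_no_leaves:
  assumes Q0: "pmf Q 0 = 0"
  shows "AE t in GW Q. \<forall>u. t u > 0"
proof (subst AE_all_countable, rule allI)
  fix u
  have "(\<integral>\<^sup>+t. indicator {0} (t u) \<partial>GW Q) = emeasure (measure_pmf Q) {0}"
    by (subst nn_integral_GW_component[where f = "indicator {0}"]) simp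
  then have "(\<integral>\<^sup>+t. indicator {0} (t u) \<partial>GW Q) = 0"
    using Q0 by (simp add: emeasure_pmf_single)
  then have "AE t in GW Q. indicator {0} (t u) = (0 :: ennreal)"
    by (subst (asm) nn_integral_0_iff_AE)
        (auto intro: measurable_compose[OF measurable_GW_component])
  then show "AE t in GW Q. t u > 0" by (auto split: split_indicator_asm)
qed

section \<open>Records and renewals of the coin walk\<close>

text \<open>A list of coins is read as a walk on the integers that goes up at \<open>True\<close> and down at \<open>False\<close>;
  \<open>stays_nonneg k cs\<close> says that this walk, started at height \<open>k\<close>, never becomes negative.\<close>

primrec stays_nonneg :: "nat \<Rightarrow> bool list \<Rightarrow> bool" where
  "stays_nonneg k [] \<longleftrightarrow> True"
| "stays_nonneg k (c # cs)
    \<longleftrightarrow> (if c then stays_nonneg (Suc k) cs else k > 0 \<and> stays_nonneg (k - 1) cs)"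

text \<open>How far the coin walk is below its running maximum: \<open>gap k cs\<close> is that distance after the coins
  \<open>cs\<close>, if it was \<open>k\<close> before them. The truncated subtraction \<open>0 - 1 = 0\<close> is a step up from the maximum,
  that is, a new strict record.\<close>

primrec gap :: "nat \<Rightarrow> bool list \<Rightarrow> nat" where
  "gap k [] = k"
| "gap k (c # cs) = gap (if c then k - 1 else Suc k) cs"

abbreviation heads :: "bool list \<Rightarrow> nat" where "heads cs \<equiv> count_list cs True"
abbreviation tails :: "bool list \<Rightarrow> nat" where "tails cs \<equiv> count_list cs False"

lemma stays_nonneg_mono: "stays_nonneg k cs \<Longrightarrow> k \<le> l \<Longrightarrow> stays_nonneg l cs"
  by (induction cs arbitrary: k l) (auto split: if_splits)

lemma gap_append: "gap k (as @ bs) = gap (gap k as) bs"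
  by (induction as arbitrary: k) auto

lemma gap_mono: "k \<le> l \<Longrightarrow> gap k cs \<le> gap l cs"
  by (induction cs arbitrary: k l) auto

lemma gap_le: "gap k cs \<le> k + tails cs"
proof (induction cs arbitrary: k)
  case (Cons c cs)
  show ?case using Cons[of "k - 1"] Cons[of "Suc k"] by auto
qed simp

lemma not_stays_nonnegD:
  "\<not> stays_nonneg k cs \<Longrightarrow> \<exists>ds es. cs = ds @ False # es \<and> tails ds = heads ds + k"
proof (induction cs arbitrary: k)
  case (Cons c cs)
  show ?case
  proof (cases "c \<or> k > 0")
    case True
    then have "\<not> stays_nonneg (if c then Suc k else k - 1) cs" using Cons.prems
      by (auto split: if_splits)
    from Cons.IH[OF this] obtain ds es where
      "cs = ds @ False # es" "tails ds = heads ds + (if c then Suc k else k - 1)" by blast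
    then show ?thesis using True by (intro exI[of _ "c # ds"] exI[of _ es]) auto
  next
    case False
    then show ?thesis by (intro exI[of _ "[]"] exI[of _ cs]) auto
  qed
qed simp

text \<open>The coins \<open>cs\<close> contain a renewal: a head that leads to a strict record of the coin walk (whose
  distance to its maximum was \<open>k\<close> at the beginning), after which the coin walk never falls below that
  record. The list \<open>bs\<close> is nonempty so that the last coin is used after the renewal.\<close>

definition renewing :: "nat \<Rightarrow> bool list \<Rightarrow> bool" where
  "renewing k cs \<longleftrightarrow> (\<exists>as bs. cs = as @ True # bs \<and> gap k as = 0 \<and> stays_nonneg 0 bs \<and> bs \<noteq> [])"

lemma renewing_appendI: "renewing (gap k ds) es \<Longrightarrow> renewing k (ds @ es)"
  unfolding renewing_def by (metis append_assoc gap_append)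

text \<open>Each head that sets a record without being a renewal is followed by a return below that record,
  so records without renewals have to be paid for by tails. With more than two heads per tail, beyond
  the initial distance to the maximum, some record survives. The induction follows the walk to the
  first head at a record; if the walk falls below this record later, the coins up to that fall are
  discarded, and what they contribute to the balance of heads and tails covers the new distance to the
  maximum.\<close>

lemma many_heads_imp_renewing:
  "heads cs > 2 * tails cs + k + 1 \<Longrightarrow> renewing k cs"
proof (induction cs arbitrary: k rule: length_induct)
  case (1 cs)
  show ?case
  proof (cases cs)
    case Nil
    then show ?thesis using 1 by simp
  next
    case (Cons c cs')
    show ?thesis
    proof (cases "c \<and> k = 0")
      case False
      let ?k = "if c then k - 1 else Suc k"
      have "heads cs' > 2 * tails cs' + ?k + 1"
        using "1.prems" Cons False by (auto split: if_splits)
      then have "renewing ?k cs'" using "1.IH" Cons by auto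
      then show ?thesis using renewing_appendI[of k "[c]" cs'] Cons by simp
    next
      case True
      have *: "heads cs' > 2 * tails cs'" using "1.prems" Cons True by simp
      then have ne: "cs' \<noteq> []" by auto
      show ?thesis
      proof (cases "stays_nonneg 0 cs'")
        case True': True
        show ?thesis unfolding renewing_def
          by (rule exI[of _ "[]"], rule exI[of _ cs']) (use True True' ne Cons in auto)
      next
        case nst: False
        from not_stays_nonnegD[OF nst] obtain ds es where de: "cs' = ds @ False # es"
            "tails ds = heads ds"
          by auto
        let ?g = "gap 0 (ds @ [False])"
        \<comment> \<open>ds has as many heads as tails, so its deficit of heads covers the new distance to the maximum\<close>
        have "?g \<le> tails ds + 1" using gap_le[of 0 "ds @ [False]"] by simp
        then have "heads es > 2 * tails es + ?g + 1" using * de by simp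
        then have "renewing ?g es" using "1.IH" Cons de by auto
        then have "renewing 0 (ds @ [False] @ es)" using renewing_appendI[of 0 "ds @ [False]" es]
          by simp
        then show ?thesis using renewing_appendI[of k "[True]" cs'] Cons True de by simp
      qed
    qed
  qed
qed

text \<open>The bound \<open>\<beta> \<ge> 4\<close> makes the coin that dominates the walk come up heads with probability at
  least \<open>4/5\<close>, which leaves room in all exponential estimates below, with explicit constants that do not
  depend on \<open>\<beta>\<close>.\<close>

locale biased_walk =
  fixes \<beta> :: real
  assumes beta: "\<beta> \<ge> 4"
begin

definition p where "p = \<beta> / (1 + \<beta>)"
definition q where "q = 1 / (1 + \<beta>)"

lemma pq: "p + q = 1" "p \<ge> 4 / 5" "q > 0" "q \<le> 1 / 5" "p \<le> 1" "q * \<beta> = p"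
  using beta by (auto simp: p_def q_def field_simps)

text \<open>The expectation over \<open>n\<close> independent coins with probabilities \<open>p\<close> and \<open>q\<close>. The recursion makes
  it a finite weighted sum, so that no integrability has to be discussed.\<close>

primrec coin_mean :: "nat \<Rightarrow> (bool list \<Rightarrow> real) \<Rightarrow> real" where
  "coin_mean 0 f = f []"
| "coin_mean (Suc n) f = p * coin_mean n (\<lambda>cs. f (True # cs)) + q
    * coin_mean n (\<lambda>cs. f (False # cs))"

lemma coin_mean_const [simp]: "coin_mean n (\<lambda>_. c) = c"
  using pq by (induction n) (auto simp: distrib_right[symmetric])

lemma coin_mean_add: "coin_mean n (\<lambda>cs. f cs + g cs) = coin_mean n f + coin_mean n g"
  by (induction n arbitrary: f g) (auto simp: algebra_simps)

lemma coin_mean_mult: "coin_mean n (\<lambda>cs. c * f cs) = c * coin_mean n f"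
  by (induction n arbitrary: f) (auto simp: algebra_simps)

lemma coin_mean_diff: "coin_mean n (\<lambda>cs. f cs - g cs) = coin_mean n f - coin_mean n g"
  using coin_mean_add[of n f "\<lambda>cs. - 1 * g cs"] coin_mean_mult[of n "- 1" g] by simp

lemma coin_mean_sum: "coin_mean n (\<lambda>cs. \<Sum>i\<in>I. f i cs) = (\<Sum>i\<in>I. coin_mean n (f i))"
  by (induction I rule: infinite_finite_induct) (auto simp: coin_mean_add)

lemma coin_mean_mono:
  "(\<And>cs. length cs = n \<Longrightarrow> f cs \<le> g cs) \<Longrightarrow> coin_mean n f \<le> coin_mean n g"
proof (induction n arbitrary: f g)
  case (Suc n)
  then show ?case using pq by (auto intro!: add_mono mult_left_mono Suc.IH Suc.prems)
qed simp

lemma coin_mean_cong: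
  "(\<And>cs. length cs = n \<Longrightarrow> f cs = g cs) \<Longrightarrow> coin_mean n f = coin_mean n g"
  by (intro antisym coin_mean_mono) auto

lemma coin_mean_append: "coin_mean (m + n) f = coin_mean m (\<lambda>as. coin_mean n (\<lambda>bs. f (as @ bs)))"
  by (induction m arbitrary: f) auto

lemma coin_mean_snoc: "coin_mean (Suc n) f
    = coin_mean n (\<lambda>cs. p * f (cs @ [True]) + q * f (cs @ [False]))"
  using coin_mean_append[of n 1 f] by simp

lemma coin_mean_abs_le: "\<bar>coin_mean n f\<bar> \<le> coin_mean n (\<lambda>cs. \<bar>f cs\<bar>)"
  using coin_mean_mono[of n f "\<lambda>cs. \<bar>f cs\<bar>"] coin_mean_mono[of n "\<lambda>cs. - 1 * f cs" "\<lambda>cs. \<bar>f cs\<bar>"]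
  unfolding coin_mean_mult by (auto simp: abs_le_iff)

lemma coin_mean_powers: "coin_mean n (\<lambda>cs. x ^ heads cs * y ^ tails cs) = (p * x + q * y) ^ n"
proof (induction n)
  case (Suc n)
  have "coin_mean (Suc n) (\<lambda>cs. x ^ heads cs * y ^ tails cs) =
      p * (x * coin_mean n (\<lambda>cs. x ^ heads cs * y ^ tails cs)) + q
          * (y * coin_mean n (\<lambda>cs. x ^ heads cs * y ^ tails cs))"
    by (simp add: mult.assoc mult.left_commute flip: coin_mean_mult)
  then show ?case by (simp add: Suc algebra_simps)
qed simp

text \<open>The distance to the maximum is a reflected walk with downward drift; the geometric tail \<open>4\<^sup>-\<^sup>k\<close>
  is preserved by one step because \<open>p / 16 + q \<le> 1 / 4\<close>.\<close>

lemma coin_mean_gap_ge: "coin_mean n (\<lambda>cs. of_bool (gap 0 cs \<ge> k)) \<le> (1 / 4) ^ k"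
proof (induction n arbitrary: k)
  case (Suc n)
  show ?case
  proof (cases k)
    case (Suc l)
    have "coin_mean (Suc n) (\<lambda>cs. of_bool (gap 0 cs \<ge> k)) =
        p * coin_mean n (\<lambda>cs. of_bool (gap 0 cs \<ge> Suc (Suc l))) + q
            * coin_mean n (\<lambda>cs. of_bool (gap 0 cs \<ge> l))"
      unfolding coin_mean_snoc Suc
        by (auto simp: gap_append coin_mean_add coin_mean_mult Suc_le_eq less_diff_conv
            less_Suc_eq_le)
    also have "\<dots> \<le> p * (1 / 4) ^ Suc (Suc l) + q * (1 / 4) ^ l"
      using pq by (intro add_mono mult_left_mono Suc.IH) auto
    also have "\<dots> = (p / 16 + q) * (1 / 4) ^ l" by (simp add: algebra_simps)
    also have "\<dots> \<le> (1 / 4) * (1 / 4) ^ l" using pq by (intro mult_right_mono) auto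
    finally show ?thesis using Suc by simp
  qed (use coin_mean_mono[of "Suc n" "\<lambda>cs. of_bool (gap 0 cs \<ge> k)" "\<lambda>_. 1"] in auto)
qed (auto simp: power_le_one)

lemma coin_mean_gap_eq_0: "coin_mean n (\<lambda>cs. of_bool (gap 0 cs = 0)) \<ge> 3 / 4"
proof -
  have "coin_mean n (\<lambda>cs. of_bool (gap 0 cs = 0)) = coin_mean n (\<lambda>cs. 1 - of_bool (gap 0 cs \<ge> 1))"
    by (intro coin_mean_cong) auto
  then show ?thesis using coin_mean_gap_ge[of n 1] by (simp add: coin_mean_diff)
qed

text \<open>The function \<open>(3/2)\<^sup>g\<close> of the distance \<open>g\<close> to the maximum contracts by the factor
  \<open>2/3 p + 3/2 q \<le> 5/6\<close> away from \<open>0\<close>, which bounds its expectation by the fixed point \<open>6\<close> of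
  \<open>x \<mapsto> 5/6 x + 1\<close>.\<close>

lemma coin_mean_gap_exp: "coin_mean n (\<lambda>cs. (3 / 2) ^ gap 0 cs) \<le> 6"
proof (induction n)
  case (Suc n)
  have "coin_mean (Suc n) (\<lambda>cs. (3 / 2) ^ gap 0 cs)
      \<le> coin_mean n (\<lambda>cs. (2 / 3 * p + 3 / 2 * q) * (3 / 2) ^ gap 0 cs + p)"
    unfolding coin_mean_snoc
  proof (rule coin_mean_mono)
    fix cs
    have "(3 / 2 :: real) ^ (gap 0 cs - 1) \<le> 2 / 3 * (3 / 2) ^ gap 0 cs + 1"
      by (cases "gap 0 cs") auto
    then have "p * (3 / 2) ^ (gap 0 cs - 1) \<le> p * (2 / 3 * (3 / 2) ^ gap 0 cs + 1)"
      using pq by (intro mult_left_mono) auto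
    then show "p * (3 / 2) ^ gap 0 (cs @ [True]) + q * (3 / 2) ^ gap 0 (cs @ [False])
        \<le> (2 / 3 * p + 3 / 2 * q) * (3 / 2) ^ gap 0 cs + p"
      by (simp add: gap_append algebra_simps)
  qed
  also have "\<dots> = (2 / 3 * p + 3 / 2 * q) * coin_mean n (\<lambda>cs. (3 / 2) ^ gap 0 cs) + p"
    by (simp add: coin_mean_add coin_mean_mult)
  also have "\<dots> \<le> (5 / 6) * 6 + 1"
    using pq Suc coin_mean_mono[of n "\<lambda>_. 0" "\<lambda>cs. (3 / 2) ^ gap 0 cs"]
      by (intro add_mono mult_mono) auto
  finally show ?case by simp
qed simp

text \<open>A list without renewals has at most twice as many heads as tails, up to the initial distance to
  the maximum. A Chernoff bound turns this into exponential decay: with the weights \<open>2/3\<close> per head and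
  \<open>(3/2)\<^sup>2\<close> per tail one coin has mean \<open>2/3 p + 9/4 q \<le> 59/60\<close>.\<close>

lemma coin_mean_not_renewing:
  "coin_mean m (\<lambda>as. coin_mean n (\<lambda>bs. of_bool (\<not> renewing (gap 0 as) bs))) \<le> 9 * (59 / 60) ^ n"
proof -
  have le: "of_bool (\<not> renewing k bs) \<le> (3 / 2) ^ Suc k
      * ((2 / 3) ^ heads bs * (9 / 4) ^ tails bs :: real)" for k bs
  proof (cases "renewing k bs")
    case False
    then have "heads bs \<le> 2 * tails bs + Suc k" using many_heads_imp_renewing[of bs k] by linarith
    then have "(3 / 2 :: real) ^ heads bs \<le> (3 / 2) ^ (2 * tails bs + Suc k)"
      by (intro power_increasing) auto
    also have "\<dots> = (9 / 4) ^ tails bs * (3 / 2) ^ Suc k"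
      by (simp add: power_add power_mult power2_eq_square)
    finally have "(2 / 3) ^ heads bs * (3 / 2 :: real) ^ heads bs \<le>
        (2 / 3) ^ heads bs * ((9 / 4) ^ tails bs * (3 / 2) ^ Suc k)"
      by (intro mult_left_mono) auto
    moreover have "(2 / 3) ^ heads bs * (3 / 2 :: real) ^ heads bs = 1"
      by (simp flip: power_mult_distrib)
    ultimately show ?thesis using False by (simp add: mult_ac)
  qed simp
  have "coin_mean m (\<lambda>as. coin_mean n (\<lambda>bs. of_bool (\<not> renewing (gap 0 as) bs))) \<le>
      coin_mean m (\<lambda>as. (p * (2 / 3) + q * (9 / 4)) ^ n * (3 / 2) * (3 / 2) ^ gap 0 as)"
  proof (rule coin_mean_mono)
    fix as
    have "coin_mean n (\<lambda>bs. of_bool (\<not> renewing (gap 0 as) bs)) \<le>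
        coin_mean n (\<lambda>bs. (3 / 2) ^ Suc (gap 0 as) * ((2 / 3) ^ heads bs * (9 / 4) ^ tails bs))"
      by (rule coin_mean_mono) (rule le)
    also have "\<dots> = (3 / 2) ^ Suc (gap 0 as) * (p * (2 / 3) + q * (9 / 4)) ^ n"
      unfolding coin_mean_mult coin_mean_powers ..
    finally show "coin_mean n (\<lambda>bs. of_bool (\<not> renewing (gap 0 as) bs)) \<le>
        (p * (2 / 3) + q * (9 / 4)) ^ n * (3 / 2) * (3 / 2) ^ gap 0 as"
      by (simp add: mult_ac)
  qed
  also have "\<dots> = (p * (2 / 3) + q * (9 / 4)) ^ n * (3 / 2) * coin_mean m (\<lambda>as. (3 / 2) ^ gap 0 as)"
    by (rule coin_mean_mult)
  also have "\<dots> \<le> (59 / 60) ^ n * (3 / 2) * 6"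
    using pq by (intro mult_mono coin_mean_gap_exp power_mono)
        (auto intro: order_trans[OF _ coin_mean_mono[of m "\<lambda>_. 0"]])
  finally show ?thesis by simp
qed

text \<open>This is what makes returns of the walk to a given vertex summable.\<close>

lemma coin_mean_heads_le_tails: "coin_mean n (\<lambda>cs. of_bool (heads cs \<le> tails cs)) \<le> (5 / 6) ^ n"
proof -
  have "coin_mean n (\<lambda>cs. of_bool (heads cs \<le> tails cs))
      \<le> coin_mean n (\<lambda>cs. (2 / 3) ^ heads cs * (3 / 2) ^ tails cs)"
  proof (rule coin_mean_mono)
    fix cs :: "bool list"
    show "of_bool (heads cs \<le> tails cs) \<le> (2 / 3) ^ heads cs * (3 / 2 :: real) ^ tails cs"
    proof (cases "heads cs \<le> tails cs")
      case True
      then have "(2 / 3) ^ heads cs * (3 / 2 :: real) ^ heads cs \<le> (2 / 3) ^ heads cs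
          * (3 / 2 :: real) ^ tails cs"
        by (intro mult_left_mono power_increasing) auto
      moreover have "(2 / 3) ^ heads cs * (3 / 2 :: real) ^ heads cs = 1"
        by (simp flip: power_mult_distrib)
      ultimately show ?thesis using True by simp
    qed simp
  qed
  also have "\<dots> = (p * (2 / 3) + q * (3 / 2)) ^ n" by (rule coin_mean_powers)
  also have "\<dots> \<le> (5 / 6) ^ n" using pq by (intro power_mono) auto
  finally show ?thesis .
qed

end

section \<open>The biased walk driven by coins\<close>

definition uniform_child :: "nat \<Rightarrow> vertex \<Rightarrow> vertex pmf" where
  "uniform_child k x = map_pmf (\<lambda>i. x @ [i]) (pmf_of_set {..<max 1 k})"

lemma set_uniform_child: "set_pmf (uniform_child k x) = (\<lambda>i. x @ [i]) ` {..<max 1 k}"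
  by (auto simp: uniform_child_def set_pmf_of_set lessThan_empty_iff)

lemma map_pmf_append_Nil: "map_pmf ((@) []) M = M"
proof -
  have "map_pmf ((@) []) M = map_pmf (\<lambda>x. x) M" by (rule map_pmf_cong) auto
  then show ?thesis by (simp add: map_pmf_ident)
qed

context biased_walk
begin

text \<open>The probability of a step to the parent when the coin shows tails. It is chosen such that
  \<open>q * parent_prob k = 1 / (1 + \<beta> * k)\<close>. At \<open>k = 0\<close> it has the value for
  \<open>k = 1\<close>, so that the laws below are probability laws for every tree, leaves included.\<close>

definition parent_prob :: "nat \<Rightarrow> real" where
  "parent_prob k = (1 + \<beta>) / (1 + \<beta> * real (max 1 k))"

lemma parent_prob: "0 \<le> parent_prob k" "parent_prob k \<le> 1"
proof -
  have "1 + \<beta> * 1 \<le> 1 + \<beta> * real (max 1 k)" using beta by (intro add_left_mono mult_left_mono) auto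
  moreover from this have "0 < 1 + \<beta> * real (max 1 k)" using beta by linarith
  ultimately show "0 \<le> parent_prob k" "parent_prob k \<le> 1"
    using beta unfolding parent_prob_def by (simp_all add: divide_le_eq del: of_nat_max)
qed

text \<open>One step of the biased walk, given the coin. Heads force a step away from the root; hence the
  level of the walk increases at least as much as the coin walk does, whatever the tree is.\<close>

definition move :: "nat \<Rightarrow> bool \<Rightarrow> vertex \<Rightarrow> vertex pmf" where
  "move k c x = (if c \<or> x = [] then uniform_child k x
     else bernoulli_pmf (parent_prob k)
         \<bind> (\<lambda>b. if b then return_pmf (butlast x) else uniform_child k x))"

text \<open>The list of positions includes the starting point, so it is longer than the list of coins by one.\<close>

primrec coupled_path :: "tree \<Rightarrow> bool list \<Rightarrow> vertex \<Rightarrow> vertex list pmf" where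
  "coupled_path t [] x = return_pmf [x]"
| "coupled_path t (c # cs) x = move (t x) c x \<bind> (\<lambda>y. map_pmf ((#) x) (coupled_path t cs y))"

lemma pmf_uniform_child:
  "k > 0 \<Longrightarrow> pmf (uniform_child k x) y = (if \<exists>i<k. y = x @ [i] then 1 / k else 0)"
proof (cases "\<exists>i<k. y = x @ [i]")
  case True
  assume k: "k > 0"
  from True obtain i where i: "i < k" "y = x @ [i]" by blast
  then have "pmf (uniform_child k x) y = pmf (pmf_of_set {..<max 1 k}) i"
    unfolding uniform_child_def i by (intro pmf_map_inj') (auto simp: inj_on_def)
  then show ?thesis using i k by (auto simp: lessThan_empty_iff max_def)
next
  case False
  assume "k > 0"
  then have "y \<notin> set_pmf (uniform_child k x)" using False
    by (auto simp: set_uniform_child max_def split: if_splits)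
  then show ?thesis using False \<open>k > 0\<close> by (simp add: set_pmf_iff)
qed

text \<open>This is what \<open>parent_prob\<close> is calibrated for: with the right mass on the parent, the children share the
  remaining mass equally.\<close>

lemma coin_move:
  assumes "t x > 0"
  shows "bernoulli_pmf p \<bind> (\<lambda>c. move (t x) c x) = step \<beta> t x"
proof (rule pmf_eqI)
  fix y
  have c: "(\<exists>i<t x. y = x @ [i]) \<longleftrightarrow> y \<in> children t x" by (auto simp: children_def)
  have child: "pmf (uniform_child (t x) x) y = (if y \<in> children t x then 1 / real (t x) else 0)"
    by (simp add: pmf_uniform_child assms c)
  have p: "0 \<le> p" "p \<le> 1" "1 - p = q" using pq by auto
  have k: "real (t x) \<ge> 1" using assms by simp
  have step: "pmf (step \<beta> t x) y = step_prob \<beta> t x y" using beta assms by (simp add: pmf_step)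
  show "pmf (bernoulli_pmf p \<bind> (\<lambda>c. move (t x) c x)) y = pmf (step \<beta> t x) y"
  proof (cases "x = []")
    case True
    then have "bernoulli_pmf p \<bind> (\<lambda>c. move (t x) c x) = uniform_child (t x) x"
      by (simp add: move_def bind_pmf_const)
    then have "pmf (bernoulli_pmf p \<bind> (\<lambda>c. move (t x) c x)) y = pmf (uniform_child (t x) x) y"
      by (rule arg_cong)
    also have "\<dots> = step_prob \<beta> t x y" unfolding child step_prob_def if_P[OF True] ..
    finally show ?thesis unfolding step .
  next
    case False
    have nc: "y = butlast x \<Longrightarrow> y \<notin> children t x"
      using False by (auto simp: children_def dest: arg_cong[where f = length])
    define w where "w = 1 / (1 + \<beta> * real (t x))"
    have pos: "1 + \<beta> * real (t x) > 0" using k beta by (simp add: add_pos_pos)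
    have "w * (1 + \<beta> * real (t x)) = 1" using pos by (simp add: w_def)
    then have w1: "1 - w = \<beta> * w * real (t x)" by (simp add: algebra_simps)
    have w: "q * parent_prob (t x) = w"
      using beta pos assms by (simp add: q_def parent_prob_def w_def max_def)
    have "pmf (bernoulli_pmf p \<bind> (\<lambda>c. move (t x) c x)) y =
        p * pmf (uniform_child (t x) x) y + q * (parent_prob (t x) * of_bool (y = butlast x)
          + (1 - parent_prob (t x)) * pmf (uniform_child (t x) x) y)"
      using False p parent_prob by (simp add: pmf_bind move_def indicator_def)
    also have "\<dots> = (p + q) * pmf (uniform_child (t x) x) y + (q * parent_prob (t x))
        * (of_bool (y = butlast x) - pmf (uniform_child (t x) x) y)"
      by (simp add: algebra_simps)
    also have "\<dots> = (1 - w) * pmf (uniform_child (t x) x) y + w * of_bool (y = butlast x)"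
      by (simp add: w pq algebra_simps)
    also have "\<dots> = step_prob \<beta> t x y"
    proof -
      have "(1 - w) * (1 / real (t x)) = \<beta> / (1 + \<beta> * real (t x))"
        unfolding w1 using k by (simp add: w_def)
      then show ?thesis using False nc unfolding child step_prob_def by (auto simp: w_def)
    qed
    finally show ?thesis by (simp add: step)
  qed
qed

lemma length_coupled_path: "\<pi> \<in> set_pmf (coupled_path t cs x) \<Longrightarrow> length \<pi> = Suc (length cs)"
  by (induction cs arbitrary: x \<pi>) auto

lemma coupled_path_Cons_ex: "\<pi> \<in> set_pmf (coupled_path t cs x) \<Longrightarrow> \<exists>\<pi>'. \<pi> = x # \<pi>'"
  by (cases cs) auto

lemma coupled_path_append:
  "coupled_path t (as @ bs) x = coupled_path t as x
      \<bind> (\<lambda>\<pi>1. map_pmf (\<lambda>\<pi>2. butlast \<pi>1 @ \<pi>2) (coupled_path t bs (last \<pi>1)))"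
proof (induction as arbitrary: x)
  case (Cons c as)
  have "coupled_path t (as @ bs) y = coupled_path t as y
      \<bind> (\<lambda>\<pi>1. map_pmf (\<lambda>\<pi>2. butlast \<pi>1 @ \<pi>2) (coupled_path t bs (last \<pi>1)))" for y
    by (rule Cons.IH)
  then have "coupled_path t ((c # as) @ bs) x = move (t x) c x \<bind> (\<lambda>y. coupled_path t as y \<bind>
      (\<lambda>\<pi>1. map_pmf (\<lambda>\<pi>2. x # butlast \<pi>1 @ \<pi>2) (coupled_path t bs (last \<pi>1))))"
    by (simp add: map_bind_pmf map_pmf_comp)
  also have "\<dots> = move (t x) c x \<bind> (\<lambda>y. coupled_path t as y \<bind>
      (\<lambda>\<pi>1. map_pmf (\<lambda>\<pi>2. butlast (x # \<pi>1) @ \<pi>2) (coupled_path t bs (last (x # \<pi>1)))))"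
    by (intro bind_pmf_cong refl) (auto dest!: coupled_path_Cons_ex)
  also have "\<dots> = coupled_path t (c # as) x
      \<bind> (\<lambda>\<pi>1. map_pmf (\<lambda>\<pi>2. butlast \<pi>1 @ \<pi>2) (coupled_path t bs (last \<pi>1)))"
    by (simp add: bind_assoc_pmf bind_map_pmf)
  finally show ?case .
qed (simp add: bind_return_pmf map_pmf_append_Nil)

text \<open>The probability of a path only involves the offspring numbers of vertices that the path leaves. The
  offspring number of the final vertex is still fresh, unless the path has been there before.\<close>

lemma pmf_coupled_path_local:
  assumes "\<And>u. u \<in> set (butlast \<pi>) \<Longrightarrow> t u = t' u"
  shows "pmf (coupled_path t cs x) \<pi> = pmf (coupled_path t' cs x) \<pi>"
  using assms
proof (induction cs arbitrary: x \<pi>)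
  case (Cons c cs)
  show ?case
  proof (cases "\<exists>\<pi>'. \<pi> = x # \<pi>' \<and> \<pi>' \<noteq> []")
    case True
    then obtain \<pi>' where \<pi>: "\<pi> = x # \<pi>'" "\<pi>' \<noteq> []" by blast
    have *: "pmf (coupled_path t (c # cs) x) \<pi>
        = measure_pmf.expectation (move (t x) c x) (\<lambda>y. pmf (coupled_path t cs y) \<pi>')" for t
      unfolding \<pi> by (simp add: pmf_bind pmf_map_inj')
    have "t x = t' x" using Cons.prems \<pi> by simp
    moreover have "pmf (coupled_path t cs y) \<pi>' = pmf (coupled_path t' cs y) \<pi>'" for y
      using Cons.prems \<pi> by (intro Cons.IH) simp
    ultimately show ?thesis unfolding * by simp
  next
    case False
    have "pmf (coupled_path t (c # cs) x) \<pi> = 0" for t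
    proof -
      have "\<pi> \<notin> set_pmf (coupled_path t (c # cs) x)" using False
        by (fastforce dest: coupled_path_Cons_ex)
      then show ?thesis by (simp only: set_pmf_iff not_not)
    qed
    then show ?thesis by simp
  qed
qed simp

lemma uniform_child_append: "uniform_child k (x @ y) = map_pmf ((@) x) (uniform_child k y)"
  by (simp add: uniform_child_def map_pmf_comp)

text \<open>As long as the coin walk stays nonnegative, the walk from \<open>x\<close> cannot step to the parent of \<open>x\<close>:
  whenever it is at \<open>x\<close>, the next coin shows heads. So it does not notice whether \<open>x\<close> is the root.\<close>

lemma coupled_path_shift:
  assumes "stays_nonneg (length y) cs"
  shows "coupled_path t cs (x @ y) = map_pmf (map ((@) x)) (coupled_path (\<lambda>u. t (x @ u)) cs y)"
  using assms
proof (induction cs arbitrary: y)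
  case (Cons c cs)
  have y: "c \<or> y \<noteq> []" using Cons.prems by (auto split: if_splits)
  have m: "move (t (x @ y)) c (x @ y) = map_pmf ((@) x) (move (t (x @ y)) c y)"
  proof (cases c)
    case True
    then show ?thesis by (simp add: move_def uniform_child_append)
  next
    case False
    then show ?thesis using y
      by (simp add: move_def uniform_child_append map_bind_pmf butlast_append if_distrib[of
          "map_pmf _"]
          cong: if_cong)
  qed
  have st: "stays_nonneg (length z) cs" if "z \<in> set_pmf (move (t (x @ y)) c y)" for z
  proof (cases c)
    case True
    then show ?thesis using Cons.prems that by (auto simp: move_def set_uniform_child)
  next
    case False
    then have "stays_nonneg (length y - 1) cs" using Cons.prems by simp
    moreover have "length y - 1 \<le> length z" using that False y
      by (auto simp: move_def set_uniform_child split: if_splits)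
    ultimately show ?thesis by (rule stays_nonneg_mono)
  qed
  have "coupled_path t (c # cs) (x @ y) = move (t (x @ y)) c y
      \<bind> (\<lambda>z. map_pmf ((#) (x @ y)) (coupled_path t cs (x @ z)))"
    by (simp add: m bind_map_pmf)
  also have "\<dots> = move (t (x @ y)) c y
      \<bind> (\<lambda>z. map_pmf ((#) (x @ y)) (map_pmf (map ((@) x)) (coupled_path (\<lambda>u. t (x @ u)) cs z)))"
    by (intro bind_pmf_cong refl) (simp add: Cons.IH st)
  also have "\<dots> = map_pmf (map ((@) x)) (coupled_path (\<lambda>u. t (x @ u)) (c # cs) y)"
    by (simp add: map_bind_pmf map_pmf_comp)
  finally show ?case .
qed simp

lemma move_level:
  assumes "y \<in> set_pmf (move k c x)"
  shows "length y = Suc (length x) \<or> \<not> c \<and> length x = Suc (length y)"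
  using assms by (cases x rule: rev_cases) (auto simp: move_def set_uniform_child split: if_splits)

text \<open>By domination, the walk is at most as far below its highest level as the coin walk is below its
  maximum.\<close>

lemma coupled_path_below_record:
  assumes "\<pi> \<in> set_pmf (coupled_path t cs x)" "v \<in> set \<pi> \<or> length v \<le> length x + k"
  shows "length v \<le> length (last \<pi>) + gap k cs"
  using assms
proof (induction cs arbitrary: x \<pi> k)
  case (Cons c cs)
  then obtain y \<pi>' where y: "y \<in> set_pmf (move (t x) c x)" "\<pi>' \<in> set_pmf (coupled_path t cs y)"
      "\<pi> = x # \<pi>'"
    by auto
  from y(2) have ne: "\<pi>' \<noteq> []" using length_coupled_path by fastforce
  let ?k = "if c then k - 1 else Suc k"
  have "length x + k \<le> length y + ?k" using move_level[OF y(1)] by auto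
  then have "v \<in> set \<pi>' \<or> length v \<le> length y + ?k"
    using Cons.prems(2) y(3) by auto
  from Cons.IH[OF y(2) this] show ?case using y(3) ne by simp
qed auto

lemma coupled_path_climb: "\<pi> \<in> set_pmf (coupled_path t cs x)
    \<Longrightarrow> length x + heads cs \<le> length (last \<pi>) + tails cs"
proof (induction cs arbitrary: x \<pi>)
  case (Cons c cs)
  then obtain y \<pi>' where y: "y \<in> set_pmf (move (t x) c x)" "\<pi>' \<in> set_pmf (coupled_path t cs y)"
      "\<pi> = x # \<pi>'"
    by auto
  from y(2) have ne: "\<pi>' \<noteq> []" using length_coupled_path by fastforce
  show ?case using Cons.IH[OF y(2)] move_level[OF y(1)] y(3) ne by auto
qed auto

text \<open>A record of the coin walk is a record of the level, so the walk is then at a vertex whose whole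
  subtree is unexplored.\<close>

lemma coupled_path_fresh:
  assumes "\<pi> \<in> set_pmf (coupled_path t (cs @ [True]) x)" "gap 0 cs = 0" "v \<in> set (butlast \<pi>)"
  shows "length v < length (last \<pi>)"
proof -
  from assms(1) obtain \<pi>1 y where \<pi>: "\<pi>1 \<in> set_pmf (coupled_path t cs x)"
      "y \<in> set_pmf (move (t (last \<pi>1)) True (last \<pi>1))" "\<pi> = butlast \<pi>1 @ [last \<pi>1, y]"
    by (auto simp: coupled_path_append)
  have ne: "\<pi>1 \<noteq> []" using \<pi>(1) length_coupled_path by fastforce
  have "v \<in> set \<pi>1" using assms(3) \<pi>(3) ne
    by (auto simp: butlast_append intro: in_set_butlastD)
  then have "length v \<le> length (last \<pi>1)"
    using coupled_path_below_record[OF \<pi>(1), where k = 0 and v = v] assms(2) by simp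
  then show ?thesis using move_level[OF \<pi>(2)] \<pi>(3) by simp
qed

lemma measurable_coupled_path:
  "(\<lambda>t. measure_pmf (coupled_path t cs x)) \<in> GW Q \<rightarrow>\<^sub>M subprob_algebra (count_space UNIV)"
proof (induction cs arbitrary: x)
  case (Cons c cs)
  have m: "(\<lambda>t. measure_pmf (move (t x) c x)) \<in> GW Q \<rightarrow>\<^sub>M subprob_algebra (count_space UNIV)"
    by (rule measurable_compose[OF measurable_GW_component[of x]])
        (simp add: measure_pmf_in_subprob_algebra)
  have M: "(\<lambda>t. measure_pmf (map_pmf ((#) x) (coupled_path t cs y))) \<in> GW Q
      \<rightarrow>\<^sub>M subprob_algebra (count_space UNIV)" for y
    unfolding map_pmf_rep_eq by (rule measurable_compose[OF Cons measurable_distr]) simp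
  show ?case
    unfolding coupled_path.simps measure_pmf_bind
  proof (rule measurable_bind[OF m])
    show "(\<lambda>p. measure_pmf (map_pmf ((#) x) (coupled_path (fst p) cs (snd p))))
        \<in> GW Q \<Otimes>\<^sub>M count_space UNIV \<rightarrow>\<^sub>M subprob_algebra (count_space UNIV)"
      by (rule measurable_compose_countable[OF measurable_compose[OF measurable_fst M]
          measurable_snd])
  qed
qed (simp add: measure_pmf_in_subprob_algebra)

end

locale biased_walk_on_GW = biased_walk +
  fixes Q :: "nat pmf"
begin

definition annealed :: "bool list \<Rightarrow> (vertex list \<Rightarrow> ennreal) \<Rightarrow> ennreal" where
  "annealed cs g = (\<integral>\<^sup>+t. \<integral>\<^sup>+\<pi>. g \<pi> \<partial>measure_pmf (coupled_path t cs []) \<partial>GW Q)"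

lemma measurable_coupled_path_integral [measurable]:
  "(\<lambda>t. \<integral>\<^sup>+\<pi>. g \<pi> \<partial>measure_pmf (coupled_path t cs x)) \<in> borel_measurable (GW Q)"
  by (rule measurable_compose[OF measurable_coupled_path nn_integral_measurable_subprob_algebra])
      simp

lemma measurable_pmf_coupled_path [measurable]:
  "(\<lambda>t. ennreal (pmf (coupled_path t cs x) \<pi>)) \<in> borel_measurable (GW Q)"
  using measurable_coupled_path_integral[where g = "indicator {\<pi>}" and cs = cs and x = x]
    by (simp add: emeasure_pmf_single)

text \<open>The tree decouples at the final vertex of a path: what has determined the path and what is read
  from the tree afterwards live on disjoint sets of vertices. The sum over all paths is exchanged with the
  expectation over the tree, and each term is a product by \<open>GW_split\<close>.\<close>

lemma annealed_factor:
  assumes h[measurable]: "\<And>x. h x \<in> borel_measurable (GW Q)"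
    and B: "\<And>x t t'. (\<And>u. u \<in> B x \<Longrightarrow> t u = t' u) \<Longrightarrow> h x t = h x t'"
    and \<kappa>: "\<And>x. (\<integral>\<^sup>+t. h x t \<partial>GW Q) = \<kappa>"
    and G: "\<And>t \<pi>. \<pi> \<in> set_pmf (coupled_path t cs []) \<Longrightarrow> G \<pi> \<noteq> 0 \<Longrightarrow> set (butlast \<pi>) \<inter> B (last \<pi>) = {}"
  shows "(\<integral>\<^sup>+t. \<integral>\<^sup>+\<pi>. G \<pi> * h (last \<pi>) t \<partial>measure_pmf (coupled_path t cs []) \<partial>GW Q)
      = annealed cs G * \<kappa>"
proof -
  let ?P = "\<lambda>t \<pi>. ennreal (pmf (coupled_path t cs []) \<pi>)"
  have "(\<integral>\<^sup>+t. ?P t \<pi> * (G \<pi> * h (last \<pi>) t) \<partial>GW Q) = (\<integral>\<^sup>+t. ?P t \<pi> * G \<pi> \<partial>GW Q) * \<kappa>" for \<pi>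
  proof (cases "(\<forall>t. pmf (coupled_path t cs []) \<pi> = 0) \<or> G \<pi> = 0")
    case False
    then have disj: "set (butlast \<pi>) \<inter> B (last \<pi>) = {}" using G by (auto simp: set_pmf_iff)
    have "(\<integral>\<^sup>+t. (?P t \<pi> * G \<pi>) * h (last \<pi>) t \<partial>GW Q) = (\<integral>\<^sup>+t. ?P t \<pi> * G \<pi> \<partial>GW Q)
        * (\<integral>\<^sup>+t. h (last \<pi>) t \<partial>GW Q)"
    proof (rule GW_split[OF _ _ disj])
      show "?P t \<pi> * G \<pi> = ?P t' \<pi> * G \<pi>" if "\<And>u. u \<in> set (butlast \<pi>) \<Longrightarrow> t u = t' u" for t t'
        by (simp only: pmf_coupled_path_local[OF that])
    qed (auto intro!: B)
    then show ?thesis by (simp add: \<kappa> mult.assoc)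
  qed auto
  then have "(\<integral>\<^sup>+\<pi>. \<integral>\<^sup>+t. ?P t \<pi> * (G \<pi> * h (last \<pi>) t) \<partial>GW Q \<partial>count_space UNIV) =
      (\<integral>\<^sup>+\<pi>. \<integral>\<^sup>+t. ?P t \<pi> * G \<pi> \<partial>GW Q \<partial>count_space UNIV) * \<kappa>"
    by (simp add: nn_integral_multc)
  then show ?thesis
    unfolding annealed_def nn_integral_measure_pmf
    by (subst (1 2) nn_integral_count_space_nn_integral) auto
qed

lemma annealed_prefix: "annealed (as @ bs) (\<lambda>\<pi>. G (take (Suc (length as)) \<pi>)) = annealed as G"
  unfolding annealed_def
proof (rule nn_integral_cong)
  fix t
  show "(\<integral>\<^sup>+\<pi>. G (take (Suc (length as)) \<pi>) \<partial>measure_pmf (coupled_path t (as @ bs) []))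
      = (\<integral>\<^sup>+\<pi>. G \<pi> \<partial>measure_pmf (coupled_path t as []))"
    unfolding coupled_path_append nn_integral_bind_pmf nn_integral_map_pmf
  proof (rule nn_integral_cong_AE, rule AE_pmfI)
    fix \<pi>1 assume 1: "\<pi>1 \<in> set_pmf (coupled_path t as [])"
    have "G (take (Suc (length as)) (butlast \<pi>1 @ \<pi>2)) = G \<pi>1"
        if 2: "\<pi>2 \<in> set_pmf (coupled_path t bs (last \<pi>1))" for \<pi>2
    proof -
      obtain \<pi>3 where "\<pi>2 = last \<pi>1 # \<pi>3" using coupled_path_Cons_ex[OF 2] by blast
      moreover have "\<pi>1 \<noteq> []" "length \<pi>1 = Suc (length as)" using length_coupled_path[OF 1] by auto
      ultimately show ?thesis by
          (metis append_Cons append_Nil append_assoc append_butlast_last_id append_eq_conv_conj)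
    qed
    then have "(\<integral>\<^sup>+\<pi>2. G (take (Suc (length as)) (butlast \<pi>1 @ \<pi>2))
        \<partial>measure_pmf (coupled_path t bs (last \<pi>1))) =
        (\<integral>\<^sup>+\<pi>2. G \<pi>1 \<partial>measure_pmf (coupled_path t bs (last \<pi>1)))"
      by (intro nn_integral_cong_AE AE_pmfI)
    then show "(\<integral>\<^sup>+\<pi>2. G (take (Suc (length as)) (butlast \<pi>1 @ \<pi>2))
        \<partial>measure_pmf (coupled_path t bs (last \<pi>1))) = G \<pi>1"
      by simp
  qed
qed

text \<open>At a renewal the walk is at a fresh vertex and never leaves its subtree again, and this subtree is
  a new Galton-Watson tree. Hence the parts of the path before and after the renewal are independent given
  the coins, and the second part has the law of a walk started at the root.\<close>

lemma annealed_renewal: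
  assumes gap: "gap 0 as = 0" and st: "stays_nonneg 0 bs"
    and H: "\<And>x \<pi>. \<pi> \<noteq> [] \<Longrightarrow> H (map ((@) x) \<pi>) = H \<pi>"
  shows "annealed ((as @ [True]) @ bs) (\<lambda>\<pi>. G (take (Suc (Suc (length as))) \<pi>)
      * H (drop (Suc (length as)) \<pi>)) =
    annealed (as @ [True]) G * annealed bs H"
proof -
  let ?as = "as @ [True]"
  define h where "h x t = (\<integral>\<^sup>+\<pi>. H \<pi> \<partial>measure_pmf (coupled_path (\<lambda>u. t (x @ u)) bs []))" for x t
  have hm: "h x \<in> borel_measurable (GW Q)" for x
    unfolding h_def by (rule measurable_compose[OF measurable_shift]) measurable
  have "annealed (?as @ bs) (\<lambda>\<pi>. G (take (Suc (Suc (length as))) \<pi>)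
      * H (drop (Suc (length as)) \<pi>)) =
     (\<integral>\<^sup>+t. \<integral>\<^sup>+\<pi>. G \<pi> * h (last \<pi>) t \<partial>measure_pmf (coupled_path t ?as []) \<partial>GW Q)"
    unfolding annealed_def
  proof (rule nn_integral_cong, unfold coupled_path_append[of _ ?as bs] nn_integral_bind_pmf
      nn_integral_map_pmf, rule nn_integral_cong_AE, rule AE_pmfI)
    fix t \<pi>1 assume 1: "\<pi>1 \<in> set_pmf (coupled_path t ?as [])"
    let ?x = "last \<pi>1"
    have "(\<integral>\<^sup>+\<pi>2. G (take (Suc (Suc (length as))) (butlast \<pi>1 @ \<pi>2))
        * H (drop (Suc (length as)) (butlast \<pi>1 @ \<pi>2)) \<partial>measure_pmf (coupled_path t bs ?x)) =
       (\<integral>\<^sup>+\<pi>2. G \<pi>1 * H \<pi>2 \<partial>measure_pmf (coupled_path t bs ?x))"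
    proof (rule nn_integral_cong_AE, rule AE_pmfI)
      fix \<pi>2 assume "\<pi>2 \<in> set_pmf (coupled_path t bs ?x)"
      then obtain \<pi>3 where "\<pi>2 = last \<pi>1 # \<pi>3" using coupled_path_Cons_ex by blast
      moreover have l: "\<pi>1 \<noteq> []" "length \<pi>1 = Suc (Suc (length as))"
        using length_coupled_path[OF 1] by auto
      ultimately have "take (Suc (Suc (length as))) (butlast \<pi>1 @ \<pi>2) = \<pi>1"
        by (metis append_Cons append_Nil append_assoc append_butlast_last_id append_eq_conv_conj)
      moreover have "drop (Suc (length as)) (butlast \<pi>1 @ \<pi>2) = \<pi>2" using l by simp
      ultimately show "G (take (Suc (Suc (length as))) (butlast \<pi>1 @ \<pi>2))
          * H (drop (Suc (length as)) (butlast \<pi>1 @ \<pi>2)) = G \<pi>1 * H \<pi>2"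
        by simp
    qed
    also have "\<dots> = G \<pi>1 * (\<integral>\<^sup>+\<pi>2. H \<pi>2 \<partial>measure_pmf (coupled_path t bs ?x))"
      by (simp add: nn_integral_cmult)
    also have "(\<integral>\<^sup>+\<pi>2. H \<pi>2 \<partial>measure_pmf (coupled_path t bs ?x)) = h ?x t"
    proof -
      have "coupled_path t bs ?x = map_pmf (map ((@) ?x)) (coupled_path (\<lambda>u. t (?x @ u)) bs [])"
        using coupled_path_shift[of "[]" bs t ?x] st by simp
      then have "(\<integral>\<^sup>+\<pi>2. H \<pi>2 \<partial>measure_pmf (coupled_path t bs ?x)) =
          (\<integral>\<^sup>+\<pi>2. H (map ((@) ?x) \<pi>2) \<partial>measure_pmf (coupled_path (\<lambda>u. t (?x @ u)) bs []))"
        by simp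
      also have "\<dots> = h ?x t"
        unfolding h_def by (intro nn_integral_cong_AE AE_pmfI H) (auto dest: coupled_path_Cons_ex)
      finally show ?thesis .
    qed
    finally show "(\<integral>\<^sup>+\<pi>2. G (take (Suc (Suc (length as))) (butlast \<pi>1 @ \<pi>2))
        * H (drop (Suc (length as)) (butlast \<pi>1 @ \<pi>2)) \<partial>measure_pmf (coupled_path t bs ?x)) =
        G \<pi>1 * h ?x t" .
  qed
  also have "\<dots> = annealed ?as G * annealed bs H"
  proof (rule annealed_factor[where B = "\<lambda>x. range ((@) x)"])
    show "h x \<in> borel_measurable (GW Q)" for x by (rule hm)
    show "h x t = h x t'" if "\<And>u. u \<in> range ((@) x) \<Longrightarrow> t u = t' u" for x t t'
      using that by (simp add: h_def)
    show "(\<integral>\<^sup>+t. h x t \<partial>GW Q) = annealed bs H" for x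
      unfolding h_def annealed_def by (rule nn_integral_GW_shift) measurable
    show "set (butlast \<pi>) \<inter> range ((@) (last \<pi>)) = {}"
        if "\<pi> \<in> set_pmf (coupled_path t ?as [])" for t \<pi>
      using coupled_path_fresh[OF that gap] by fastforce
  qed
  finally show ?thesis .
qed

end

section \<open>Decay of correlations between backward steps\<close>

text \<open>The length requirement excludes the default value of \<open>last []\<close>, which would spoil shift
  invariance.\<close>

definition ends_with_backstep :: "vertex list \<Rightarrow> bool" where
  "ends_with_backstep \<pi> \<longleftrightarrow> length \<pi> \<ge> 2 \<and> length (last \<pi>) < length (last (butlast \<pi>))"

lemma ends_with_backstep_shift: "ends_with_backstep (map ((@) x) \<pi>) = ends_with_backstep \<pi>"
proof (cases "length \<pi> \<ge> 2")
  case True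
  then have "\<pi> \<noteq> []" "butlast \<pi> \<noteq> []" by (auto simp flip: length_greater_0_conv)
  then show ?thesis using True by (simp add: ends_with_backstep_def last_map map_butlast[symmetric])
qed (simp add: ends_with_backstep_def)

lemma ends_with_backstep_drop: "length \<pi> \<ge> n + 2
    \<Longrightarrow> ends_with_backstep (drop n \<pi>) = ends_with_backstep \<pi>"
proof -
  assume l: "length \<pi> \<ge> n + 2"
  then have "last (drop n \<pi>) = last \<pi>" by (intro last_drop) simp
  moreover have "last (butlast (drop n \<pi>)) = last (butlast \<pi>)"
    using l by (subst drop_butlast[symmetric], intro last_drop) simp
  moreover have "2 \<le> length \<pi> - n" "2 \<le> length \<pi>" using l by linarith+
  ultimately show ?thesis by (simp add: ends_with_backstep_def)
qed

context biased_walk_on_GW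
begin

lemma annealed_cong:
  "(\<And>t \<pi>. \<pi> \<in> set_pmf (coupled_path t cs []) \<Longrightarrow> g \<pi> = g' \<pi>) \<Longrightarrow> annealed cs g = annealed cs g'"
  unfolding annealed_def by (intro nn_integral_cong nn_integral_cong_AE AE_pmfI)

lemma annealed_le_1: "(\<And>\<pi>. g \<pi> \<le> 1) \<Longrightarrow> annealed cs g \<le> 1"
proof -
  interpret GW: prob_space "GW Q" by (rule prob_space_GW)
  assume g: "\<And>\<pi>. g \<pi> \<le> 1"
  have "annealed cs g \<le> annealed cs (\<lambda>_. 1)" unfolding annealed_def by (intro nn_integral_mono g)
  then show ?thesis by (simp add: annealed_def GW.emeasure_space_1[simplified])
qed

lemma annealed_1: "annealed cs (\<lambda>_. 1) = 1"
proof -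
  interpret GW: prob_space "GW Q" by (rule prob_space_GW)
  show ?thesis by (simp add: annealed_def GW.emeasure_space_1[simplified])
qed

definition backstep_prob :: "bool list \<Rightarrow> real" where
  "backstep_prob cs = enn2real (annealed cs (\<lambda>\<pi>. of_bool (ends_with_backstep \<pi>)))"

text \<open>The list \<open>take (i + 2) \<pi>\<close> contains the positions at the times \<open>0, \<dots>, i + 1\<close>, so its last step is
  the one at time \<open>i\<close>.\<close>

definition backstep_pair_prob :: "nat \<Rightarrow> bool list \<Rightarrow> real" where
  "backstep_pair_prob i cs = enn2real
      (annealed cs (\<lambda>\<pi>. of_bool (ends_with_backstep (take (i + 2) \<pi>))
          * of_bool (ends_with_backstep \<pi>)))"

lemma enn2real_le_1: "x \<le> 1 \<Longrightarrow> enn2real x \<le> 1"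
  using enn2real_mono[of x 1] by simp

lemma backstep_prob_bounds: "0 \<le> backstep_prob cs" "backstep_prob cs \<le> 1"
  unfolding backstep_prob_def by (auto intro!: enn2real_le_1 annealed_le_1)

lemma backstep_pair_prob_bounds: "0 \<le> backstep_pair_prob i cs" "backstep_pair_prob i cs \<le> 1"
  unfolding backstep_pair_prob_def by (auto intro!: enn2real_le_1 annealed_le_1)

text \<open>If there is a renewal among the coins \<open>bs\<close>, it decouples the last step from everything that
  happened during \<open>as\<close>. Both the law of the last step after \<open>as @ bs\<close> and that after \<open>bs\<close> alone equal the
  one after the coins that follow the renewal; for \<open>bs\<close> alone the same position is a renewal because
  forgetting \<open>as\<close> only makes records easier.\<close>

lemma annealed_renewing:
  assumes "renewing (gap 0 as) bs"
  shows "annealed (as @ bs) (\<lambda>\<pi>. G (take (Suc (length as)) \<pi>) * of_bool (ends_with_backstep \<pi>)) =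
    annealed as G * annealed bs (\<lambda>\<pi>. of_bool (ends_with_backstep \<pi>))"
proof -
  from assms obtain b1 b2 where bs: "bs = b1 @ True # b2" "gap 0 (as @ b1) = 0"
      "stays_nonneg 0 b2" "b2 \<noteq> []"
    by (auto simp: renewing_def gap_append)
  have *: "annealed ((cs @ [True]) @ b2) (\<lambda>\<pi>. F (take (Suc (Suc (length cs))) \<pi>)
      * of_bool (ends_with_backstep \<pi>)) =
      annealed (cs @ [True]) F * annealed b2 (\<lambda>\<pi>. of_bool (ends_with_backstep \<pi>))"
          if "gap 0 cs = 0" for cs F
    unfolding annealed_renewal[OF that bs(3), of
        "\<lambda>\<pi>. of_bool (ends_with_backstep \<pi>)" F, OF arg_cong[OF ends_with_backstep_shift], symmetric]
  proof (rule annealed_cong)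
    fix t \<pi> assume "\<pi> \<in> set_pmf (coupled_path t ((cs @ [True]) @ b2) [])"
    then have "length \<pi> = Suc (Suc (length cs + length b2))" using length_coupled_path by fastforce
    moreover have "length b2 \<ge> 1" using bs by (cases b2) auto
    ultimately have "ends_with_backstep (drop (Suc (length cs)) \<pi>) = ends_with_backstep \<pi>"
      by (intro ends_with_backstep_drop) simp
    then show "F (take (Suc (Suc (length cs))) \<pi>) * of_bool (ends_with_backstep \<pi>) =
      F (take (Suc (Suc (length cs))) \<pi>)
          * of_bool (ends_with_backstep (drop (Suc (length cs)) \<pi>))" by simp
  qed
  have "gap 0 b1 \<le> gap (gap 0 as) b1" by (rule gap_mono) simp
  then have "gap 0 b1 = 0" using bs by (simp add: gap_append)
  from *[OF this, of "\<lambda>_. 1"] have bsd: "annealed bs (\<lambda>\<pi>. of_bool (ends_with_backstep \<pi>))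
      = annealed b2 (\<lambda>\<pi>. of_bool (ends_with_backstep \<pi>))"
    by (simp add: bs annealed_1)
  have "annealed (as @ bs) (\<lambda>\<pi>. G (take (Suc (length as)) \<pi>) * of_bool (ends_with_backstep \<pi>)) =
    annealed (as @ b1 @ [True]) (\<lambda>\<pi>. G (take (Suc (length as)) \<pi>))
        * annealed b2 (\<lambda>\<pi>. of_bool (ends_with_backstep \<pi>))"
    using *[OF bs(2), of "\<lambda>\<pi>. G (take (Suc (length as)) \<pi>)"] by (simp add: bs min_def)
  also have "annealed (as @ b1 @ [True]) (\<lambda>\<pi>. G (take (Suc (length as)) \<pi>)) = annealed as G"
    by (rule annealed_prefix)
  finally show ?thesis by (simp add: bsd)
qed

lemma backstep_prob_renewing: "renewing (gap 0 as) bs \<Longrightarrow> backstep_prob (as @ bs) = backstep_prob bs"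
  using annealed_renewing[of as bs "\<lambda>_. 1"] by (simp add: backstep_prob_def annealed_1)

lemma backstep_pair_prob_renewing:
  assumes "renewing (gap 0 as) bs" "length as = Suc i"
  shows "backstep_pair_prob i (as @ bs) = backstep_prob as * backstep_prob bs"
  using annealed_renewing[OF assms(1), of "\<lambda>\<pi>. of_bool (ends_with_backstep \<pi>)"] assms(2)
  by (simp add: backstep_prob_def backstep_pair_prob_def enn2real_mult)

definition backstep_rate :: "nat \<Rightarrow> real" where "backstep_rate j = coin_mean (Suc j) backstep_prob"
definition backstep_pair_rate :: "nat \<Rightarrow> nat \<Rightarrow> real" where
    "backstep_pair_rate i j = coin_mean (Suc j) (backstep_pair_prob i)"

lemma backstep_rate_bounds: "0 \<le> backstep_rate j" "backstep_rate j \<le> 1"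
  using coin_mean_mono[of "Suc j" "\<lambda>_. 0" backstep_prob] coin_mean_mono[of "Suc j" backstep_prob
      "\<lambda>_. 1"]
  by (auto simp: backstep_rate_def backstep_prob_bounds simp del: coin_mean.simps)

text \<open>Functions with values in the unit interval differ by at most \<open>1\<close> when there is no renewal, an event of
  exponentially small probability.\<close>

lemma coin_mean_diff_le:
  assumes "\<And>as bs. length as = m \<Longrightarrow> length bs = n \<Longrightarrow> renewing (gap 0 as) bs \<Longrightarrow> f as bs = g as bs"
    and "\<And>as bs. 0 \<le> f as bs \<and> f as bs \<le> 1" "\<And>as bs. 0 \<le> g as bs \<and> g as bs \<le> 1"
  shows "\<bar>coin_mean m (\<lambda>as. coin_mean n (f as)) - coin_mean m (\<lambda>as. coin_mean n (g as))\<bar> \<le> 9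
      * (59 / 60) ^ n"
proof -
  have "coin_mean m (\<lambda>as. coin_mean n (f as)) - coin_mean m (\<lambda>as. coin_mean n (g as))
      = coin_mean m (\<lambda>as. coin_mean n (\<lambda>bs. f as bs - g as bs))"
    by (simp add: coin_mean_diff)
  also have "\<bar>\<dots>\<bar> \<le> coin_mean m (\<lambda>as. \<bar>coin_mean n (\<lambda>bs. f as bs - g as bs)\<bar>)"
    by (rule coin_mean_abs_le)
  also have "\<dots> \<le> coin_mean m (\<lambda>as. coin_mean n (\<lambda>bs. \<bar>f as bs - g as bs\<bar>))"
    by (intro coin_mean_mono coin_mean_abs_le)
  also have "\<dots> \<le> coin_mean m (\<lambda>as. coin_mean n (\<lambda>bs. of_bool (\<not> renewing (gap 0 as) bs)))"
  proof (intro coin_mean_mono)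
    fix as bs :: "bool list" assume "length as = m" "length bs = n"
    then show "\<bar>f as bs - g as bs\<bar> \<le> of_bool (\<not> renewing (gap 0 as) bs)"
      using assms(1)[of as bs] assms(2,3)[of as bs] by (cases "renewing (gap 0 as) bs") auto
  qed
  also have "\<dots> \<le> 9 * (59 / 60) ^ n" by (rule coin_mean_not_renewing)
  finally show ?thesis .
qed

text \<open>After \<open>Suc n\<close> further coins there has been a renewal with high probability; therefore starting at the
  root or from an arbitrary past makes little difference.\<close>

lemma backstep_rate_stable: "\<bar>backstep_rate (i + Suc n) - backstep_rate n\<bar> \<le> 9 * (59 / 60) ^ Suc n"
proof -
  have "backstep_rate (i + Suc n)
      = coin_mean (Suc i) (\<lambda>as. coin_mean (Suc n) (\<lambda>bs. backstep_prob (as @ bs)))"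
    using coin_mean_append[of "Suc i" "Suc n" backstep_prob] by (simp add: backstep_rate_def)
  moreover have "backstep_rate n
      = coin_mean (Suc i) (\<lambda>as. coin_mean (Suc n) (\<lambda>bs. backstep_prob bs))"
    by (simp only: backstep_rate_def coin_mean_const)
  ultimately show ?thesis
    by (simp only:) (rule coin_mean_diff_le, auto simp: backstep_prob_renewing backstep_prob_bounds)
qed

lemma backstep_pair_rate_decorrelates: "\<bar>backstep_pair_rate i (i + Suc n) - backstep_rate i
    * backstep_rate n\<bar> \<le> 9 * (59 / 60) ^ Suc n"
proof -
  have "backstep_pair_rate i (i + Suc n)
      = coin_mean (Suc i) (\<lambda>as. coin_mean (Suc n) (\<lambda>bs. backstep_pair_prob i (as @ bs)))"
    using coin_mean_append[of "Suc i" "Suc n" "backstep_pair_prob i"]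
      by (simp add: backstep_pair_rate_def)
  moreover have "backstep_rate i * backstep_rate n
      = coin_mean (Suc i) (\<lambda>as. coin_mean (Suc n) (\<lambda>bs. backstep_prob as * backstep_prob bs))"
    by (simp only: backstep_rate_def coin_mean_mult mult.commute[of _
        "coin_mean (Suc n) backstep_prob"])
  moreover have "\<bar>coin_mean (Suc i) (\<lambda>as. coin_mean (Suc n) (\<lambda>bs. backstep_pair_prob i (as @ bs))) -
      coin_mean (Suc i) (\<lambda>as. coin_mean (Suc n) (\<lambda>bs. backstep_prob as * backstep_prob bs))\<bar> \<le> 9
          * (59 / 60) ^ Suc n"
    by (rule coin_mean_diff_le)
        (auto simp: backstep_pair_prob_renewing backstep_prob_bounds backstep_pair_prob_bounds
            mult_le_one)
  ultimately show ?thesis by (simp only:)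
qed

lemma backstep_rate_covariance: "i < j
    \<Longrightarrow> \<bar>backstep_pair_rate i j - backstep_rate i * backstep_rate j\<bar> \<le> 18 * (59 / 60) ^ (j - i)"
proof -
  assume "i < j"
  then obtain n where j: "j = i + Suc n" by (auto dest: less_imp_Suc_add)
  have "\<bar>backstep_rate i * (backstep_rate j - backstep_rate n)\<bar> \<le> 1 * (9 * (59 / 60) ^ Suc n)"
    unfolding abs_mult j using backstep_rate_bounds[of i]
      by (intro mult_mono backstep_rate_stable) auto
  moreover have "backstep_pair_rate i j - backstep_rate i * backstep_rate j =
      (backstep_pair_rate i (i + Suc n) - backstep_rate i * backstep_rate n) - backstep_rate i
          * (backstep_rate j - backstep_rate n)"
    by (simp add: j algebra_simps)
  moreover have "j - i = Suc n" using j by simp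
  ultimately show ?thesis
    using backstep_pair_rate_decorrelates[of i n]
      abs_triangle_ineq4[of "backstep_pair_rate i (i + Suc n) - backstep_rate i * backstep_rate n"
          "backstep_rate i * (backstep_rate j - backstep_rate n)"]
    by (simp only:)
qed

lemma backstep_rate_convergent: "convergent backstep_rate"
proof (rule Cauchy_convergent, rule metric_CauchyI)
  fix e :: real assume e: "e > 0"
  have "(\<lambda>n. 18 * (59 / 60) ^ n :: real) \<longlonglongrightarrow> 18 * 0"
    by (intro tendsto_mult tendsto_const LIMSEQ_power_zero) simp
  then have "eventually (\<lambda>n. 18 * (59 / 60 :: real) ^ n < e) sequentially"
    using e by (intro order_tendstoD(2)) simp_all
  then obtain N where N: "18 * (59 / 60 :: real) ^ N < e" by (auto simp: eventually_sequentially)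
  have near: "\<bar>backstep_rate m - backstep_rate N\<bar> \<le> 9 * (59 / 60) ^ N" if "m > N" for m
  proof -
    have "m - Suc N + Suc N = m" using that by simp
    then have "\<bar>backstep_rate m - backstep_rate N\<bar> \<le> 9 * (59 / 60) ^ Suc N"
      using backstep_rate_stable[of "m - Suc N" N] by (simp only:)
    also have "\<dots> \<le> 9 * (59 / 60) ^ N" by simp
    finally show ?thesis .
  qed
  show "\<exists>M. \<forall>m\<ge>M. \<forall>n\<ge>M. dist (backstep_rate m) (backstep_rate n) < e"
  proof (intro exI[of _ "Suc N"] allI impI)
    fix m n assume "m \<ge> Suc N" "n \<ge> Suc N"
    then show "dist (backstep_rate m) (backstep_rate n) < e"
      using near[of m] near[of n] N by (auto simp: dist_real_def)
  qed
qed

section \<open>Bounds for the frequency of backward steps\<close>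

lemma move_backstep:
  "(\<integral>\<^sup>+y. of_bool (length y < length x) \<partial>measure_pmf (move k c x)) = of_bool (\<not> c \<and> x \<noteq> [])
      * ennreal (parent_prob k)"
proof (cases "c \<or> x = []")
  case True
  then have "(\<integral>\<^sup>+y. of_bool (length y < length x) \<partial>measure_pmf (move k c x))
      = (\<integral>\<^sup>+y. 0 \<partial>measure_pmf (move k c x))"
    by (intro nn_integral_cong_AE AE_pmfI) (auto dest!: move_level simp: move_def set_uniform_child)
  then show ?thesis using True by auto
next
  case False
  have "(\<integral>\<^sup>+y. of_bool (length y < length x) \<partial>measure_pmf (uniform_child k x))
      = (\<integral>\<^sup>+y. 0 \<partial>measure_pmf (uniform_child k x))"
    by (intro nn_integral_cong_AE AE_pmfI) (auto simp: set_uniform_child)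
  then show ?thesis using False parent_prob[of k]
    by (simp add: move_def nn_integral_bernoulli_pmf)
qed

text \<open>The last coin must show tails and the walk must not be at the root; then the conditional
  probability of a backward step only depends on the number of children of the current vertex.\<close>

lemma annealed_snoc_backstep:
  "annealed (cs @ [c]) (\<lambda>\<pi>. of_bool (ends_with_backstep \<pi>)) =
    (\<integral>\<^sup>+t. \<integral>\<^sup>+\<pi>. of_bool (\<not> c \<and> last \<pi> \<noteq> []) * ennreal (parent_prob (t (last \<pi>)))
        \<partial>measure_pmf (coupled_path t cs []) \<partial>GW Q)"
  unfolding annealed_def coupled_path_append nn_integral_bind_pmf nn_integral_map_pmf
proof (rule nn_integral_cong, rule nn_integral_cong_AE, rule AE_pmfI)
  fix t \<pi> assume "\<pi> \<in> set_pmf (coupled_path t cs [])"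
  then have "\<pi> \<noteq> []" using length_coupled_path by fastforce
  then have "ends_with_backstep (butlast \<pi> @ [last \<pi>, y]) \<longleftrightarrow> length y < length (last \<pi>)" for y
    by (simp add: ends_with_backstep_def butlast_append Suc_le_eq)
  then show "(\<integral>\<^sup>+\<pi>'. of_bool (ends_with_backstep (butlast \<pi> @ \<pi>'))
      \<partial>measure_pmf (coupled_path t [c] (last \<pi>))) =
      of_bool (\<not> c \<and> last \<pi> \<noteq> []) * ennreal (parent_prob (t (last \<pi>)))"
    by (simp add: move_backstep)
qed

text \<open>Up to the factor \<open>q\<close> this is the mean of \<open>1 / (1 + \<beta> * Z)\<close>, the probability of a backward step from
  a fresh vertex.\<close>

definition mean_parent_prob :: real where
  "mean_parent_prob = measure_pmf.expectation Q parent_prob"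

lemma mean_parent_prob: "(\<integral>\<^sup>+t. ennreal (parent_prob (t u)) \<partial>GW Q) = ennreal mean_parent_prob"
proof -
  have "integrable (measure_pmf Q) parent_prob"
    using parent_prob by (intro measure_pmf.integrable_const_bound[where B = 1]) auto
  then show ?thesis
    unfolding mean_parent_prob_def nn_integral_GW_component[where f = "\<lambda>k. ennreal (parent_prob k)"]
    by (rule nn_integral_eq_integral) (simp add: parent_prob)
qed

lemma mean_parent_prob_nonneg: "mean_parent_prob \<ge> 0"
  unfolding mean_parent_prob_def using parent_prob by (intro integral_nonneg_AE) auto

lemma measurable_parent_prob [measurable]: "(\<lambda>t. ennreal (parent_prob (t x)))
    \<in> borel_measurable (GW Q)"
  by (rule measurable_compose[OF measurable_GW_component[of x]]) simp

lemma measurable_coupled_path_integral_last: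
  assumes h[measurable]: "\<And>x. h x \<in> borel_measurable (GW Q)"
  shows "(\<lambda>t. \<integral>\<^sup>+\<pi>. G \<pi> * h (last \<pi>) t \<partial>measure_pmf (coupled_path t cs x))
      \<in> borel_measurable (GW Q)"
proof (rule nn_integral_measurable_subprob_algebra2[OF _ measurable_coupled_path])
  have "(\<lambda>r. G \<pi> * h (last \<pi>) (fst r)) \<in> borel_measurable (GW Q \<Otimes>\<^sub>M count_space UNIV)" for \<pi>
    by measurable
  from measurable_compose_countable[OF this measurable_snd]
  show "(\<lambda>(t, \<pi>). G \<pi> * h (last \<pi>) t) \<in> borel_measurable (GW Q \<Otimes>\<^sub>M count_space UNIV)"
    by (simp add: case_prod_beta')
qed

lemma annealed_factor_back:
  assumes "\<And>t \<pi>. \<pi> \<in> set_pmf (coupled_path t cs []) \<Longrightarrow> G \<pi> \<noteq> 0 \<Longrightarrow> last \<pi> \<notin> set (butlast \<pi>)"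
  shows "(\<integral>\<^sup>+t. \<integral>\<^sup>+\<pi>. G \<pi> * ennreal (parent_prob (t (last \<pi>))) \<partial>measure_pmf (coupled_path t cs [])
      \<partial>GW Q) = annealed cs G * ennreal mean_parent_prob"
  by (rule annealed_factor[where h = "\<lambda>x t. ennreal (parent_prob (t x))" and B = "\<lambda>x. {x}"])
    (use assms in \<open>auto simp: mean_parent_prob\<close>)

text \<open>With probability at least \<open>3/4 * p\<close> the coin walk is at a strict record just before the final step.
  The walk is then at a fresh vertex, and a tail leads back with conditional probability \<open>parent_prob\<close> of
  a fresh offspring number.\<close>

lemma backstep_rate_ge: "backstep_rate (Suc j) \<ge> 3 / 4 * p * q * mean_parent_prob"
proof -
  have *: "backstep_prob ((cs @ [True]) @ [False]) = mean_parent_prob" if "gap 0 cs = 0" for cs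
  proof -
    have fr: "last \<pi> \<noteq> [] \<and> last \<pi> \<notin> set (butlast \<pi>)"
        if \<pi>: "\<pi> \<in> set_pmf (coupled_path t (cs @ [True]) [])" for t \<pi>
    proof
      show "last \<pi> \<notin> set (butlast \<pi>)" using coupled_path_fresh[OF \<pi> \<open>gap 0 cs = 0\<close>] by blast
      obtain \<pi>' where "\<pi> = [] # \<pi>'" using coupled_path_Cons_ex[OF \<pi>] by blast
      moreover have "length \<pi> \<ge> 2" using length_coupled_path[OF \<pi>] by simp
      ultimately have "[] \<in> set (butlast \<pi>)" by auto
      then show "last \<pi> \<noteq> []" using coupled_path_fresh[OF \<pi> \<open>gap 0 cs = 0\<close>] by force
    qed
    have "annealed ((cs @ [True]) @ [False]) (\<lambda>\<pi>. of_bool (ends_with_backstep \<pi>)) =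
      (\<integral>\<^sup>+t. \<integral>\<^sup>+\<pi>. 1 * ennreal (parent_prob (t (last \<pi>)))
          \<partial>measure_pmf (coupled_path t (cs @ [True]) []) \<partial>GW Q)"
      unfolding annealed_snoc_backstep
        by (intro nn_integral_cong nn_integral_cong_AE AE_pmfI) (simp add: fr)
    also have "\<dots> = annealed (cs @ [True]) (\<lambda>_. 1) * ennreal mean_parent_prob"
      by (rule annealed_factor_back) (use fr in blast)
    finally show ?thesis by (simp add: backstep_prob_def annealed_1 mean_parent_prob_nonneg)
  qed
  have "p * q * mean_parent_prob * (3 / 4) \<le> p * q * mean_parent_prob
      * coin_mean j (\<lambda>cs. of_bool (gap 0 cs = 0))"
    using pq mean_parent_prob_nonneg by (intro mult_left_mono coin_mean_gap_eq_0) auto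
  also have "\<dots> = coin_mean j (\<lambda>cs. p * q * mean_parent_prob * of_bool (gap 0 cs = 0))"
    by (rule coin_mean_mult[symmetric])
  also have "\<dots> \<le> coin_mean j (\<lambda>cs. coin_mean 2 (\<lambda>bs. backstep_prob (cs @ bs)))"
  proof (rule coin_mean_mono)
    fix cs
    have "q * (p * mean_parent_prob) \<le> p * (q * backstep_prob (cs @ [True, False]))"
        if "gap 0 cs = 0"
      using *[OF that] by simp
    moreover have "p * (q * backstep_prob (cs @ [True, False]))
        \<le> coin_mean 2 (\<lambda>bs. backstep_prob (cs @ bs))"
      using pq by (simp add: numeral_2_eq_2 algebra_simps backstep_prob_bounds)
    ultimately show "p * q * mean_parent_prob * of_bool (gap 0 cs = 0)
        \<le> coin_mean 2 (\<lambda>bs. backstep_prob (cs @ bs))"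
      using pq backstep_prob_bounds by (auto simp: mult_ac intro: order_trans[rotated])
  qed
  also have "\<dots> = backstep_rate (Suc j)" unfolding backstep_rate_def
    using coin_mean_append[of j 2 backstep_prob] by simp
  finally show ?thesis by (simp add: mult_ac)
qed

text \<open>The current vertex need not be fresh: a vertex with few children is left towards
  the root with larger probability, so it is revisited more often. The sum runs over the time \<open>n\<close> of the first visit to the
  current vertex. At that time its offspring number is fresh, and the return between \<open>n\<close> and now requires
  that the coins in between show no more heads than tails.\<close>

lemma annealed_snoc_backstep_le:
  "annealed (cs @ [False]) (\<lambda>\<pi>. of_bool (ends_with_backstep \<pi>)) \<le>
    (\<Sum>n\<le>length cs. of_bool (heads (drop n cs) \<le> tails (drop n cs))) * ennreal mean_parent_prob"
proof -
  let ?b = "\<lambda>t x. ennreal (parent_prob (t x))"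
  let ?I = "\<lambda>n \<pi>. of_bool (last \<pi> = \<pi> ! n \<and> \<pi> ! n \<notin> set (take n \<pi>)) :: ennreal"
  have "annealed (cs @ [False]) (\<lambda>\<pi>. of_bool (ends_with_backstep \<pi>)) \<le>
      (\<integral>\<^sup>+t. \<integral>\<^sup>+\<pi>. (\<Sum>n\<le>length cs. ?I n \<pi> * ?b t (\<pi> ! n)) \<partial>measure_pmf (coupled_path t cs []) \<partial>GW Q)"
    unfolding annealed_snoc_backstep
  proof (rule nn_integral_mono, rule nn_integral_mono_AE, rule AE_pmfI)
    fix t \<pi> assume \<pi>: "\<pi> \<in> set_pmf (coupled_path t cs [])"
    then have l: "length \<pi> = Suc (length cs)" by (rule length_coupled_path)
    define n where "n = (LEAST n. \<pi> ! n = last \<pi>)"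
    have lst: "\<pi> ! length cs = last \<pi>" using l
      by (metis diff_Suc_1 last_conv_nth length_0_conv nat.distinct(1))
    have n: "\<pi> ! n = last \<pi>" "n \<le> length cs"
      unfolding n_def using lst by (auto intro: LeastI Least_le)
    have "last \<pi> \<notin> set (take n \<pi>)"
    proof
      assume "last \<pi> \<in> set (take n \<pi>)"
      then obtain m where "m < n" "\<pi> ! m = last \<pi>" using n l by (auto simp: in_set_conv_nth)
      then show False unfolding n_def using not_less_Least by blast
    qed
    then have "?b t (last \<pi>) = ?I n \<pi> * ?b t (\<pi> ! n)" using n by simp
    also have "\<dots> \<le> (\<Sum>n\<le>length cs. ?I n \<pi> * ?b t (\<pi> ! n))" using n(2)
      by (intro sum_nonneg_leq_bound[OF _ _ refl]) auto
    finally have "?b t (last \<pi>) \<le> (\<Sum>n\<le>length cs. ?I n \<pi> * ?b t (\<pi> ! n))" .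
    then show "of_bool (\<not> False \<and> last \<pi> \<noteq> []) * ?b t (last \<pi>)
        \<le> (\<Sum>n\<le>length cs. ?I n \<pi> * ?b t (\<pi> ! n))"
      by (auto intro: order_trans[rotated])
  qed
  also have "\<dots> = (\<integral>\<^sup>+t. (\<Sum>n\<le>length cs. \<integral>\<^sup>+\<pi>. ?I n \<pi> * ?b t (\<pi> ! n)
      \<partial>measure_pmf (coupled_path t cs [])) \<partial>GW Q)"
    by (rule nn_integral_cong, rule nn_integral_sum) simp
  also have "\<dots> \<le> (\<integral>\<^sup>+t. (\<Sum>n\<le>length cs. of_bool (heads (drop n cs) \<le> tails (drop n cs)) *
      (\<integral>\<^sup>+\<pi>. of_bool (last \<pi> \<notin> set (butlast \<pi>)) * ?b t (last \<pi>)
          \<partial>measure_pmf (coupled_path t (take n cs) []))) \<partial>GW Q)"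
  proof (intro nn_integral_mono sum_mono)
    fix t n assume "n \<in> {..length cs}"
    then have n: "n \<le> length cs" by simp
    have "(\<integral>\<^sup>+\<pi>. ?I n \<pi> * ?b t (\<pi> ! n) \<partial>measure_pmf (coupled_path t cs [])) =
        (\<integral>\<^sup>+\<pi>1. \<integral>\<^sup>+\<pi>2. ?I n (butlast \<pi>1 @ \<pi>2) * ?b t ((butlast \<pi>1 @ \<pi>2) ! n)
            \<partial>measure_pmf (coupled_path t (drop n cs) (last \<pi>1))
                \<partial>measure_pmf (coupled_path t (take n cs) []))"
      by (subst append_take_drop_id[of n cs, symmetric], subst coupled_path_append) simp
    also have "\<dots> \<le> (\<integral>\<^sup>+\<pi>1. \<integral>\<^sup>+\<pi>2. of_bool (heads (drop n cs) \<le> tails (drop n cs))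
        * (of_bool (last \<pi>1 \<notin> set (butlast \<pi>1)) * ?b t (last \<pi>1))
        \<partial>measure_pmf (coupled_path t (drop n cs) (last \<pi>1))
            \<partial>measure_pmf (coupled_path t (take n cs) []))"
    proof (intro nn_integral_mono_AE AE_pmfI)
      fix \<pi>1 \<pi>2 assume 1: "\<pi>1 \<in> set_pmf (coupled_path t (take n cs) [])"
          and 2: "\<pi>2 \<in> set_pmf (coupled_path t (drop n cs) (last \<pi>1))"
      have l1: "length (butlast \<pi>1) = n" using length_coupled_path[OF 1] n by simp
      obtain \<pi>3 where \<pi>2: "\<pi>2 = last \<pi>1 # \<pi>3" using coupled_path_Cons_ex[OF 2] by blast
      have nth: "(butlast \<pi>1 @ \<pi>2) ! n = last \<pi>1" using l1 \<pi>2 by (simp add: nth_append)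
      have tk: "take n (butlast \<pi>1 @ \<pi>2) = butlast \<pi>1" using l1 by simp
      have la: "last (butlast \<pi>1 @ \<pi>2) = last \<pi>2" using \<pi>2 by simp
      have "heads (drop n cs) \<le> tails (drop n cs)" if "last \<pi>2 = last \<pi>1"
        using coupled_path_climb[OF 2] that by simp
      then show "?I n (butlast \<pi>1 @ \<pi>2) * ?b t ((butlast \<pi>1 @ \<pi>2) ! n) \<le>
          of_bool (heads (drop n cs) \<le> tails (drop n cs))
              * (of_bool (last \<pi>1 \<notin> set (butlast \<pi>1)) * ?b t (last \<pi>1))"
        unfolding nth tk la by auto
    qed
    also have "\<dots> = of_bool (heads (drop n cs) \<le> tails (drop n cs)) *
        (\<integral>\<^sup>+\<pi>. of_bool (last \<pi> \<notin> set (butlast \<pi>)) * ?b t (last \<pi>)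
            \<partial>measure_pmf (coupled_path t (take n cs) []))"
      by (simp add: nn_integral_cmult)
    finally show "(\<integral>\<^sup>+\<pi>. ?I n \<pi> * ?b t (\<pi> ! n) \<partial>measure_pmf (coupled_path t cs [])) \<le>
        of_bool (heads (drop n cs) \<le> tails (drop n cs)) *
        (\<integral>\<^sup>+\<pi>. of_bool (last \<pi> \<notin> set (butlast \<pi>)) * ?b t (last \<pi>)
            \<partial>measure_pmf (coupled_path t (take n cs) []))" .
  qed
  also have "\<dots> = (\<Sum>n\<le>length cs. of_bool (heads (drop n cs) \<le> tails (drop n cs)) *
      (\<integral>\<^sup>+t. \<integral>\<^sup>+\<pi>. of_bool (last \<pi> \<notin> set (butlast \<pi>)) * ?b t (last \<pi>)
          \<partial>measure_pmf (coupled_path t (take n cs) []) \<partial>GW Q))"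
  proof -
    have m: "(\<lambda>t. \<integral>\<^sup>+\<pi>. of_bool (last \<pi> \<notin> set (butlast \<pi>)) * ?b t (last \<pi>)
        \<partial>measure_pmf (coupled_path t (take n cs) []))
        \<in> borel_measurable (GW Q)" for n
      by (rule measurable_coupled_path_integral_last[OF measurable_parent_prob])
    show ?thesis
      by (rule trans[OF nn_integral_sum sum.cong[OF refl nn_integral_cmult[OF m]]])
        (intro borel_measurable_times_ennreal borel_measurable_const m)
  qed
  also have "\<dots> \<le> (\<Sum>n\<le>length cs. of_bool (heads (drop n cs) \<le> tails (drop n cs))
      * ennreal mean_parent_prob)"
  proof (intro sum_mono mult_left_mono)
    fix n
    have "(\<integral>\<^sup>+t. \<integral>\<^sup>+\<pi>. of_bool (last \<pi> \<notin> set (butlast \<pi>)) * ?b t (last \<pi>)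
        \<partial>measure_pmf (coupled_path t (take n cs) []) \<partial>GW Q) =
        annealed (take n cs) (\<lambda>\<pi>. of_bool (last \<pi> \<notin> set (butlast \<pi>))) * ennreal mean_parent_prob"
      by (rule annealed_factor_back) auto
    also have "\<dots> \<le> 1 * ennreal mean_parent_prob" by (intro mult_right_mono annealed_le_1) auto
    finally show "(\<integral>\<^sup>+t. \<integral>\<^sup>+\<pi>. of_bool (last \<pi> \<notin> set (butlast \<pi>)) * ?b t (last \<pi>)
        \<partial>measure_pmf (coupled_path t (take n cs) []) \<partial>GW Q) \<le> ennreal mean_parent_prob"
      by simp
  qed auto
  finally show ?thesis by (simp add: sum_distrib_right)
qed

text \<open>Summing over the time since the first visit gives the factor \<open>6\<close>, the sum of the powers of
  \<open>5/6\<close>.\<close>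

lemma backstep_rate_le: "backstep_rate j \<le> 6 * q * mean_parent_prob"
proof -
  have T: "backstep_prob (cs @ [True]) = 0" for cs
    by (simp add: backstep_prob_def annealed_snoc_backstep)
  have F: "backstep_prob (cs @ [False])
      \<le> (\<Sum>n\<le>length cs. of_bool (heads (drop n cs) \<le> tails (drop n cs))) * mean_parent_prob" for cs
  proof -
    have "(\<Sum>n\<le>length cs. of_bool (heads (drop n cs) \<le> tails (drop n cs)) :: ennreal) =
        ennreal (\<Sum>n\<le>length cs. of_bool (heads (drop n cs) \<le> tails (drop n cs)))"
    proof -
      have "ennreal (\<Sum>n\<le>length cs. of_bool (heads (drop n cs) \<le> tails (drop n cs))) =
          (\<Sum>n\<le>length cs. ennreal (of_bool (heads (drop n cs) \<le> tails (drop n cs))))"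
        by (rule sum_ennreal[symmetric]) simp
      also have "\<dots> = (\<Sum>n\<le>length cs. of_bool (heads (drop n cs) \<le> tails (drop n cs)))"
        by (rule sum.cong) auto
      finally show ?thesis by (rule sym)
    qed
    then have "annealed (cs @ [False]) (\<lambda>\<pi>. of_bool (ends_with_backstep \<pi>)) \<le>
      ennreal ((\<Sum>n\<le>length cs. of_bool (heads (drop n cs) \<le> tails (drop n cs))) * mean_parent_prob)"
      using annealed_snoc_backstep_le[of cs] mean_parent_prob_nonneg
      by (simp add: ennreal_mult sum_nonneg del: sum_of_bool_eq)
    from enn2real_mono[OF this] show ?thesis
      using mean_parent_prob_nonneg by (simp add: backstep_prob_def sum_nonneg del: sum_of_bool_eq)
  qed
  have "backstep_rate j = coin_mean j (\<lambda>cs. q * backstep_prob (cs @ [False]))"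
    unfolding backstep_rate_def coin_mean_snoc by (simp add: T)
  also have "\<dots> \<le> coin_mean j (\<lambda>cs. q * mean_parent_prob
      * (\<Sum>n\<le>j. of_bool (heads (drop n cs) \<le> tails (drop n cs))))"
  proof (rule coin_mean_mono)
    fix cs :: "bool list" assume "length cs = j"
    with F[of cs] have "backstep_prob (cs @ [False])
        \<le> (\<Sum>n\<le>j. of_bool (heads (drop n cs) \<le> tails (drop n cs))) * mean_parent_prob"
      by simp
    then have "q * backstep_prob (cs @ [False]) \<le> q
        * ((\<Sum>n\<le>j. of_bool (heads (drop n cs) \<le> tails (drop n cs))) * mean_parent_prob)"
      using pq by (intro mult_left_mono) auto
    then show "q * backstep_prob (cs @ [False]) \<le> q * mean_parent_prob
        * (\<Sum>n\<le>j. of_bool (heads (drop n cs) \<le> tails (drop n cs)))"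
      by (simp only: mult_ac)
  qed
  also have "\<dots> = q * mean_parent_prob
      * (\<Sum>n\<le>j. coin_mean j (\<lambda>cs. of_bool (heads (drop n cs) \<le> tails (drop n cs))))"
    unfolding coin_mean_mult coin_mean_sum ..
  finally have le: "backstep_rate j \<le> q * mean_parent_prob
      * (\<Sum>n\<le>j. coin_mean j (\<lambda>cs. of_bool (heads (drop n cs) \<le> tails (drop n cs))))" .
  have "(\<Sum>n\<le>j. coin_mean j (\<lambda>cs. of_bool (heads (drop n cs) \<le> tails (drop n cs))))
      \<le> (\<Sum>n\<le>j. (5 / 6) ^ (j - n))"
  proof (rule sum_mono)
    fix n assume "n \<in> {..j}"
    then have "coin_mean j (\<lambda>cs. of_bool (heads (drop n cs) \<le> tails (drop n cs))) =
        coin_mean n (\<lambda>as. coin_mean (j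
            - n) (\<lambda>bs. of_bool (heads (drop n (as @ bs)) \<le> tails (drop n (as @ bs)))))"
      using coin_mean_append[of n "j - n"] by simp
    also have "\<dots> = coin_mean n (\<lambda>as. coin_mean (j - n) (\<lambda>bs. of_bool (heads bs \<le> tails bs)))"
      by (rule coin_mean_cong) simp
    also have "\<dots> \<le> (5 / 6) ^ (j - n)" by (simp add: coin_mean_heads_le_tails)
    finally show "coin_mean j (\<lambda>cs. of_bool (heads (drop n cs) \<le> tails (drop n cs)))
        \<le> (5 / 6) ^ (j - n)" .
  qed
  also have "(\<Sum>n\<le>j. (5 / 6 :: real) ^ (j - n)) = (\<Sum>n\<le>j. (5 / 6) ^ n)"
    by (rule sum.reindex_bij_witness[of _ "\<lambda>n. j - n" "\<lambda>n. j - n"]) auto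
  also have "\<dots> = (1 - (5 / 6) ^ Suc j) / (1 - 5 / 6)"
    by (subst lessThan_Suc_atMost[symmetric], subst sum_gp_strict) simp
  also have "\<dots> \<le> 6" by simp
  finally have "q * mean_parent_prob
      * (\<Sum>n\<le>j. coin_mean j (\<lambda>cs. of_bool (heads (drop n cs) \<le> tails (drop n cs)))) \<le> q
          * mean_parent_prob * 6"
    using pq mean_parent_prob_nonneg by (intro mult_left_mono) auto
  with le show ?thesis by simp
qed

end

section \<open>A strong law for weakly correlated events\<close>

lemma tendsto_average:
  fixes a :: "nat \<Rightarrow> real"
  assumes "a \<longlonglongrightarrow> b"
  shows "(\<lambda>n. (\<Sum>i<n. a i) / n) \<longlonglongrightarrow> b"
proof (rule LIMSEQ_I)
  fix e :: real assume e: "e > 0"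
  obtain N where N: "\<And>i. i \<ge> N \<Longrightarrow> \<bar>a i - b\<bar> < e / 2"
    using LIMSEQ_D[OF assms, of "e / 2"] e by auto
  define C where "C = (\<Sum>i<N. \<bar>a i - b\<bar>)"
  have C: "C \<ge> 0" unfolding C_def by (intro sum_nonneg) auto
  obtain M where M: "real M > 2 * C / e" using reals_Archimedean2 by blast
  show "\<exists>n0. \<forall>n\<ge>n0. norm ((\<Sum>i<n. a i) / n - b) < e"
  proof (intro exI[of _ "Suc (max N M)"] allI impI)
    fix n assume n: "n \<ge> Suc (max N M)"
    then have pos: "real n > 0" by simp
    have "(\<Sum>i<n. a i) / n - b = (\<Sum>i<n. a i - b) / n"
      using pos by (simp add: sum_subtractf field_simps)
    moreover have "\<bar>\<Sum>i<n. a i - b\<bar> \<le> (\<Sum>i<n. \<bar>a i - b\<bar>)" by (rule sum_abs)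
    moreover have "(\<Sum>i<n. \<bar>a i - b\<bar>) = C + (\<Sum>i=N..<n. \<bar>a i - b\<bar>)"
      unfolding C_def using n by (subst sum.union_disjoint[symmetric]) (auto intro!: sum.cong)
    moreover have "(\<Sum>i=N..<n. \<bar>a i - b\<bar>) \<le> (\<Sum>i=N..<n. e / 2)"
      using N by (intro sum_mono) (auto intro: less_imp_le)
    moreover have "(\<Sum>i=N..<n. e / 2) \<le> n * (e / 2)" using e by simp
    ultimately have "norm ((\<Sum>i<n. a i) / n - b) \<le> (C + n * (e / 2)) / n"
      using pos by (simp add: divide_right_mono)
    also have "\<dots> = C / n + e / 2" using pos by (simp add: field_simps)
    also have "C / n < e / 2"
    proof -
      have "2 * C / e < n" using M n by linarith
      then show ?thesis using e pos by (simp add: field_simps)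
    qed
    finally show "norm ((\<Sum>i<n. a i) / n - b) < e" by simp
  qed
qed

text \<open>Between consecutive squares the sum changes by at most \<open>2 k\<close>, which is negligible compared with
  \<open>k\<^sup>2\<close>.\<close>

lemma tendsto_average_from_squares:
  fixes x :: "nat \<Rightarrow> real"
  assumes x: "\<And>i. \<bar>x i\<bar> \<le> 1"
    and sq: "(\<lambda>k. (\<Sum>i<k\<^sup>2. x i) / (real k)\<^sup>2) \<longlonglongrightarrow> 0"
  shows "(\<lambda>n. (\<Sum>i<n. x i) / n) \<longlonglongrightarrow> 0"
proof -
  define g where "g n = nat \<lfloor>sqrt (real n)\<rfloor>" for n
  have g: "filterlim g at_top sequentially"
    unfolding g_def
    by (intro filterlim_compose[OF filterlim_nat_sequentially]
        filterlim_compose[OF filterlim_floor_sequentially]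
        filterlim_compose[OF sqrt_at_top] filterlim_real_sequentially)
  have "(\<lambda>k. \<bar>(\<Sum>i<k\<^sup>2. x i) / (real k)\<^sup>2\<bar> + 2 / real k) \<longlonglongrightarrow> \<bar>0\<bar> + 0"
    by (intro tendsto_add tendsto_rabs sq lim_const_over_n)
  then have lim: "(\<lambda>n. \<bar>(\<Sum>i<(g n)\<^sup>2. x i) / (real (g n))\<^sup>2\<bar> + 2 / real (g n)) \<longlonglongrightarrow> 0"
    using filterlim_compose[OF _ g] by fastforce
  show ?thesis
  proof (rule Lim_null_comparison[OF _ lim], rule eventually_sequentiallyI)
    fix n :: nat assume n: "n \<ge> 1"
    let ?k = "g n"
    have f: "real ?k \<le> sqrt n" "sqrt n < real ?k + 1"
      unfolding g_def by (auto simp: floor_less_iff[symmetric])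
    have "(real ?k)\<^sup>2 \<le> (sqrt n)\<^sup>2" using f by (intro power_mono) auto
    then have k1: "(real ?k)\<^sup>2 \<le> n" by simp
    then have k1': "?k\<^sup>2 \<le> n" by (metis of_nat_le_iff of_nat_power)
    have "(sqrt n)\<^sup>2 < (real ?k + 1)\<^sup>2" using f by (intro power_strict_mono) auto
    then have "real n < (real ?k + 1)\<^sup>2" by simp
    then have "real n < real ((?k + 1)\<^sup>2)" by (simp add: add.commute)
    then have "n < (?k + 1)\<^sup>2" by (simp only: of_nat_less_iff)
    then have k2: "n - ?k\<^sup>2 \<le> 2 * ?k" by (simp add: power2_eq_square)
    have kpos: "?k > 0"
    proof (rule ccontr)
      assume "\<not> ?k > 0"
      then show False using k2 n by simp
    qed
    have "(\<Sum>i<n. x i) = (\<Sum>i<?k\<^sup>2. x i) + (\<Sum>i=?k\<^sup>2..<n. x i)"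
      using k1' by (subst sum.union_disjoint[symmetric]) (auto intro!: sum.cong)
    moreover have "\<bar>\<Sum>i=?k\<^sup>2..<n. x i\<bar> \<le> (\<Sum>i=?k\<^sup>2..<n. 1)"
      by (intro order_trans[OF sum_abs] sum_mono x)
    moreover have "(\<Sum>i=?k\<^sup>2..<n. 1 :: real) \<le> 2 * ?k" using k2 by simp
    ultimately have "\<bar>\<Sum>i<n. x i\<bar> \<le> \<bar>\<Sum>i<?k\<^sup>2. x i\<bar> + 2 * ?k" by linarith
    then have "\<bar>\<Sum>i<n. x i\<bar> / n \<le> (\<bar>\<Sum>i<?k\<^sup>2. x i\<bar> + 2 * ?k) / n" by (rule divide_right_mono) simp
    also have "\<dots> \<le> (\<bar>\<Sum>i<?k\<^sup>2. x i\<bar> + 2 * ?k) / (real ?k)\<^sup>2"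
      using k1 kpos n by (intro divide_left_mono mult_pos_pos) auto
    also have "\<dots> = \<bar>(\<Sum>i<?k\<^sup>2. x i) / (real ?k)\<^sup>2\<bar> + 2 / real ?k"
      using kpos by (simp add: add_divide_distrib power2_eq_square)
    finally show "norm ((\<Sum>i<n. x i) / n) \<le> \<bar>(\<Sum>i<?k\<^sup>2. x i) / (real ?k)\<^sup>2\<bar> + 2 / real ?k" by simp
  qed
qed

lemma sum_geometric_distance:
  assumes "0 \<le> \<rho>" "\<rho> < (1 :: real)"
  shows "(\<Sum>j<n. \<rho> ^ (if j \<le> i then i - j else j - i)) \<le> 2 / (1 - \<rho>)"
proof -
  have geo: "(\<Sum>k<m. \<rho> ^ k) \<le> 1 / (1 - \<rho>)" for m
    using assms by (auto simp: sum_gp_strict intro!: divide_right_mono)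
  have "(\<Sum>j<n. \<rho> ^ (if j \<le> i then i - j else j - i))
      \<le> (\<Sum>j<n. (if j \<le> i then \<rho> ^ (i - j) else 0) + (if j \<ge> i then \<rho> ^ (j - i) else 0))"
    using assms by (intro sum_mono) auto
  also have "\<dots> = (\<Sum>j | j < n \<and> j \<le> i. \<rho> ^ (i - j)) + (\<Sum>j | j < n \<and> j \<ge> i. \<rho> ^ (j - i))"
    by (simp add: sum.distrib sum.If_cases Int_def lessThan_def conj_commute)
  finally have le: "(\<Sum>j<n. \<rho> ^ (if j \<le> i then i - j else j - i)) \<le>
      (\<Sum>j | j < n \<and> j \<le> i. \<rho> ^ (i - j)) + (\<Sum>j | j < n \<and> j \<ge> i. \<rho> ^ (j - i))" .
  have le1: "(\<Sum>j | j < n \<and> j \<le> i. \<rho> ^ (i - j)) \<le> (\<Sum>k<Suc i. \<rho> ^ k)"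
  proof -
    have "(\<Sum>j | j < n \<and> j \<le> i. \<rho> ^ (i - j)) = (\<Sum>k\<in>(\<lambda>j. i - j) ` {j. j < n \<and> j \<le> i}. \<rho> ^ k)"
      by (subst sum.reindex) (auto simp: inj_on_def)
    also have "\<dots> \<le> (\<Sum>k<Suc i. \<rho> ^ k)" using assms by (intro sum_mono2) auto
    finally show ?thesis .
  qed
  have le2: "(\<Sum>j | j < n \<and> j \<ge> i. \<rho> ^ (j - i)) \<le> (\<Sum>k<n. \<rho> ^ k)"
  proof -
    have "(\<Sum>j | j < n \<and> j \<ge> i. \<rho> ^ (j - i)) = (\<Sum>k\<in>(\<lambda>j. j - i) ` {j. j < n \<and> j \<ge> i}. \<rho> ^ k)"
      by (subst sum.reindex) (auto simp: inj_on_def)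
    also have "\<dots> \<le> (\<Sum>k<n. \<rho> ^ k)" using assms by (intro sum_mono2) auto
    finally show ?thesis .
  qed
  have "1 / (1 - \<rho>) + 1 / (1 - \<rho>) = 2 / (1 - \<rho>)" by simp
  then show ?thesis using le le1 le2 geo[of "Suc i"] geo[of n] by linarith
qed

text \<open>Exponentially decaying correlations give a variance of linear order for the counting process. Its
  averages along the squares then have summable second moments, and the bounded increments fill the gaps.\<close>

lemma (in prob_space) events_strong_law:
  fixes B :: "nat \<Rightarrow> 'a set"
  assumes B[measurable]: "\<And>i. B i \<in> events"
    and cov: "\<And>i j. i < j \<Longrightarrow> \<bar>prob (B i \<inter> B j) - prob (B i) * prob (B j)\<bar> \<le> K * \<rho> ^ (j - i)"
    and K: "K \<ge> 1" and \<rho>: "0 \<le> \<rho>" "\<rho> < 1"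
    and lim: "(\<lambda>i. prob (B i)) \<longlonglongrightarrow> b"
  shows "AE \<omega> in M. (\<lambda>n. (\<Sum>i<n. indicator (B i) \<omega>) / real n) \<longlonglongrightarrow> b"
proof -
  define X where "X i \<omega> = indicator (B i) \<omega> - prob (B i)" for i \<omega>
  have X[measurable]: "X i \<in> borel_measurable M" for i unfolding X_def by measurable
  have X1: "\<bar>X i \<omega>\<bar> \<le> 1" for i \<omega> by (auto simp: X_def indicator_def prob_le_1)
  define Y where "Y n \<omega> = (\<Sum>i<n. X i \<omega>)" for n \<omega>
  have Y[measurable]: "Y n \<in> borel_measurable M" for n unfolding Y_def by measurable
  have int: "integrable M (\<lambda>\<omega>. X i \<omega> * X j \<omega>)" for i j
    using X1 by (intro integrable_const_bound[where B = 1]) (auto simp: abs_mult mult_le_one)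
  have EX: "expectation (\<lambda>\<omega>. X i \<omega> * X j \<omega>) = prob (B i \<inter> B j) - prob (B i) * prob (B j)" for i j
  proof -
    have "X i \<omega> * X j \<omega> = indicator (B i \<inter> B j) \<omega> - prob (B j) * indicator (B i) \<omega> - prob (B i)
        * indicator (B j) \<omega> + prob (B i) * prob (B j)" for \<omega>
      by (simp add: X_def indicator_inter_arith algebra_simps)
    moreover have "integrable M (indicat_real A)" "expectation (indicat_real A) = prob A"
        if "A \<in> events" for A
      using that by (simp_all add: integrable_real_indicator less_top[symmetric])
    ultimately show ?thesis by (simp add: prob_space)
  qed
  have cov': "expectation (\<lambda>\<omega>. X i \<omega> * X j \<omega>) \<le> K * \<rho> ^ (if j \<le> i then i - j else j - i)" for i j
  proof (rule linorder_cases[of i j])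
    assume "i < j" then show ?thesis using cov[of i j] by (simp add: EX)
  next
    assume "j < i" then show ?thesis using cov[of j i] by (simp add: EX Int_commute mult.commute)
  next
    assume "i = j"
    moreover have "expectation (\<lambda>\<omega>. X i \<omega> * X i \<omega>) \<le> 1"
      using prob_le_1[of "B i"] by (simp add: EX add_increasing2 diff_le_eq)
    ultimately show ?thesis using K by simp
  qed
  define C where "C = K * (2 / (1 - \<rho>))"
  have C: "C \<ge> 0" using K \<rho> by (simp add: C_def)
  have EY: "expectation (\<lambda>\<omega>. (Y n \<omega>)\<^sup>2) \<le> C * n" for n
  proof -
    have "expectation (\<lambda>\<omega>. (Y n \<omega>)\<^sup>2) = (\<Sum>i<n. \<Sum>j<n. expectation (\<lambda>\<omega>. X i \<omega> * X j \<omega>))"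
      unfolding Y_def power2_eq_square sum_product by (simp add: int)
    also have "\<dots> \<le> (\<Sum>i<n. \<Sum>j<n. K * \<rho> ^ (if j \<le> i then i - j else j - i))"
      by (intro sum_mono cov')
    also have "\<dots> \<le> (\<Sum>i<n. C)"
      unfolding C_def sum_distrib_left[symmetric] using K \<rho>
      by (intro sum_mono mult_left_mono sum_geometric_distance) auto
    finally show ?thesis by (simp add: mult.commute)
  qed
  have intY: "integrable M (\<lambda>\<omega>. (Y n \<omega>)\<^sup>2)" for n
    unfolding Y_def power2_eq_square sum_product by (intro Bochner_Integration.integrable_sum int)
  \<comment> \<open>indexed from 1 to avoid division by 0\<close>
  define Z where "Z k \<omega> = (Y ((Suc k)\<^sup>2) \<omega> / (real (Suc k))\<^sup>2)\<^sup>2" for k \<omega>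
  have Z[measurable]: "Z k \<in> borel_measurable M" for k unfolding Z_def by measurable
  have Zle: "(\<integral>\<^sup>+\<omega>. ennreal (Z k \<omega>) \<partial>M) \<le> ennreal (C / (real (Suc k))\<^sup>2)" for k
  proof -
    let ?s = "(real (Suc k))\<^sup>2"
    have "(\<integral>\<^sup>+\<omega>. ennreal (Z k \<omega>) \<partial>M) = ennreal (expectation (Z k))"
      unfolding Z_def power_divide by (intro nn_integral_eq_integral integrable_divide intY) auto
    also have "expectation (Z k) = expectation (\<lambda>\<omega>. (Y ((Suc k)\<^sup>2) \<omega>)\<^sup>2) / ?s\<^sup>2"
      by (simp only: Z_def[abs_def] power_divide integral_divide_zero)
    also have "\<dots> \<le> C * ?s / ?s\<^sup>2"
      using EY[of "(Suc k)\<^sup>2"] by (intro divide_right_mono)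
          (simp_all only: of_nat_power zero_le_power2)
    also have "\<dots> = C / ?s" by (simp add: power2_eq_square)
    finally show ?thesis by (simp add: ennreal_leI)
  qed
  have sC: "summable (\<lambda>k. C / (real (Suc k))\<^sup>2)"
    using summable_mult[OF inverse_power_summable[of 2, where 'a = real], of C]
    by (subst summable_Suc_iff) (simp add: divide_inverse)
  have "(\<integral>\<^sup>+\<omega>. (\<Sum>k. ennreal (Z k \<omega>)) \<partial>M) = (\<Sum>k. \<integral>\<^sup>+\<omega>. ennreal (Z k \<omega>) \<partial>M)"
    by (rule nn_integral_suminf) measurable
  also have "\<dots> \<le> (\<Sum>k. ennreal (C / (real (Suc k))\<^sup>2))" by (intro suminf_le Zle) auto
  also have "\<dots> = ennreal (\<Sum>k. C / (real (Suc k))\<^sup>2)" using sC C by (intro suminf_ennreal2) auto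
  also have "\<dots> < \<infinity>" by simp
  finally have "(\<integral>\<^sup>+\<omega>. (\<Sum>k. ennreal (Z k \<omega>)) \<partial>M) \<noteq> \<infinity>" by simp
  then have "AE \<omega> in M. (\<Sum>k. ennreal (Z k \<omega>)) \<noteq> \<infinity>"
    by (intro nn_integral_PInf_AE) measurable
  then show ?thesis
  proof eventually_elim
    case (elim \<omega>)
    have "summable (\<lambda>k. Z k \<omega>)"
      using elim by (intro summable_suminf_not_top) (auto simp: Z_def)
    then have "(\<lambda>k. Z k \<omega>) \<longlonglongrightarrow> 0" by (rule summable_LIMSEQ_zero)
    then have "(\<lambda>k. sqrt (Z k \<omega>)) \<longlonglongrightarrow> sqrt 0" by (rule tendsto_real_sqrt)
    then have "(\<lambda>k. \<bar>Y ((Suc k)\<^sup>2) \<omega> / (real (Suc k))\<^sup>2\<bar>) \<longlonglongrightarrow> 0"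
      unfolding Z_def real_sqrt_abs by simp
    then have "(\<lambda>k. Y ((Suc k)\<^sup>2) \<omega> / (real (Suc k))\<^sup>2) \<longlonglongrightarrow> 0" by (rule tendsto_rabs_zero_cancel)
    then have "(\<lambda>k. Y (k\<^sup>2) \<omega> / (real k)\<^sup>2) \<longlonglongrightarrow> 0" by (rule LIMSEQ_imp_Suc)
    then have "(\<lambda>n. (\<Sum>i<n. X i \<omega>) / n) \<longlonglongrightarrow> 0"
      unfolding Y_def using X1 by (intro tendsto_average_from_squares)
    from tendsto_add[OF this tendsto_average[OF lim]]
    show ?case by (simp add: X_def sum_subtractf diff_divide_distrib)
  qed
qed

section \<open>The speed\<close>

context biased_walk
begin

primrec quenched_path :: "tree \<Rightarrow> nat \<Rightarrow> vertex \<Rightarrow> vertex list pmf" where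
  "quenched_path t 0 x = return_pmf [x]"
| "quenched_path t (Suc n) x = step \<beta> t x \<bind> (\<lambda>y. map_pmf ((#) x) (quenched_path t n y))"

lemma pmf_quenched_path:
  "pmf (quenched_path t n x) xs =
    (if length xs = Suc n \<and> xs ! 0 = x then \<Prod>i<n. pmf (step \<beta> t (xs ! i)) (xs ! Suc i) else 0)"
proof (induction n arbitrary: x xs)
  case 0
  then show ?case by (cases xs) (auto simp: pmf_return)
next
  case (Suc n)
  show ?case
  proof (cases xs)
    case Nil
    have "[] \<notin> set_pmf (quenched_path t (Suc n) x)" by auto
    then show ?thesis using Nil by (simp add: set_pmf_iff del: quenched_path.simps)
  next
    case (Cons z ys)
    show ?thesis
    proof (cases "z = x")
      case False
      then have "xs \<notin> set_pmf (quenched_path t (Suc n) x)" using Cons by auto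
      then show ?thesis using Cons False by (simp add: set_pmf_iff del: quenched_path.simps)
    next
      case True
      have "pmf (quenched_path t (Suc n) x) xs
          = measure_pmf.expectation (step \<beta> t x) (\<lambda>y. pmf (quenched_path t n y) ys)"
        using Cons True by (simp add: pmf_bind pmf_map_inj')
      also have "\<dots> = measure_pmf.expectation (step \<beta> t x)
          (\<lambda>y. (if length ys = Suc n then \<Prod>i<n. pmf (step \<beta> t (ys ! i)) (ys ! Suc i) else 0)
              * indicator {ys ! 0} y)"
        unfolding Suc by (intro Bochner_Integration.integral_cong) (auto simp: indicator_def)
      also have "\<dots> = (if length ys = Suc n then \<Prod>i<n. pmf (step \<beta> t (ys ! i)) (ys ! Suc i) else 0)
          * pmf (step \<beta> t x) (ys ! 0)"
        by (simp add: pmf.rep_eq)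
      also have "\<dots> = (if length xs = Suc (Suc n) \<and> xs ! 0
          = x then \<Prod>i<Suc n. pmf (step \<beta> t (xs ! i)) (xs ! Suc i) else 0)"
        unfolding prod.lessThan_Suc_shift using Cons True by simp
      finally show ?thesis .
    qed
  qed
qed

abbreviation coins :: "nat \<Rightarrow> bool list pmf" where
  "coins n \<equiv> replicate_pmf n (bernoulli_pmf p)"

text \<open>All coins can be tossed in advance.\<close>

lemma quenched_path_coins:
  assumes "\<And>u. t u > 0"
  shows "quenched_path t n x = coins n \<bind> (\<lambda>cs. coupled_path t cs x)"
proof (induction n arbitrary: x)
  case (Suc n)
  have "quenched_path t (Suc n) x = bernoulli_pmf p
      \<bind> (\<lambda>c. move (t x) c x \<bind> (\<lambda>y. coins n \<bind> (\<lambda>cs. map_pmf ((#) x) (coupled_path t cs y))))"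
    by (simp add: Suc coin_move[OF assms, symmetric] bind_assoc_pmf map_bind_pmf)
  also have "\<dots> = bernoulli_pmf p \<bind> (\<lambda>c. coins n \<bind> (\<lambda>cs. coupled_path t (c # cs) x))"
    by (subst bind_commute_pmf) simp
  also have "\<dots> = coins (Suc n) \<bind> (\<lambda>cs. coupled_path t cs x)"
    by (simp add: bind_assoc_pmf bind_return_pmf)
  finally show ?case .
qed (simp add: bind_return_pmf)

lemma nn_integral_coins:
  "(\<And>cs. f cs \<ge> 0) \<Longrightarrow> (\<integral>\<^sup>+cs. ennreal (f cs) \<partial>measure_pmf (coins n)) = ennreal (coin_mean n f)"
proof (induction n arbitrary: f)
  case (Suc n)
  have p: "0 \<le> p" "p \<le> 1" "1 - p = q" using pq by auto
  have nonneg: "coin_mean n (\<lambda>cs. f (c # cs)) \<ge> 0" for c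
    using coin_mean_mono[of n "\<lambda>_. 0" "\<lambda>cs. f (c # cs)"] Suc.prems by simp
  show ?case
    using p(1,2) pq(3) nonneg Suc
    by (simp add: nn_integral_bernoulli_pmf ennreal_plus ennreal_mult p(3) mult.commute)
qed simp

lemma measurable_walk_prefix: "(\<lambda>X. map X ns) \<in> walk \<beta> t \<rightarrow>\<^sub>M count_space UNIV"
proof (induction ns)
  case (Cons i ns)
  have "(\<lambda>X. X i) \<in> walk \<beta> t \<rightarrow>\<^sub>M count_space UNIV"
    unfolding measurable_cong_sets[OF sets_walk refl] by (rule measurable_component_singleton) simp
  then show ?case using Cons by simp
qed simp

lemma walk_prefix:
  "distr (walk \<beta> t) (count_space UNIV) (\<lambda>X. map X [0..<Suc n]) = measure_pmf (quenched_path t n [])"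
proof (rule measure_eqI_countable[where A = UNIV])
  fix xs :: "vertex list"
  note m = measurable_walk_prefix[of "[0..<Suc n]" t]
  have sp: "space (walk \<beta> t) = UNIV" using sets_eq_imp_space_eq[OF sets_walk]
    by (simp add: space_PiM)
  have eq: "(\<lambda>X. map X [0..<Suc n]) -` {xs}
      = (if length xs = Suc n then {X. \<forall>i\<le>n. X i = xs ! i} else {})"
  proof -
    have "map X [0..<Suc n] = xs \<longleftrightarrow> length xs = Suc n \<and> (\<forall>i<Suc n. X i = xs ! i)" for X
      unfolding list_eq_iff_nth_eq by (auto simp del: upt_Suc)
    then show ?thesis by (auto simp: less_Suc_eq_le simp del: upt_Suc)
  qed
  show "emeasure (distr (walk \<beta> t) (count_space UNIV) (\<lambda>X. map X [0..<Suc n])) {xs}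
      = emeasure (measure_pmf (quenched_path t n [])) {xs}"
    by (subst emeasure_distr[OF m]) 
      (auto simp: sp eq emeasure_walk_cylinder emeasure_pmf_single pmf_quenched_path prod_ennreal
          simp del: upt_Suc)
qed auto

end

locale biased_walk_on_leafless_GW = biased_walk_on_GW +
  assumes Q0: "pmf Q 0 = 0"
begin

lemma sets_averaged [measurable_cong]: "sets (averaged \<beta> Q) = sets (GW Q \<Otimes>\<^sub>M paths)"
  unfolding averaged_def by (rule sets_bind_measurable[OF measurable_averaged_kernel]) simp

lemma prob_space_averaged: "prob_space (averaged \<beta> Q)"
  unfolding averaged_def
proof (rule prob_space.prob_space_bind[OF prob_space_GW])
  show "AE t in GW Q. prob_space (distr (walk \<beta> t) (GW Q \<Otimes>\<^sub>M paths) (\<lambda>X. (t, X)))"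
    by (intro AE_I2 prob_space.prob_space_distr prob_space_walk) measurable
qed (rule measurable_averaged_kernel)

lemma measurable_prefix [measurable]:
  "(\<lambda>r. map (snd r) [0..<n]) \<in> averaged \<beta> Q \<rightarrow>\<^sub>M count_space UNIV"
proof -
  have "(\<lambda>r. map (snd r) is) \<in> GW Q \<Otimes>\<^sub>M paths \<rightarrow>\<^sub>M count_space UNIV" for "is"
  proof (induction "is")
    case (Cons i "is")
    have "(\<lambda>r. snd r i) \<in> GW Q \<Otimes>\<^sub>M paths \<rightarrow>\<^sub>M count_space UNIV" by measurable
    then show ?case using Cons by simp
  qed simp
  then show ?thesis unfolding measurable_cong_sets[OF sets_averaged refl] .
qed

text \<open>The bridge between the walk on path space and the finite-dimensional laws given the coins.\<close>

lemma emeasure_averaged: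
  "emeasure (averaged \<beta> Q) {r. map (snd r) [0..<Suc n] \<in> A} =
    ennreal (coin_mean n (\<lambda>cs. enn2real (annealed cs (indicator A))))"
proof -
  let ?E = "{r. map (snd r) [0..<Suc n] \<in> A}"
  have sp: "space (averaged \<beta> Q) = UNIV" "space (GW Q \<Otimes>\<^sub>M paths) = UNIV"
    using sets_eq_imp_space_eq[OF sets_averaged] by (auto simp: space_pair_measure space_PiM)
  have E: "?E \<in> sets (GW Q \<Otimes>\<^sub>M paths)"
    using measurable_sets[OF measurable_prefix[of "Suc n"], of A]
      by (simp add: vimage_def sp sets_averaged)
  have mA: "(\<lambda>t. emeasure (measure_pmf (coupled_path t cs [])) A) \<in> borel_measurable (GW Q)" for cs
    using measurable_coupled_path_integral[where g = "indicator A" and cs = cs and x = "[]"] by simp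
  have "emeasure (averaged \<beta> Q) ?E
      = (\<integral>\<^sup>+t. emeasure (distr (walk \<beta> t) (GW Q \<Otimes>\<^sub>M paths) (\<lambda>X. (t, X))) ?E \<partial>GW Q)"
    unfolding averaged_def by (rule emeasure_bind[OF _ measurable_averaged_kernel E]) simp
  also have "\<dots> = (\<integral>\<^sup>+t. \<integral>\<^sup>+cs. \<integral>\<^sup>+\<pi>. indicator A \<pi> \<partial>measure_pmf (coupled_path t cs [])
      \<partial>measure_pmf (coins n) \<partial>GW Q)"
  proof (rule nn_integral_cong_AE, use AE_no_leaves[OF Q0] in eventually_elim)
    case (elim t)
    have spw: "space (walk \<beta> t) = UNIV" using sets_eq_imp_space_eq[OF sets_walk]
      by (simp add: space_PiM)
    note m = measurable_walk_prefix[of "[0..<Suc n]" t]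
    have "emeasure (distr (walk \<beta> t) (GW Q \<Otimes>\<^sub>M paths) (\<lambda>X. (t, X))) ?E
        = emeasure (walk \<beta> t) {X. map X [0..<Suc n] \<in> A}"
      using E by (subst emeasure_distr) (auto simp: spw vimage_def)
    also have "\<dots> = emeasure (distr (walk \<beta> t) (count_space UNIV) (\<lambda>X. map X [0..<Suc n])) A"
      by (subst emeasure_distr[OF m]) (auto simp: spw vimage_def)
    also have "\<dots> = emeasure (measure_pmf (coins n \<bind> (\<lambda>cs. coupled_path t cs []))) A"
      using elim by (simp only: walk_prefix quenched_path_coins)
    also have "\<dots> = (\<integral>\<^sup>+cs. \<integral>\<^sup>+\<pi>. indicator A \<pi> \<partial>measure_pmf (coupled_path t cs [])
        \<partial>measure_pmf (coins n))"
      by simp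
    finally show ?case .
  qed
  also have "\<dots> = (\<integral>\<^sup>+cs. annealed cs (indicator A) \<partial>measure_pmf (coins n))"
    unfolding annealed_def nn_integral_measure_pmf[where p = "coins n"]
    by (subst nn_integral_count_space_nn_integral)
      (simp_all add: nn_integral_cmult mA borel_measurable_times_ennreal)
  also have "\<dots> = (\<integral>\<^sup>+cs. ennreal (enn2real (annealed cs (indicator A))) \<partial>measure_pmf (coins n))"
  proof (rule nn_integral_cong)
    fix cs
    have "annealed cs (indicator A) \<le> 1" by (rule annealed_le_1) (simp add: indicator_def)
    then have "annealed cs (indicator A) < top" by (rule order.strict_trans1) simp
    then show "annealed cs (indicator A) = ennreal (enn2real (annealed cs (indicator A)))" by simp
  qed
  also have "\<dots> = ennreal (coin_mean n (\<lambda>cs. enn2real (annealed cs (indicator A))))"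
    by (rule nn_integral_coins) simp
  finally show ?thesis .
qed

lemma prob_averaged:
  "measure (averaged \<beta> Q) {r. map (snd r) [0..<Suc n] \<in> A}
      = coin_mean n (\<lambda>cs. enn2real (annealed cs (indicator A)))"
proof -
  have "coin_mean n (\<lambda>cs. enn2real (annealed cs (indicator A))) \<ge> 0"
    using coin_mean_mono[of n "\<lambda>_. 0"] by simp
  then show ?thesis using emeasure_averaged[of n A] by (simp add: measure_def)
qed

definition backstep_event :: "nat \<Rightarrow> (tree \<times> (nat \<Rightarrow> vertex)) set" where
  "backstep_event i = {r. length (snd r (Suc i)) < length (snd r i)}"

lemma backstep_event_prefix: "backstep_event i = {r. map (snd r) [0..<Suc (Suc i)]
    \<in> {\<pi>. ends_with_backstep \<pi>}}"
  by (auto simp: backstep_event_def ends_with_backstep_def butlast_append)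

lemma backstep_event_Int_prefix:
  assumes "i < j"
  shows "backstep_event i \<inter> backstep_event j = {r. map (snd r) [0..<Suc (Suc j)]
      \<in> {\<pi>. ends_with_backstep (take (i + 2) \<pi>) \<and> ends_with_backstep \<pi>}}"
proof -
  have "take (i + 2) (map X [0..<Suc (Suc j)]) = map X [0..<Suc (Suc i)]" for X :: "nat \<Rightarrow> vertex"
    using assms by (simp add: take_map del: upt_Suc)
  then show ?thesis unfolding backstep_event_prefix by (auto simp del: upt_Suc)
qed

lemma prob_backstep_event: "measure (averaged \<beta> Q) (backstep_event i) = backstep_rate i"
  unfolding backstep_event_prefix prob_averaged backstep_rate_def backstep_prob_def
  by (rule coin_mean_cong, rule arg_cong[where f = enn2real], rule annealed_cong)
      (simp add: indicator_def)

lemma prob_backstep_event_Int: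
  assumes "i < j"
  shows "measure (averaged \<beta> Q) (backstep_event i \<inter> backstep_event j) = backstep_pair_rate i j"
  unfolding backstep_event_Int_prefix[OF assms] prob_averaged backstep_pair_rate_def
      backstep_pair_prob_def
  by (rule coin_mean_cong, rule arg_cong[where f = enn2real], rule annealed_cong)
      (simp add: indicator_def)

lemma sets_backstep_event [measurable]: "backstep_event i \<in> sets (averaged \<beta> Q)"
proof -
  have "space (averaged \<beta> Q) = UNIV"
    using sets_eq_imp_space_eq[OF sets_averaged] by (auto simp: space_pair_measure space_PiM)
  then show ?thesis
    using measurable_sets[OF measurable_prefix[of "Suc (Suc i)"], of "{\<pi>. ends_with_backstep \<pi>}"]
    by (simp add: vimage_def backstep_event_prefix del: upt_Suc)
qed

lemma coupled_path_last_step: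
  assumes "\<pi> \<in> set_pmf (coupled_path t cs x)" "cs \<noteq> []"
  shows "length (last \<pi>) = Suc (length (last (butlast \<pi>))) \<or> length (last (butlast \<pi>))
      = Suc (length (last \<pi>))"
proof -
  obtain cs' c where cs: "cs = cs' @ [c]" using assms(2) by (metis rev_exhaust)
  from assms(1) obtain \<pi>1 y where \<pi>: "\<pi>1 \<in> set_pmf (coupled_path t cs' x)"
      "y \<in> set_pmf (move (t (last \<pi>1)) c (last \<pi>1))" "\<pi> = butlast \<pi>1 @ [last \<pi>1, y]"
    unfolding cs by (auto simp: coupled_path_append)
  then show ?thesis using move_level[OF \<pi>(2)] by (auto simp: butlast_append)
qed

lemma AE_nearest_neighbour:
  "AE r in averaged \<beta> Q. snd r 0 = [] \<and> (\<forall>i. length (snd r (Suc i)) = Suc (length (snd r i)) \<or>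
     length (snd r i) = Suc (length (snd r (Suc i))))"
proof (intro AE_conjI, goal_cases)
  interpret prob_space "averaged \<beta> Q" by (rule prob_space_averaged)
  have null: "AE r in averaged \<beta> Q. map (snd r) [0..<Suc n] \<in> A"
    if "\<And>t cs \<pi>. length cs = n \<Longrightarrow> \<pi> \<in> set_pmf (coupled_path t cs []) \<Longrightarrow> \<pi> \<in> A" for n A
  proof -
    have "prob {r. map (snd r) [0..<Suc n] \<in> A} = coin_mean n (\<lambda>_. 1)"
      unfolding prob_averaged
    proof (rule coin_mean_cong)
      fix cs :: "bool list" assume "length cs = n"
      then have "annealed cs (indicator A) = annealed cs (\<lambda>_. 1)"
        by (intro annealed_cong) (simp add: that)
      then show "enn2real (annealed cs (indicator A)) = 1" by (simp add: annealed_1)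
    qed
    moreover have "{r. map (snd r) [0..<Suc n] \<in> A} \<in> events"
      using measurable_sets[OF measurable_prefix[of
          "Suc n"], of A] sets_eq_imp_space_eq[OF sets_averaged]
      by (simp add: vimage_def space_pair_measure space_PiM)
    ultimately show ?thesis using prob_eq_1 by (auto elim!: AE_mp)
  qed
  case 1
  show ?case using null[of 0 "{[[]]}"] by simp
  case 2
  show ?case
  proof (subst AE_all_countable, rule allI)
    fix i
    have "AE r in averaged \<beta> Q. map (snd r) [0..<Suc (Suc i)] \<in>
      {\<pi>. length (last \<pi>) = Suc (length (last (butlast \<pi>))) \<or> length (last (butlast \<pi>))
          = Suc (length (last \<pi>))}"
      by (rule null) (use coupled_path_last_step in force)
    then show "AE r in averaged \<beta> Q. length (snd r (Suc i)) = Suc (length (snd r i)) \<or>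
        length (snd r i) = Suc (length (snd r (Suc i)))"
      by eventually_elim (simp add: butlast_append)
  qed
qed

text \<open>Each step changes the level by one, and it is a backward step or not; so counting backward steps
  determines the level.\<close>

lemma level_eq:
  fixes X :: "nat \<Rightarrow> vertex"
  assumes "X 0 = []" "\<And>i. length (X (Suc i)) = Suc (length (X i)) \<or> length (X i)
      = Suc (length (X (Suc i)))"
  shows "real (length (X n)) = real n - 2 * (\<Sum>i<n. indicator (backstep_event i) (t, X))"
proof (induction n)
  case (Suc n)
  have "real (length (X (Suc n))) = real (length (X n)) + 1 - 2
      * indicator (backstep_event n) (t, X)"
    using assms(2)[of n] by (auto simp: backstep_event_def indicator_def)
  then show ?case using Suc by simp
qed (simp add: assms)

lemma AE_speed: "AE (t, X) in averaged \<beta> Q. (\<lambda>n. real (length (X n)) / real n) \<longlonglongrightarrow> 1 - 2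
    * lim backstep_rate"
proof -
  interpret prob_space "averaged \<beta> Q" by (rule prob_space_averaged)
  have "AE r in averaged \<beta> Q. (\<lambda>n. (\<Sum>i<n. indicator (backstep_event i) r) / real n)
      \<longlonglongrightarrow> lim backstep_rate"
  proof (rule events_strong_law[where K = 18 and \<rho> = "59 / 60"])
    show "\<bar>prob (backstep_event i \<inter> backstep_event j) - prob (backstep_event i)
        * prob (backstep_event j)\<bar> \<le> 18 * (59 / 60) ^ (j - i)"
      if "i < j" for i j
      using backstep_rate_covariance[OF that] that
        by (simp add: prob_backstep_event prob_backstep_event_Int)
    show "(\<lambda>i. prob (backstep_event i)) \<longlonglongrightarrow> lim backstep_rate"
      using backstep_rate_convergent by (simp add: prob_backstep_event convergent_LIMSEQ_iff)
  qed auto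
  then show ?thesis using AE_nearest_neighbour
  proof eventually_elim
    case (elim r)
    obtain t X where r: "r = (t, X)" by (cases r)
    have "(\<lambda>n. 1 - 2 * ((\<Sum>i<n. indicator (backstep_event i) r) / real n)) \<longlonglongrightarrow> 1 - 2
        * lim backstep_rate"
      using elim by (intro tendsto_intros) auto
    moreover have "eventually (\<lambda>n. 1 - 2 * ((\<Sum>i<n. indicator (backstep_event i) r) / real n)
        = real (length (X n)) / real n) sequentially"
    proof (rule eventually_sequentiallyI)
      fix n :: nat assume "n \<ge> 1"
      then show "1 - 2 * ((\<Sum>i<n. indicator (backstep_event i) r) / real n)
          = real (length (X n)) / real n"
        using level_eq[of X n t] elim by (simp add: r diff_divide_distrib)
    qed
    ultimately have "(\<lambda>n. real (length (X n)) / real n) \<longlonglongrightarrow> 1 - 2 * lim backstep_rate"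
      by (rule Lim_transform_eventually)
    then show ?case by (simp add: r)
  qed
qed

lemma speed_eq: "speed \<beta> Q = 1 - 2 * lim backstep_rate"
  unfolding speed_def
proof (rule the_equality)
  show "AE (t, X) in averaged \<beta> Q. (\<lambda>n. real (length (X n)) / real n) \<longlonglongrightarrow> 1 - 2 * lim backstep_rate"
    by (rule AE_speed)
  interpret prob_space "averaged \<beta> Q" by (rule prob_space_averaged)
  fix v assume "AE (t, X) in averaged \<beta> Q. (\<lambda>n. real (length (X n)) / real n) \<longlonglongrightarrow> v"
  with AE_speed have "AE r in averaged \<beta> Q. v = 1 - 2 * lim backstep_rate"
    by eventually_elim (auto intro: LIMSEQ_unique)
  then show "v = 1 - 2 * lim backstep_rate" by simp
qed

text \<open>For \<open>\<beta> \<ge> 4\<close> the ratio of \<open>1 + \<beta>\<close> and \<open>\<beta>\<close> is at most \<open>5/4\<close>.\<close>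

lemma parent_prob_sandwich:
  assumes "k \<noteq> 0"
  shows "1 / real k \<le> parent_prob k" "parent_prob k \<le> 5 / 4 * (1 / real k)"
proof -
  have k: "real k \<ge> 1" using assms by simp
  have d: "1 + \<beta> * real k > 0" using beta k by (simp add: add_pos_pos)
  have b: "parent_prob k = (1 + \<beta>) / (1 + \<beta> * real k)" using assms
    by (simp add: parent_prob_def max_def)
  have "1 * (1 + \<beta> * real k) \<le> (1 + \<beta>) * real k" using k by (simp add: algebra_simps)
  then have "1 \<le> (1 + \<beta>) * real k / (1 + \<beta> * real k)" using d by (subst pos_le_divide_eq) simp_all
  then show "1 / real k \<le> parent_prob k" unfolding b using k by (subst pos_divide_le_eq) simp_all
  have "(1 + \<beta>) * real k \<le> 5 / 4 * (\<beta> * real k)" using beta k by (simp add: algebra_simps)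
  then have "(1 + \<beta>) * real k \<le> 5 / 4 * (1 + \<beta> * real k)" by simp
  then show "parent_prob k \<le> 5 / 4 * (1 / real k)" unfolding b using d k
    by (subst pos_divide_le_eq) (simp_all add: field_simps)
qed

lemma mean_parent_prob_sandwich:
  "measure_pmf.expectation Q (\<lambda>k. 1 / real k) \<le> mean_parent_prob"
  "mean_parent_prob \<le> 5 / 4 * measure_pmf.expectation Q (\<lambda>k. 1 / real k)"
proof -
  have le1: "norm (1 / real k) \<le> 1" for k :: nat by (cases k) auto
  have i1: "integrable (measure_pmf Q) (\<lambda>k. 1 / real k)"
    using le1 by (intro measure_pmf.integrable_const_bound[where B = 1]) auto
  have i2: "integrable (measure_pmf Q) parent_prob"
    using parent_prob by (intro measure_pmf.integrable_const_bound[where B = 1]) auto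
  have AE: "AE k in measure_pmf Q. 1 / real k \<le> parent_prob k \<and> parent_prob k \<le> 5 / 4
      * (1 / real k)"
  proof (rule AE_pmfI)
    fix k assume "k \<in> set_pmf Q"
    then have "k \<noteq> 0" using Q0 by (intro notI) (simp add: set_pmf_iff)
    then show "1 / real k \<le> parent_prob k \<and> parent_prob k \<le> 5 / 4 * (1 / real k)"
      using parent_prob_sandwich by blast
  qed
  show "measure_pmf.expectation Q (\<lambda>k. 1 / real k) \<le> mean_parent_prob"
    unfolding mean_parent_prob_def using AE
      by (intro integral_mono_AE i1 i2) (auto elim!: eventually_mono)
  have "mean_parent_prob \<le> measure_pmf.expectation Q (\<lambda>k. 5 / 4 * (1 / real k))"
    unfolding mean_parent_prob_def using AE
      by (intro integral_mono_AE i2 integrable_mult_right i1) (auto elim!: eventually_mono)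
  then show "mean_parent_prob \<le> 5 / 4 * measure_pmf.expectation Q (\<lambda>k. 1 / real k)"
    by (simp only: integral_mult_right_zero)
qed

lemma lim_backstep_rate_le: "lim backstep_rate \<le> 6 * q * mean_parent_prob"
  using backstep_rate_convergent backstep_rate_le
    by (intro LIMSEQ_le_const2[of backstep_rate]) (auto simp: convergent_LIMSEQ_iff)

lemma lim_backstep_rate_ge: "lim backstep_rate \<ge> 3 / 4 * p * q * mean_parent_prob"
proof -
  have "(\<lambda>n. backstep_rate (Suc n)) \<longlonglongrightarrow> lim backstep_rate"
    using backstep_rate_convergent by (intro LIMSEQ_Suc) (simp add: convergent_LIMSEQ_iff)
  then show ?thesis using backstep_rate_ge
    by (intro LIMSEQ_le_const[of "\<lambda>n. backstep_rate (Suc n)"]) auto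
qed

end

section \<open>Harmonic moments of generation sizes\<close>

lemma length_generation: "u \<in> generation t n \<Longrightarrow> length u = n"
  by (induction n arbitrary: u) (auto simp: children_def)

lemma generation_cong:
  "(\<And>u. length u < n \<Longrightarrow> t u = t' u) \<Longrightarrow> generation t n = generation t' n"
proof (induction n)
  case (Suc n)
  then have "generation t n = generation t' n" by simp
  moreover have "children t u = children t' u" if "u \<in> generation t n" for u
    using Suc.prems[of u] length_generation[OF that] by (simp add: children_def)
  ultimately show ?case by simp
qed simp

lemma generation_size_Suc: "generation_size (Suc n) t = (\<Sum>u\<in>generation t n. t u)"
proof -
  have "card (\<Union>u\<in>generation t n. children t u) = (\<Sum>u\<in>generation t n. card (children t u))"
    by (rule card_UN_disjoint) (auto simp: children_def)
  then show ?thesis by (simp add: generation_size_def)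
qed

lemma generation_size_0 [simp]: "generation_size 0 t = 1"
  by (simp add: generation_size_def)

lemma generation_size_1: "generation_size 1 t = t []"
  using generation_size_Suc[of 0 t] by simp

lemma nn_integral_generation_law:
  "(\<integral>\<^sup>+k. f k \<partial>measure_pmf (generation_law P n)) = (\<integral>\<^sup>+t. f (generation_size n t) \<partial>GW P)"
  unfolding measure_pmf_generation_law
  by (rule nn_integral_distr[OF measurable_generation_size]) simp

text \<open>A one-step estimate for a function \<open>\<phi>\<close> of the population size, valid for a generation of
  any given shape \<open>A\<close>, is iterated along the generations. The \<open>n\<close>th generation is determined by offspring
  numbers of vertices of length less than \<open>n\<close>, hence independent of the offspring numbers of its own members.\<close>

lemma generation_recursion_le:
  fixes \<phi> :: "nat \<Rightarrow> ennreal"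
  assumes step: "\<And>A. finite A \<Longrightarrow> (\<integral>\<^sup>+t. \<phi> (\<Sum>u\<in>A. t u) \<partial>GW P) \<le> c * \<phi> (card A)"
  shows "(\<integral>\<^sup>+t. \<phi> (generation_size n t) \<partial>GW P) \<le> c ^ n * \<phi> 1"
proof (induction n)
  case 0
  interpret prob_space "GW P" by (rule prob_space_GW)
  show ?case using emeasure_space_1 by simp
next
  case (Suc n)
  \<comment> \<open>the expectation is split according to the vertex set A of the nth generation, a finite set of words\<close>
  let ?I = "\<lambda>t A. indicator {generation t n} A :: ennreal"
  let ?C = "count_space {A :: vertex set. finite A}"
  have single: "(\<integral>\<^sup>+A. ?I t A * f A \<partial>?C) = f (generation t n)" for t and f :: "vertex set \<Rightarrow> ennreal"
    by (subst mult.commute, subst nn_integral_indicator_singleton) auto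
  have mI[measurable]: "(\<lambda>t. ?I t A) \<in> borel_measurable (GW P)" for A
  proof -
    have "Measurable.pred (GW P) (\<lambda>t. \<forall>u. u \<in> generation t n \<longleftrightarrow> u \<in> A)" by measurable
    then have "{t. generation t n = A} \<in> sets (GW P)" by (simp add: pred_def set_eq_iff)
    moreover have "?I t A = indicator {t. generation t n = A} t" for t by (auto simp: indicator_def)
    ultimately show ?thesis by simp
  qed
  have [measurable]: "(\<lambda>t. \<phi> (\<Sum>u\<in>A. t u)) \<in> borel_measurable (GW P)" for A
  proof -
    have "(\<lambda>t. \<Sum>u\<in>A. t u) \<in> GW P \<rightarrow>\<^sub>M count_space UNIV" by measurable
    then show ?thesis by (rule measurable_compose) simp
  qed
  have split: "(\<integral>\<^sup>+t. ?I t A * \<phi> (\<Sum>u\<in>A. t u) \<partial>GW P) = (\<integral>\<^sup>+t. ?I t A \<partial>GW P)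
      * (\<integral>\<^sup>+t. \<phi> (\<Sum>u\<in>A. t u) \<partial>GW P)" for A
  proof (cases "\<forall>u\<in>A. length u = n")
    case True
    show ?thesis
    proof (rule GW_split[where A = "{u. length u < n}" and B = A])
      show "?I t A = ?I t' A" if "\<And>u. u \<in> {u. length u < n} \<Longrightarrow> t u = t' u" for t t'
        using generation_cong[of n t t'] that by simp
    qed (use True in \<open>auto intro!: arg_cong[of _ _ \<phi>] sum.cong\<close>)
  next
    case False
    then have "?I t A = 0" for t using length_generation by (auto simp: indicator_def)
    then show ?thesis by simp
  qed
  have cnt: "countable {A :: vertex set. finite A}" by (rule countable_Collect_finite)
  have "(\<integral>\<^sup>+t. \<phi> (generation_size (Suc n) t) \<partial>GW P)
      = (\<integral>\<^sup>+t. \<integral>\<^sup>+A. ?I t A * \<phi> (\<Sum>u\<in>A. t u) \<partial>?C \<partial>GW P)"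
    by (simp add: single generation_size_Suc)
  also have "\<dots> = (\<integral>\<^sup>+A. \<integral>\<^sup>+t. ?I t A * \<phi> (\<Sum>u\<in>A. t u) \<partial>GW P \<partial>?C)"
    by (rule nn_integral_count_space_nn_integral[OF cnt]) measurable
  also have "\<dots> \<le> (\<integral>\<^sup>+A. c * (\<integral>\<^sup>+t. ?I t A * \<phi> (card A) \<partial>GW P) \<partial>?C)"
  proof (rule nn_integral_mono)
    fix A :: "vertex set" assume "A \<in> space ?C"
    then have "(\<integral>\<^sup>+t. ?I t A \<partial>GW P) * (\<integral>\<^sup>+t. \<phi> (\<Sum>u\<in>A. t u) \<partial>GW P) \<le> (\<integral>\<^sup>+t. ?I t A \<partial>GW P)
        * (c * \<phi> (card A))"
      by (intro mult_left_mono step) auto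
    then show "(\<integral>\<^sup>+t. ?I t A * \<phi> (\<Sum>u\<in>A. t u) \<partial>GW P) \<le> c * (\<integral>\<^sup>+t. ?I t A * \<phi> (card A) \<partial>GW P)"
      unfolding split nn_integral_multc[OF mI] by (simp only: mult_ac)
  qed
  also have "\<dots> = c * (\<integral>\<^sup>+A. \<integral>\<^sup>+t. ?I t A * \<phi> (card A) \<partial>GW P \<partial>?C)"
    by (rule nn_integral_cmult) simp
  also have "(\<integral>\<^sup>+A. \<integral>\<^sup>+t. ?I t A * \<phi> (card A) \<partial>GW P \<partial>?C)
      = (\<integral>\<^sup>+t. \<integral>\<^sup>+A. ?I t A * \<phi> (card A) \<partial>?C \<partial>GW P)"
    by (rule nn_integral_count_space_nn_integral[OF cnt, symmetric]) measurable
  also have "\<dots> = (\<integral>\<^sup>+t. \<phi> (generation_size n t) \<partial>GW P)"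
    by (simp add: single generation_size_def)
  also have "c * \<dots> \<le> c * (c ^ n * \<phi> 1)" by (rule mult_left_mono[OF Suc]) simp
  finally show ?case by (simp add: mult.assoc)
qed

lemma generation_size_pos: "(\<And>u. t u > 0) \<Longrightarrow> generation_size n t > 0"
proof (induction n)
  case (Suc n)
  then have "generation t n \<noteq> {}" by (auto simp: generation_size_def)
  then show ?case unfolding generation_size_Suc using Suc.prems by (intro sum_pos) auto
qed simp

lemma pmf_generation_law_0:
  assumes "pmf P 0 = 0"
  shows "pmf (generation_law P n) 0 = 0"
proof -
  have "emeasure (measure_pmf (generation_law P n)) {0}
      = (\<integral>\<^sup>+t. indicator {0} (generation_size n t) \<partial>GW P)"
    by (subst nn_integral_generation_law[where f = "indicator {0}", symmetric]) simp
  also have "\<dots> = (\<integral>\<^sup>+t. 0 \<partial>GW P)"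
  proof (rule nn_integral_cong_AE, use AE_no_leaves[OF assms] in eventually_elim)
    case (elim t)
    then have "generation_size n t > 0" by (intro generation_size_pos) simp
    then show ?case by simp
  qed
  finally show ?thesis by (simp add: emeasure_pmf_single)
qed

lemma integral_GW_component:
  fixes f :: "nat \<Rightarrow> real"
  shows "integrable (GW P) (\<lambda>t. f (t u)) \<longleftrightarrow> integrable (measure_pmf P) f"
    and "(\<integral>t. f (t u) \<partial>GW P) = (\<integral>k. f k \<partial>measure_pmf P)"
proof -
  have comp: "distr (GW P) (measure_pmf P) (\<lambda>t. t u) = measure_pmf P"
    unfolding GW_def by (rule distr_PiM_component) (auto intro: measure_pmf.prob_space_axioms)
  have m: "(\<lambda>t. t u) \<in> GW P \<rightarrow>\<^sub>M measure_pmf P"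
    unfolding GW_def by (rule measurable_component_singleton) simp
  show "integrable (GW P) (\<lambda>t. f (t u)) \<longleftrightarrow> integrable (measure_pmf P) f"
    using integrable_distr_eq[OF m, of f] by (simp add: comp)
  show "(\<integral>t. f (t u) \<partial>GW P) = (\<integral>k. f k \<partial>measure_pmf P)"
    using integral_distr[OF m, of f] by (simp add: comp)
qed

lemma integrable_of_square:
  assumes "integrable (measure_pmf P) (\<lambda>k. (real k)\<^sup>2)"
  shows "integrable (measure_pmf P) real"
proof (rule Bochner_Integration.integrable_bound[OF assms])
  have "real k \<le> (real k)\<^sup>2" for k by (metis le_square of_nat_le_iff of_nat_power power2_eq_square)
  then show "AE k in measure_pmf P. norm (real k) \<le> norm ((real k)\<^sup>2)" by simp
qed simp

lemma sum_second_moment: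
  fixes v :: real
  assumes sq: "integrable (measure_pmf P) (\<lambda>k. (real k)\<^sup>2)" and A: "finite A"
  defines "v \<equiv> measure_pmf.expectation P (\<lambda>k. (real k - mean P)\<^sup>2)"
  shows "integrable (GW P) (\<lambda>t. (\<Sum>u\<in>A. real (t u) - mean P)\<^sup>2)" (is ?int)
    and "(\<integral>t. (\<Sum>u\<in>A. real (t u) - mean P)\<^sup>2 \<partial>GW P) = card A * v" (is ?eq)
proof -
  interpret prob_space "GW P" by (rule prob_space_GW)
  let ?Y = "\<lambda>u t. real (t u) - mean P"
  have int1: "integrable (measure_pmf P) real" by (rule integrable_of_square[OF sq])
  have intv: "integrable (measure_pmf P) (\<lambda>k. (real k - mean P)\<^sup>2)"
    unfolding power2_diff using sq int1
      by (intro Bochner_Integration.integrable_add Bochner_Integration.integrable_diff) auto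
  have indep: "indep_vars (\<lambda>_. borel) ?Y UNIV"
    using indep_vars_compose2[OF indep_vars_GW, of "\<lambda>_ k. real k - mean P" "\<lambda>_. borel"] by simp
  have Y: "integrable (GW P) (?Y u)" "expectation (?Y u) = 0" for u
  proof -
    show "integrable (GW P) (?Y u)"
      using integral_GW_component(1)[of P "\<lambda>k. real k - mean P" u] int1 by simp
    have "expectation (?Y u) = measure_pmf.expectation P (\<lambda>k. real k - mean P)"
      by (rule integral_GW_component(2))
    also have "\<dots> = 0" using int1 by (simp add: mean_def)
    finally show "expectation (?Y u) = 0" .
  qed
  have YY: "integrable (GW P) (\<lambda>t. ?Y u t * ?Y w t) \<and> expectation (\<lambda>t. ?Y u t * ?Y w t)
      = (if u = w then v else 0)" for u w
  proof (cases "u = w")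
    case True
    then show ?thesis
      using integral_GW_component[of P "\<lambda>k. (real k - mean P)\<^sup>2" u] intv
        by (simp add: power2_eq_square v_def)
  next
    case False
    have "indep_vars (\<lambda>_. borel) ?Y {u, w}" by (rule indep_vars_subset[OF indep]) simp
    from indep_vars_lebesgue_integral[OF _ this] indep_vars_integrable[OF _ this] Y False
        show ?thesis by simp
  qed
  show ?int unfolding power2_eq_square sum_product using YY
    by (intro Bochner_Integration.integrable_sum) auto
  have "(\<integral>t. (\<Sum>u\<in>A. ?Y u t)\<^sup>2 \<partial>GW P) = (\<Sum>u\<in>A. \<Sum>w\<in>A. expectation (\<lambda>t. ?Y u t * ?Y w t))"
    unfolding power2_eq_square sum_product using YY by simp
  also have "\<dots> = card A * v" using A YY by (simp add: sum.delta)
  finally show ?eq .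
qed

text \<open>The tangent of \<open>1 / s\<close> at \<open>a\<close> plus an exact remainder, in which one factor \<open>1 / s\<close> is bounded by
  \<open>1 / N\<close>.\<close>

lemma inverse_le_quadratic:
  fixes s a N :: real
  assumes "0 < N" "N \<le> s" "0 < a"
  shows "1 / s \<le> 1 / a - (s - a) / a\<^sup>2 + (s - a)\<^sup>2 / (N * a\<^sup>2)"
proof -
  have "1 / s - (1 / a - (s - a) / a\<^sup>2) = (s - a)\<^sup>2 / (s * a\<^sup>2)"
    using assms by (simp add: field_simps power2_eq_square)
  also have "\<dots> \<le> (s - a)\<^sup>2 / (N * a\<^sup>2)"
    using assms by (intro divide_left_mono mult_right_mono) auto
  finally show ?thesis by simp
qed

lemma mean_ge_1:
  assumes "pmf P 0 = 0" "integrable (measure_pmf P) real"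
  shows "mean P \<ge> 1"
proof -
  have "measure_pmf.expectation P (\<lambda>_. 1) \<le> measure_pmf.expectation P real"
  proof (rule integral_mono_AE)
    show "AE k in measure_pmf P. 1 \<le> real k"
    proof (rule AE_pmfI)
      fix k assume "k \<in> set_pmf P"
      then have "k \<noteq> 0" using assms(1) by (intro notI) (simp add: set_pmf_iff)
      then show "1 \<le> real k" by simp
    qed
  qed (use assms in auto)
  then show ?thesis by (simp add: mean_def)
qed

text \<open>In expectation the linear term of the tangent vanishes and the quadratic one is a variance. So the
  harmonic moment of a sum of \<open>N\<close> offspring numbers is \<open>1 / (N m)\<close> up to a relative error of order
  \<open>1 / N\<close>, without any large deviation estimate.\<close>

lemma harmonic_sum_le:
  fixes v :: real
  assumes P0: "pmf P 0 = 0" and sq: "integrable (measure_pmf P) (\<lambda>k. (real k)\<^sup>2)"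
    and A: "finite A" "A \<noteq> {}"
  defines "v \<equiv> measure_pmf.expectation P (\<lambda>k. (real k - mean P)\<^sup>2)"
  shows "(\<integral>\<^sup>+t. ennreal (1 / real (\<Sum>u\<in>A. t u)) \<partial>GW P) \<le>
    ennreal ((1 / mean P + v / (card A * (mean P)\<^sup>2)) / card A)"
proof -
  interpret prob_space "GW P" by (rule prob_space_GW)
  let ?N = "real (card A)" and ?m = "mean P"
  let ?S = "\<lambda>t. \<Sum>u\<in>A. real (t u)"
  let ?a = "?N * ?m"
  have int1: "integrable (measure_pmf P) real" by (rule integrable_of_square[OF sq])
  have N: "?N > 0" using A by (simp add: card_gt_0_iff)
  have m: "?m \<ge> 1" by (rule mean_ge_1[OF P0 int1])
  have a: "?a > 0" using N m by simp
  let ?g = "\<lambda>t. 1 / ?a - (\<Sum>u\<in>A. real (t u) - ?m) / ?a\<^sup>2 + (\<Sum>u\<in>A. real (t u) - ?m)\<^sup>2 / (?N * ?a\<^sup>2)"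
  have dev: "?S t - ?a = (\<Sum>u\<in>A. real (t u) - ?m)" for t by (simp add: sum_subtractf)
  have AE: "AE t in GW P. 1 / ?S t \<le> ?g t \<and> 0 \<le> ?g t"
    using AE_no_leaves[OF P0]
  proof eventually_elim
    case (elim t)
    have "(\<Sum>u\<in>A. 1) \<le> ?S t"
      by (intro sum_mono) (use elim in \<open>auto simp: Suc_le_eq\<close>)
    then have "?N \<le> ?S t" by simp
    from inverse_le_quadratic[OF N this a] have "1 / ?S t \<le> ?g t" by (simp only: dev)
    moreover have "0 \<le> 1 / ?S t" by (simp add: sum_nonneg)
    ultimately show ?case by linarith
  qed
  have intu: "integrable (GW P) (\<lambda>t. real (t u) - ?m)" "expectation (\<lambda>t. real (t u) - ?m) = 0" for u
    using integral_GW_component[of P "\<lambda>k. real k - ?m" u] int1 by (auto simp: mean_def)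
  have ints: "integrable (GW P) (\<lambda>t. \<Sum>u\<in>A. real (t u) - ?m)"
      "expectation (\<lambda>t. \<Sum>u\<in>A. real (t u) - ?m) = 0"
    using intu by auto
  note ints2 = sum_second_moment[OF sq A(1)]
  have intg: "integrable (GW P) ?g" using ints(1) ints2(1) by simp
  have "(\<integral>\<^sup>+t. ennreal (1 / real (\<Sum>u\<in>A. t u)) \<partial>GW P) \<le> (\<integral>\<^sup>+t. ennreal (?g t) \<partial>GW P)"
    using AE by (intro nn_integral_mono_AE) (auto elim!: eventually_mono intro: ennreal_leI)
  also have "\<dots> = ennreal (expectation ?g)"
    using AE by (intro nn_integral_eq_integral intg) (auto elim!: eventually_mono)
  also have "expectation ?g = 1 / ?a + ?N * v / (?N * ?a\<^sup>2)"
    using ints ints2 prob_space by (simp add: v_def)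
  also have "\<dots> = (1 / ?m + v / (?N * ?m\<^sup>2)) / ?N"
    using N m by (simp add: field_simps power2_eq_square)
  finally show ?thesis .
qed

text \<open>The population stays at its size only if every member has exactly one child, in particular if one
  chosen member has.\<close>

lemma penalty_sum_le:
  fixes pen :: "nat \<Rightarrow> real"
  assumes P0: "pmf P 0 = 0" and A: "finite A" "A \<noteq> {}"
    and anti: "\<And>k l. 1 \<le> k \<Longrightarrow> k \<le> l \<Longrightarrow> pen l \<le> pen k" and nonneg: "\<And>k. pen k \<ge> 0"
  shows "(\<integral>\<^sup>+t. ennreal (pen (\<Sum>u\<in>A. t u)) \<partial>GW P)
      \<le> ennreal (pmf P 1 * pen (card A) + pen (Suc (card A)))"
proof -
  obtain w where w: "w \<in> A" using A by blast
  have "(\<integral>\<^sup>+t. ennreal (pen (\<Sum>u\<in>A. t u)) \<partial>GW P) \<le>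
      (\<integral>\<^sup>+t. ennreal (pen (card A)) * indicator {1} (t w) + ennreal (pen (Suc (card A))) \<partial>GW P)"
  proof (rule nn_integral_mono_AE, use AE_no_leaves[OF P0] in eventually_elim)
    case (elim t)
    have ge: "card (A - {w}) \<le> (\<Sum>u\<in>A - {w}. t u)"
      using sum_mono[of "A - {w}" "\<lambda>_. 1 :: nat" t] elim by (simp add: Suc_le_eq)
    have S: "(\<Sum>u\<in>A. t u) = t w + (\<Sum>u\<in>A - {w}. t u)" using A w by (rule_tac sum.remove)
    have c: "card A = Suc (card (A - {w}))" using A w by (metis card_Suc_Diff1)
    show ?case
    proof (cases "t w = 1")
      case True
      then have "pen (\<Sum>u\<in>A. t u) \<le> pen (card A)" using ge S c by (intro anti) auto
      then show ?thesis using True nonneg by (auto intro!: add_increasing2 ennreal_leI)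
    next
      case False
      then have "t w \<ge> 2" using elim[rule_format, of w] by auto
      then have "pen (\<Sum>u\<in>A. t u) \<le> pen (Suc (card A))" using ge S c by (intro anti) auto
      then show ?thesis using False by (auto intro!: ennreal_leI)
    qed
  qed
  also have "\<dots> = ennreal (pen (card A)) * (\<integral>\<^sup>+t. indicator {1} (t w) \<partial>GW P)
      + ennreal (pen (Suc (card A)))"
  proof -
    interpret prob_space "GW P" by (rule prob_space_GW)
    have m[measurable]: "(\<lambda>t. indicator {1} (t w) :: ennreal) \<in> borel_measurable (GW P)"
      by (rule measurable_compose[OF measurable_GW_component]) simp
    have "(\<integral>\<^sup>+t. ennreal (pen (card A)) * indicator {1} (t w) + ennreal (pen (Suc (card A)))
        \<partial>GW P) =
        (\<integral>\<^sup>+t. ennreal (pen (card A)) * indicator {1} (t w) \<partial>GW P)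
            + (\<integral>\<^sup>+t. ennreal (pen (Suc (card A))) \<partial>GW P)"
      by (rule nn_integral_add) measurable
    then show ?thesis using emeasure_space_1 unfolding nn_integral_cmult[OF m] by simp
  qed
  also have "(\<integral>\<^sup>+t. indicator {1} (t w) \<partial>GW P) = ennreal (pmf P 1)"
    by (subst nn_integral_GW_component[where f = "indicator {1}"]) (simp add: emeasure_pmf_single)
  finally show ?thesis using nonneg by (simp add: ennreal_mult ennreal_plus mult.commute)
qed

text \<open>Two mechanisms compete in \<open>1 / Z\<^sub>n\<close>: either the population grows at its mean rate \<open>m\<close>, or it stays
  small, at the cost of a factor \<open>P{1}\<close> per generation. Accordingly \<open>E[1 / Z\<^sub>n]\<close> decays at least as fast as \<open>\<rho>\<^sup>n\<close> for every
  \<open>\<rho>\<close> above \<open>1 / m\<close> and \<open>P{1}\<close>. The proof exhibits a function \<open>\<phi> k = 1 / k + pen k\<close> of the population size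
  that contracts by \<open>\<rho>\<close> in each generation. Large populations contract by \<open>harmonic_sum_le\<close>. For the
  finitely many small sizes, \<open>pen\<close> dominates \<open>1 / k\<close> and falls off so steeply that only the
  possibility of not growing at all matters.\<close>

theorem harmonic_moment_decay:
  assumes P0: "pmf P 0 = 0" and sq: "integrable (measure_pmf P) (\<lambda>k. (real k)\<^sup>2)"
    and \<rho>: "pmf P 1 < \<rho>" "1 / mean P < \<rho>"
  obtains C where "C > 0" "\<And>n. (\<integral>\<^sup>+t. ennreal (1 / real (generation_size n t)) \<partial>GW P)
      \<le> ennreal (C * \<rho> ^ n)"
proof -
  define v where "v = measure_pmf.expectation P (\<lambda>k. (real k - mean P)\<^sup>2)"
  have int1: "integrable (measure_pmf P) real" by (rule integrable_of_square[OF sq])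
  have m: "mean P \<ge> 1" by (rule mean_ge_1[OF P0 int1])
  have v: "v \<ge> 0" unfolding v_def by (intro integral_nonneg_AE) auto
  have \<rho>0: "\<rho> > 0" using \<rho>(1) pmf_nonneg[of P 1] by linarith
  \<comment> \<open>the ratio of consecutive penalties: reaching the next size must be nearly free\<close>
  obtain L where L: "L \<ge> 1" "pmf P 1 + 1 / L < \<rho>"
  proof
    let ?L = "max 1 (2 / (\<rho> - pmf P 1))"
    have "1 / ?L \<le> 1 / (2 / (\<rho> - pmf P 1))" using \<rho> by (intro divide_left_mono) auto
    also have "\<dots> < \<rho> - pmf P 1" using \<rho> by simp
    finally show "pmf P 1 + 1 / ?L < \<rho>" by simp
  qed simp
  \<comment> \<open>beyond this size the variance term no longer matters\<close>
  obtain N0 :: nat where N0: "N0 \<ge> 1" "1 / mean P + v / (N0 * (mean P)\<^sup>2) \<le> \<rho>"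
  proof -
    obtain n :: nat where n: "real n > v / ((mean P)\<^sup>2 * (\<rho> - 1 / mean P))"
      using reals_Archimedean2 by blast
    have pos: "(mean P)\<^sup>2 * (\<rho> - 1 / mean P) > 0" using \<rho> m by auto
    have "v < real (Suc n) * ((mean P)\<^sup>2 * (\<rho> - 1 / mean P))"
    proof -
      have "v < real n * ((mean P)\<^sup>2 * (\<rho> - 1 / mean P))" using n
        by (simp only: pos_divide_less_eq[OF pos])
      also have "\<dots> \<le> real (Suc n) * ((mean P)\<^sup>2 * (\<rho> - 1 / mean P))"
        using pos by (intro mult_right_mono) auto
      finally show ?thesis .
    qed
    then have "v / (Suc n * (mean P)\<^sup>2) \<le> \<rho> - 1 / mean P"
      using m by (subst divide_le_eq) (auto simp: mult_ac)
    then show ?thesis by (intro that[of "Suc n"]) auto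
  qed
  \<comment> \<open>the part of the contraction that remains for absorbing 1 / k into the penalty\<close>
  define \<epsilon> where "\<epsilon> = \<rho> - pmf P 1 - 1 / L"
  have \<epsilon>: "\<epsilon> > 0" using L by (simp add: \<epsilon>_def)
  define pen where "pen k = (if k < N0 then (1 / \<epsilon>) * L ^ (N0 - k) else 0)" for k
  have pen0: "pen k \<ge> 0" for k using \<epsilon> L by (simp add: pen_def)
  have anti: "pen l \<le> pen k" if "k \<le> l" for k l
    using that L \<epsilon> by (auto simp: pen_def intro!: divide_right_mono power_increasing)
  have penS: "pen (Suc k) \<le> pen k / L" for k
  proof (cases "Suc k < N0")
    case True
    then have "N0 - k = Suc (N0 - Suc k)" by simp
    then show ?thesis using True L by (simp add: pen_def)
  qed (use pen0[of k] L in \<open>simp add: pen_def\<close>)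
  \<comment> \<open>the value at 0 makes the one-step estimate true for the empty generation as well\<close>
  define \<phi> where "\<phi> k = (if k = 0 then 0 else 1 / real k + pen k)" for k :: nat
  have \<phi>0: "\<phi> k \<ge> 0" for k using pen0 by (simp add: \<phi>_def)
  have step: "(\<integral>\<^sup>+t. ennreal (\<phi> (\<Sum>u\<in>A. t u)) \<partial>GW P) \<le> ennreal \<rho> * ennreal (\<phi> (card A))"
      if A: "finite A" for A
  proof (cases "A = {}")
    case False
    let ?N = "card A"
    have N: "?N \<ge> 1" using A False by (simp add: Suc_le_eq card_gt_0_iff)
    define h where "h = (if ?N < N0 then 1 else \<rho> / ?N)"
    have h0: "h \<ge> 0" using \<rho>0 by (simp add: h_def)
    have mS: "(\<lambda>t. \<Sum>u\<in>A. t u) \<in> GW P \<rightarrow>\<^sub>M count_space UNIV" by measurable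
    have "(\<integral>\<^sup>+t. ennreal (\<phi> (\<Sum>u\<in>A. t u)) \<partial>GW P) \<le>
        (\<integral>\<^sup>+t. ennreal (1 / real (\<Sum>u\<in>A. t u)) + ennreal (pen (\<Sum>u\<in>A. t u)) \<partial>GW P)"
    proof (rule nn_integral_mono)
      fix t
      have "ennreal (\<phi> k) \<le> ennreal (1 / real k + pen k)" for k
        using pen0 by (intro ennreal_leI) (simp add: \<phi>_def)
      also have "ennreal (1 / real k + pen k) = ennreal (1 / real k) + ennreal (pen k)" for k
        using pen0 by (intro ennreal_plus) auto
      finally show "ennreal (\<phi> (\<Sum>u\<in>A. t u)) \<le> ennreal (1 / real (\<Sum>u\<in>A. t u))
          + ennreal (pen (\<Sum>u\<in>A. t u))" .
    qed
    also have "\<dots> = (\<integral>\<^sup>+t. ennreal (1 / real (\<Sum>u\<in>A. t u)) \<partial>GW P)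
        + (\<integral>\<^sup>+t. ennreal (pen (\<Sum>u\<in>A. t u)) \<partial>GW P)"
      by (intro nn_integral_add measurable_compose[OF mS]) auto
    also have "\<dots> \<le> ennreal h + ennreal (pmf P 1 * pen ?N + pen (Suc ?N))"
    proof (intro add_mono)
      show "(\<integral>\<^sup>+t. ennreal (1 / real (\<Sum>u\<in>A. t u)) \<partial>GW P) \<le> ennreal h"
      proof (cases "?N < N0")
        case True
        interpret prob_space "GW P" by (rule prob_space_GW)
        have "1 / real n \<le> 1" for n :: nat by (cases n) auto
        then have "(\<integral>\<^sup>+t. ennreal (1 / real (\<Sum>u\<in>A. t u)) \<partial>GW P) \<le> (\<integral>\<^sup>+t. 1 \<partial>GW P)"
          by (intro nn_integral_mono) (metis ennreal_1 ennreal_leI)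
        then show ?thesis using True emeasure_space_1 by (simp add: h_def)
      next
        case nlt: False
        have "(1 / mean P + v / (?N * (mean P)\<^sup>2)) / ?N \<le> (1 / mean P + v / (N0 * (mean P)\<^sup>2)) / ?N"
          using nlt N0 m v by (intro divide_right_mono add_left_mono divide_left_mono
              mult_right_mono) auto
        also have "\<dots> \<le> \<rho> / ?N" using N0 by (intro divide_right_mono) auto
        finally show ?thesis
          using harmonic_sum_le[OF P0 sq A False] nlt
            by (auto simp: h_def v_def intro: order_trans ennreal_leI)
      qed
      show "(\<integral>\<^sup>+t. ennreal (pen (\<Sum>u\<in>A. t u)) \<partial>GW P) \<le> ennreal (pmf P 1 * pen ?N + pen (Suc ?N))"
        using anti pen0 by (intro penalty_sum_le[OF P0 A False])
    qed
    also have "\<dots> = ennreal (h + (pmf P 1 * pen ?N + pen (Suc ?N)))"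
      using h0 pen0 by (intro ennreal_plus[symmetric]) auto
    also have "\<dots> \<le> ennreal (\<rho> * \<phi> ?N)"
    proof (rule ennreal_leI)
      have "pmf P 1 * pen ?N + pen (Suc ?N) \<le> (\<rho> - \<epsilon>) * pen ?N"
        using penS[of ?N] by (simp add: \<epsilon>_def algebra_simps)
      moreover have "h \<le> \<epsilon> * pen ?N + \<rho> / ?N"
      proof (cases "?N < N0")
        case True
        have "1 \<le> L ^ (N0 - ?N)" using L by simp
        then show ?thesis using True \<epsilon> \<rho>0 by (simp add: h_def pen_def add_increasing2)
      qed (simp add: h_def pen_def)
      moreover have "\<rho> * \<phi> ?N = \<rho> / ?N + \<rho> * pen ?N" using N by (auto simp: \<phi>_def algebra_simps)
      ultimately show "h + (pmf P 1 * pen ?N + pen (Suc ?N)) \<le> \<rho> * \<phi> ?N"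
        by (simp add: algebra_simps)
    qed
    also have "\<dots> = ennreal \<rho> * ennreal (\<phi> ?N)" using \<rho>0 \<phi>0 by (intro ennreal_mult) auto
    finally show ?thesis .
  qed (simp add: \<phi>_def)
  show ?thesis
  proof (rule that[of "\<phi> 1"])
    show "\<phi> 1 > 0" using pen0[of 1] by (simp add: \<phi>_def)
    fix n
    have "(\<integral>\<^sup>+t. ennreal (1 / real (generation_size n t)) \<partial>GW P)
        \<le> (\<integral>\<^sup>+t. ennreal (\<phi> (generation_size n t)) \<partial>GW P)"
      using pen0 by (intro nn_integral_mono ennreal_leI) (auto simp: \<phi>_def)
    also have "\<dots> \<le> ennreal \<rho> ^ n * ennreal (\<phi> 1)"
      by (rule generation_recursion_le[where \<phi> = "\<lambda>k. ennreal (\<phi> k)"]) (rule step)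
    also have "\<dots> = ennreal (\<phi> 1 * \<rho> ^ n)"
      using \<rho>0 \<phi>0 by (simp add: ennreal_mult ennreal_power mult.commute)
    finally show "(\<integral>\<^sup>+t. ennreal (1 / real (generation_size n t)) \<partial>GW P) \<le> ennreal (\<phi> 1 * \<rho> ^ n)" .
  qed
qed

lemma generation_mean_le:
  assumes "integrable (measure_pmf P) real"
  shows "(\<integral>\<^sup>+k. ennreal (real k) \<partial>measure_pmf (generation_law P n)) \<le> ennreal (mean P ^ n)"
proof -
  have m: "mean P \<ge> 0" unfolding mean_def by (intro integral_nonneg_AE) auto
  have "(\<integral>\<^sup>+t. ennreal (real (generation_size n t)) \<partial>GW P) \<le> ennreal (mean P) ^ n
      * ennreal (real 1)"
  proof (rule generation_recursion_le)
    fix A :: "vertex set" assume "finite A"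
    have mu: "(\<lambda>t. ennreal (real (t u))) \<in> borel_measurable (GW P)" for u
      by (rule measurable_compose[OF measurable_GW_component]) simp
    have "(\<integral>\<^sup>+t. ennreal (real (\<Sum>u\<in>A. t u)) \<partial>GW P) = (\<integral>\<^sup>+t. (\<Sum>u\<in>A. ennreal (real (t u))) \<partial>GW P)"
      by (simp add: sum_ennreal)
    also have "\<dots> = (\<Sum>u\<in>A. \<integral>\<^sup>+t. ennreal (real (t u)) \<partial>GW P)" by (rule nn_integral_sum) (rule mu)
    also have "\<dots> = (\<Sum>u\<in>A. ennreal (mean P))"
      unfolding nn_integral_GW_component[where f = "\<lambda>k. ennreal (real k)"] mean_def
      by (intro sum.cong refl nn_integral_eq_integral assms) auto
    finally show "(\<integral>\<^sup>+t. ennreal (real (\<Sum>u\<in>A. t u)) \<partial>GW P) \<le> ennreal (mean P)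
        * ennreal (real (card A))"
      by (simp add: mult.commute ennreal_of_nat_eq_real_of_nat)
  qed
  then show ?thesis using m by (simp add: nn_integral_generation_law ennreal_power)
qed

text \<open>Jensen's inequality for \<open>1 / k\<close>, through its tangent at \<open>a = m\<^sup>n\<close>.\<close>

lemma harmonic_moment_ge:
  assumes P0: "pmf P 0 = 0" and int: "integrable (measure_pmf P) real"
  shows "measure_pmf.expectation (generation_law P n) (\<lambda>k. 1 / real k) \<ge> 1 / mean P ^ n"
proof -
  let ?Q = "generation_law P n"
  define a where "a = mean P ^ n"
  have "mean P \<ge> 1" by (rule mean_ge_1[OF assms])
  then have a: "a > 0" by (simp add: a_def)
  have intQ: "integrable (measure_pmf ?Q) real"
  proof (rule integrableI_bounded)
    show "(\<integral>\<^sup>+k. ennreal (norm (real k)) \<partial>measure_pmf ?Q) < \<infinity>"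
      using le_less_trans[OF generation_mean_le[OF int, of n]] by simp
  qed simp
  have "ennreal (measure_pmf.expectation ?Q real) \<le> ennreal a"
    using generation_mean_le[OF int, of n] nn_integral_eq_integral[OF intQ] by (simp add: a_def)
  then have EZ: "measure_pmf.expectation ?Q real \<le> a" using a by (simp add: ennreal_le_iff)
  have "1 / a = 2 / a - a / a\<^sup>2" using a by (simp add: field_simps power2_eq_square)
  also have "\<dots> \<le> 2 / a - measure_pmf.expectation ?Q real / a\<^sup>2"
    using EZ a by (intro diff_left_mono divide_right_mono) auto
  also have "\<dots> = measure_pmf.expectation ?Q (\<lambda>k. 2 / a - real k / a\<^sup>2)"
    using intQ by simp
  also have "\<dots> \<le> measure_pmf.expectation ?Q (\<lambda>k. 1 / real k)"
  proof (rule integral_mono_AE)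
    show "integrable (measure_pmf ?Q) (\<lambda>k. 2 / a - real k / a\<^sup>2)" using intQ by simp
    have "norm (1 / real k) \<le> 1" for k :: nat by (cases k) auto
    then show "integrable (measure_pmf ?Q) (\<lambda>k. 1 / real k)"
      by (intro measure_pmf.integrable_const_bound[where B = 1]) auto
    show "AE k in measure_pmf ?Q. 2 / a - real k / a\<^sup>2 \<le> 1 / real k"
    proof (rule AE_pmfI)
      fix k assume "k \<in> set_pmf ?Q"
      then have "k \<noteq> 0" using pmf_generation_law_0[OF P0, of n]
        by (intro notI) (simp add: set_pmf_iff)
      then have k: "real k > 0" by simp
      have "1 / real k - (2 / a - real k / a\<^sup>2) = (a - real k)\<^sup>2 / (real k * a\<^sup>2)"
        using a k by (simp add: field_simps power2_eq_square)
      also have "\<dots> \<ge> 0" using k by simp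
      finally show "2 / a - real k / a\<^sup>2 \<le> 1 / real k" by simp
    qed
  qed
  finally show ?thesis by (simp add: a_def)
qed

section \<open>Comparison of speeds\<close>

text \<open>The rates of backward steps are comparable to the harmonic moments with constants that are the same
  for both trees, so a sufficiently large ratio of the harmonic moments decides which walk is faster. The
  ratio \<open>25/2\<close> is \<open>6 / (3/4 * 4/5)\<close> times \<open>5/4\<close>.\<close>

theorem speed_less_if_harmonic_moments:
  assumes "\<beta> \<ge> 4" and "pmf Q1 0 = 0" and "pmf Q2 0 = 0"
    and less: "25 / 2 * measure_pmf.expectation Q1 (\<lambda>k. 1 / real k)
        < measure_pmf.expectation Q2 (\<lambda>k. 1 / real k)"
  shows "speed \<beta> Q2 < speed \<beta> Q1"
proof -
  interpret biased_walk \<beta> using assms by unfold_locales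
  interpret W1: biased_walk_on_leafless_GW \<beta> Q1 using assms by unfold_locales
  interpret W2: biased_walk_on_leafless_GW \<beta> Q2 using assms by unfold_locales
  have pq34: "3 / 4 * p * q * W2.mean_parent_prob \<ge> 3 / 5 * q * W2.mean_parent_prob"
    using pq W2.mean_parent_prob_nonneg by (intro mult_right_mono) auto
  have "10 * W1.mean_parent_prob < W2.mean_parent_prob"
    using W1.mean_parent_prob_sandwich(2) W2.mean_parent_prob_sandwich(1) less by linarith
  then have "(3 / 5 * q) * (10 * W1.mean_parent_prob) < (3 / 5 * q) * W2.mean_parent_prob"
    using pq by (intro mult_strict_left_mono) auto
  then have "lim W1.backstep_rate < lim W2.backstep_rate"
    using W1.lim_backstep_rate_le W2.lim_backstep_rate_ge pq34 by (simp add: algebra_simps)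
  then show ?thesis by (simp add: W1.speed_eq W2.speed_eq)
qed

lemma pmf_nat_expectation_sums:
  fixes f :: "nat \<Rightarrow> real"
  assumes "integrable (measure_pmf P) f"
  shows "(\<lambda>k. pmf P k * f k) sums measure_pmf.expectation P f"
proof -
  have "integrable (count_space UNIV) (\<lambda>k. pmf P k *\<^sub>R f k)"
    using assms unfolding measure_pmf_eq_density by (subst (asm) integrable_density) auto
  then have "(\<lambda>k. pmf P k *\<^sub>R f k) sums (\<integral>k. pmf P k *\<^sub>R f k \<partial>count_space UNIV)"
    by (rule sums_integral_count_space_nat)
  moreover have "(\<integral>k. pmf P k *\<^sub>R f k \<partial>count_space UNIV) = measure_pmf.expectation P f"
    unfolding measure_pmf_eq_density by (subst integral_density) auto
  ultimately show ?thesis by simp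
qed

lemma exponential_moment_imp_summable:
  assumes "integrable (measure_pmf P) (\<lambda>k. exp (\<theta> * real k))"
  shows "summable (\<lambda>k. pmf P k * exp \<theta> ^ k)"
  using sums_summable[OF pmf_nat_expectation_sums[OF assms]] by (simp only: exp_of_nat2_mult)

lemma deriv_gen_fun:
  assumes s: "summable (\<lambda>k. pmf P k * K ^ k)" and x: "\<bar>x\<bar> < \<bar>K\<bar>"
  shows "deriv (gen_fun P) x = (\<Sum>n. diffs (pmf P) n * x ^ n)"
  unfolding gen_fun_def[abs_def]
  by (intro DERIV_imp_deriv termdiffs_strong[where K = K] s) (use x in auto)

lemma deriv_gen_fun_0:
  assumes "summable (\<lambda>k. pmf P k * K ^ k)" "K > 1"
  shows "deriv (gen_fun P) 0 = pmf P 1"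
  using deriv_gen_fun[OF assms(1), of 0] assms(2) by (simp add: diffs_def)

lemma deriv_gen_fun_1:
  assumes s: "summable (\<lambda>k. pmf P k * K ^ k)" "K > 1" and int: "integrable (measure_pmf P) real"
  shows "deriv (gen_fun P) 1 = mean P"
proof -
  have "(\<lambda>n. diffs (pmf P) n * 1 ^ n) sums deriv (gen_fun P) 1"
  proof -
    have "summable (\<lambda>n. diffs (pmf P) n * 1 ^ n)"
      by (rule termdiff_converges[of _ K]) (use assms powser_inside[OF s(1)] in auto)
    then show ?thesis using deriv_gen_fun[OF s(1), of 1] s(2) by (simp add: summable_sums)
  qed
  then have "(\<lambda>n. real (Suc n) * pmf P (Suc n)) sums deriv (gen_fun P) 1" by (simp add: diffs_def)
  then have "(\<lambda>n. real n * pmf P n) sums deriv (gen_fun P) 1"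
    using sums_Suc_iff[of "\<lambda>n. real n * pmf P n"] by simp
  moreover have "(\<lambda>n. real n * pmf P n) sums mean P"
    using pmf_nat_expectation_sums[OF int] by (simp add: mean_def mult.commute)
  ultimately show ?thesis by (rule sums_unique2)
qed

text \<open>The mean of a law on the natural numbers is the sum of its tail probabilities.\<close>

lemma dominated_integrable:
  assumes dom: "stochastically_dominates P1 P2" and int: "integrable (measure_pmf P1) real"
  shows "integrable (measure_pmf P2) real"
proof -
  have tail: "(\<integral>\<^sup>+k. ennreal (real k) \<partial>measure_pmf P)
      = (\<Sum>j. ennreal (measure_pmf.prob P {Suc j..}))" for P
  proof -
    have "ennreal (real k) = (\<Sum>j. indicator {Suc j..} k)" for k
    proof -
      have "(\<Sum>j. indicator {Suc j..} k :: ennreal) = (\<Sum>j<k. indicator {Suc j..} k)"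
        by (rule suminf_finite) (auto simp: indicator_def)
      also have "\<dots> = (\<Sum>j<k. 1)" by (intro sum.cong) auto
      finally show ?thesis by (simp add: ennreal_of_nat_eq_real_of_nat)
    qed
    then have "(\<integral>\<^sup>+k. ennreal (real k) \<partial>measure_pmf P)
        = (\<Sum>j. \<integral>\<^sup>+k. indicator {Suc j..} k \<partial>measure_pmf P)"
      by (simp only:) (rule nn_integral_suminf, simp)
    then show ?thesis by (simp add: measure_pmf.emeasure_eq_measure)
  qed
  have "(\<integral>\<^sup>+k. ennreal (real k) \<partial>measure_pmf P2) \<le> (\<integral>\<^sup>+k. ennreal (real k) \<partial>measure_pmf P1)"
    unfolding tail using dom by (intro suminf_le ennreal_leI)
        (auto simp: stochastically_dominates_def)
  also have "\<dots> < \<infinity>" using int nn_integral_eq_integral[OF int] by simp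
  finally show ?thesis by (intro integrableI_bounded) auto
qed

theorem corollary5:
  fixes P1 P2 :: "nat pmf" and \<beta> :: real
  assumes "pmf P1 0 = 0" and "pmf P2 0 = 0"
    and "stochastically_dominates P1 P2" and "P1 \<noteq> P2"
    and "\<exists>\<theta>>0. integrable (GW P1) (\<lambda>t. exp (\<theta> * real (generation_size 1 t)))"
    and "mean P1 > mean P2 powr real_of_ereal (max (2 / alpha P1) (1 / alpha P1 + 1))"
    and "\<beta> > 23 / 4"
  shows "\<exists>k\<ge>1. speed \<beta> (generation_law P1 k) > speed \<beta> (generation_law P2 k)"
proof -
  obtain \<theta> where \<theta>: "\<theta> > 0" "integrable (GW P1) (\<lambda>t. exp (\<theta> * real (generation_size 1 t)))"
    using assms(5) by blast
  have int\<theta>: "integrable (measure_pmf P1) (\<lambda>k. exp (\<theta> * real k))"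
    using \<theta>(2) integral_GW_component(1)[of P1 "\<lambda>k. exp (\<theta> * real k)" "[]"]
    unfolding generation_size_1 by simp
  have sq: "integrable (measure_pmf P1) (\<lambda>k. (real k)\<^sup>2)"
  proof (rule Bochner_Integration.integrable_bound)
    show "integrable (measure_pmf P1) (\<lambda>k. 2 / \<theta>\<^sup>2 * exp (\<theta> * real k))" using int\<theta> by simp
    have "(real k)\<^sup>2 \<le> 2 / \<theta>\<^sup>2 * exp (\<theta> * real k)" for k
    proof -
      have "(\<theta> * real k)\<^sup>2 / 2 \<le> exp (\<theta> * real k)"
        using exp_lower_Taylor_quadratic[of "\<theta> * real k"] \<theta>
          by (smt (verit) mult_nonneg_nonneg of_nat_0_le_iff)
      then show ?thesis using \<theta> by (simp add: field_simps power2_eq_square)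
    qed
    then show "AE k in measure_pmf P1. norm ((real k)\<^sup>2) \<le> norm (2 / \<theta>\<^sup>2 * exp (\<theta> * real k))"
      using \<theta> by simp
  qed simp
  have int1: "integrable (measure_pmf P1) real" by (rule integrable_of_square[OF sq])
  have int2: "integrable (measure_pmf P2) real" by (rule dominated_integrable[OF assms(3) int1])
  have m2: "mean P2 \<ge> 1" by (rule mean_ge_1[OF assms(2) int2])
  have s: "summable (\<lambda>k. pmf P1 k * exp \<theta> ^ k)" by (rule exponential_moment_imp_summable[OF int\<theta>])
  have e\<theta>: "exp \<theta> > 1" using \<theta> by simp
  \<comment> \<open>the assumption on the means enters through two comparisons: the tree of P1 grows faster than that of
    P2, and it stagnates with a probability that decays faster than the population of P2 grows\<close>
  have key: "mean P2 < mean P1 \<and> pmf P1 1 < 1 / mean P2"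
  proof (cases "pmf P1 1 = 0")
    case True
    then have "alpha P1 = \<infinity>" by (simp add: alpha_def)
    then have "mean P2 < mean P1" using assms(6) m2
      by (simp add: zero_ereal_def one_ereal_def max_def)
    then show ?thesis using True m2 by simp
  next
    case False
    then have p1: "pmf P1 1 > 0" using pmf_nonneg[of P1 1] by linarith
    define a where "a = - ln (pmf P1 1) / ln (mean P1)"
    have a: "alpha P1 = ereal a"
      using False deriv_gen_fun_0[OF s e\<theta>] deriv_gen_fun_1[OF s e\<theta> int1]
        by (simp add: alpha_def a_def)
    have p1': "pmf P1 1 \<le> 1" by (rule pmf_le_1)
    have m1: "mean P1 \<ge> 1" by (rule mean_ge_1[OF assms(1) int1])
    show ?thesis
    proof (cases "a > 0")
      case True
      have "max (2 / alpha P1) (1 / alpha P1 + 1) = ereal (max (2 / a) (1 / a + 1))"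
        using True by (simp add: a max_def one_ereal_def)
      then have "real_of_ereal (max (2 / alpha P1) (1 / alpha P1 + 1)) = max (2 / a) (1 / a + 1)"
        by (simp only: real_of_ereal.simps)
      then have less: "mean P2 powr max (2 / a) (1 / a + 1) < mean P1" using assms(6)
        by (simp only:)
      have "mean P2 powr 1 \<le> mean P2 powr max (2 / a) (1 / a + 1)"
        using m2 True by (intro powr_mono max.coboundedI2) auto
      then have m12: "mean P2 < mean P1" using less m2 by simp
      have "mean P2 powr (2 / a) \<le> mean P2 powr max (2 / a) (1 / a + 1)"
        using m2 by (intro powr_mono) auto
      then have "ln (mean P2 powr (2 / a)) < ln (mean P1)"
        using less m1 m2 by (subst ln_less_cancel_iff) auto
      then have "2 / a * ln (mean P2) < ln (mean P1)" using m2 by (simp add: ln_powr)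
      then have "2 * ln (mean P2) < a * ln (mean P1)" using True by (simp add: field_simps)
      also have "\<dots> = - ln (pmf P1 1)" using m12 m2 by (simp add: a_def)
      finally have "ln (mean P2) < - ln (pmf P1 1)" using m2 ln_ge_zero[of "mean P2"] by linarith
      then have "ln (pmf P1 1) < ln (1 / mean P2)" using m2 by (simp add: ln_div)
      then show ?thesis using m12 p1 m2 by (subst (asm) ln_less_cancel_iff) auto
    next
      case False
      have "a \<ge> 0" unfolding a_def using p1 p1' m1 by (intro divide_nonneg_nonneg) auto
      \<comment> \<open>here P1 would be concentrated at 1, and the exponent is the real value 0 of infinity\<close>
      then have a0: "a = 0" using False by simp
      then have "max (2 / alpha P1) (1 / alpha P1 + 1) = \<infinity>"
        unfolding a by (simp add: max_def divide_ereal_def)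
      then have m1': "mean P1 > 1" using assms(6) m2 by simp
      then have "pmf P1 1 = 1" using a0 p1 by (auto simp: a_def)
      then have "AE k in measure_pmf P1. k \<in> {1}"
        by (intro measure_pmf.AE_prob_1) (simp add: measure_pmf_single)
      then have "P1 = return_pmf 1"
        by (simp add: AE_measure_pmf_iff set_pmf_subset_singleton[symmetric] subset_iff)
      then have "mean P1 = 1" by (simp add: mean_def)
      then show ?thesis using m1' by simp
    qed
  qed
  have "max (pmf P1 1) (1 / mean P1) < 1 / mean P2"
    using key m2 by (auto simp: frac_less2)
  then obtain \<rho> where \<rho>: "pmf P1 1 < \<rho>" "1 / mean P1 < \<rho>" "\<rho> < 1 / mean P2"
    using dense by (metis max_less_iff_conj)
  obtain C where C: "C > 0"
      "\<And>n. (\<integral>\<^sup>+t. ennreal (1 / real (generation_size n t)) \<partial>GW P1) \<le> ennreal (C * \<rho> ^ n)"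
    using harmonic_moment_decay[OF assms(1) sq \<rho>(1,2)] by blast
  have \<rho>0: "\<rho> \<ge> 0" using \<rho>(1) pmf_nonneg[of P1 1] by linarith
  have r: "0 \<le> \<rho> * mean P2" "\<rho> * mean P2 < 1" using \<rho>0 \<rho>(3) m2 by (auto simp: pos_less_divide_eq)
  have "(\<lambda>n. 25 / 2 * C * (\<rho> * mean P2) ^ n) \<longlonglongrightarrow> 25 / 2 * C * 0"
    using r by (intro tendsto_mult tendsto_const LIMSEQ_power_zero) auto
  then have "eventually (\<lambda>n. 25 / 2 * C * (\<rho> * mean P2) ^ n < 1) sequentially"
    by (rule order_tendstoD(2)) simp
  then have "eventually (\<lambda>n. 25 / 2 * C * (\<rho> * mean P2) ^ n < 1 \<and> n \<ge> 1) sequentially"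
    using eventually_ge_at_top[of 1] by (rule eventually_conj)
  then obtain k where k: "25 / 2 * C * (\<rho> * mean P2) ^ k < 1" "k \<ge> 1"
    unfolding eventually_sequentially by blast
  have "measure_pmf.expectation (generation_law P1 k) (\<lambda>j. 1 / real j) \<le> C * \<rho> ^ k"
  proof -
    have "norm (1 / real j) \<le> 1" for j :: nat by (cases j) auto
    then have "integrable (measure_pmf (generation_law P1 k)) (\<lambda>j. 1 / real j)"
      by (intro measure_pmf.integrable_const_bound[where B = 1]) auto
    then have "ennreal (measure_pmf.expectation (generation_law P1 k) (\<lambda>j. 1 / real j)) =
        (\<integral>\<^sup>+t. ennreal (1 / real (generation_size k t)) \<partial>GW P1)"
      by (subst nn_integral_eq_integral[symmetric])
        (auto simp: nn_integral_generation_law[where f = "\<lambda>j. ennreal (1 / real j)"])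
    then show ?thesis using C \<rho>0
      by (metis ennreal_le_iff less_imp_le mult_nonneg_nonneg zero_le_power)
  qed
  then have "25 / 2 * measure_pmf.expectation (generation_law P1 k) (\<lambda>j. 1 / real j) \<le> 25 / 2 * C
      * \<rho> ^ k"
    by simp
  also have "\<dots> < 1 / mean P2 ^ k"
    using k(1) m2 by (simp add: pos_less_divide_eq power_mult_distrib mult_ac)
  also have "\<dots> \<le> measure_pmf.expectation (generation_law P2 k) (\<lambda>j. 1 / real j)"
    by (rule harmonic_moment_ge[OF assms(2) int2])
  finally have "speed \<beta> (generation_law P2 k) < speed \<beta> (generation_law P1 k)"
    using assms(1,2,7) by (intro speed_less_if_harmonic_moments pmf_generation_law_0) auto
  then show ?thesis using k(2) by blast
qed

end
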